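(* For $z > 0$ and $N \ge 1$ let \[ D_z(N) = \max_{A} \frac{\sum_{a \in A} z^{\Omega(a)}/a}{\sum_{n \le N} z^{\Omega(n)}/n}, \] the maximum over all primitive sets $A \subseteq \{1, 2, \ldots, N\}$. Then: (A) for each $0 < z < 2$, $D_z(N) \sim (2\pi z \log\log N)^{-1/2}$ as $N \to \infty$; (B) $D_2(N) \asymp (\log N)^{-1}$ as $N \to \infty$; (C) for each $z > 2$ there exist $C > 0$ and $N_0$ such that $D_z(N) \ge C$ for all $N > N_0$; one can take $N_0 = 4$ and $C = (1 - 2/z)/3$.
   Context: A set $A \subseteq \mathbb{N}$ is primitive if for $a_1, a_2 \in A$, $a_1 \mid a_2$ implies $a_1 = a_2$. $\Omega(n)$ is the number of prime factors of $n$ counted with multiplicity. *)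

theory Defs
  imports
    "HOL-Computational_Algebra.Computational_Algebra"
    "HOL-Library.Landau_Symbols"
    Complex_Main
begin

definition primitive_set :: "nat set \<Rightarrow> bool" where
  "primitive_set A \<longleftrightarrow> (\<forall>a\<^sub>1\<in>A. \<forall>a\<^sub>2\<in>A. a\<^sub>1 dvd a\<^sub>2 \<longrightarrow> a\<^sub>1 = a\<^sub>2)"

definition Omega :: "nat \<Rightarrow> nat" where
  "Omega n = size (prime_factorization n)"

definition weight_sum :: "real \<Rightarrow> nat set \<Rightarrow> real" where
  "weight_sum z A = (\<Sum>a\<in>A. z ^ Omega a / real a)"

definition max_density :: "real \<Rightarrow> nat \<Rightarrow> real" where
  "max_density z N =
     Max ((\<lambda>A. weight_sum z A / weight_sum z {1..N}) ` {A. A \<subseteq> {1..N} \<and> primitive_set A})"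

lemma max_density_wf:
  "finite {A. A \<subseteq> {1..N} \<and> primitive_set A}"
  "{A. A \<subseteq> {1..N} \<and> primitive_set A} \<noteq> {}"
  by (auto simp: primitive_set_def)

end

theory Submission
  imports Defs "HOL-Analysis.Analysis" "HOL-Real_Asymp.Real_Asymp"
begin

text \<open>Write \<open>w n = z ^ Omega n / n\<close>, a completely multiplicative weight.

  For \<open>z \<ge> 2\<close> everything is governed by the chains \<open>m, 2m, 4m, \<dots>\<close> with \<open>m\<close> odd, along which
  the weight grows like \<open>(z/2)\<^sup>j\<close>. The primitive set \<open>(N/2, N]\<close> picks the top of each chain, which
  gives the lower bounds; a primitive set meets each chain at most once, which gives the upper bound
  for \<open>z = 2\<close>.

  For \<open>z < 2\<close> factor \<open>n = s r\<close>, where \<open>s\<close> consists of the primes in \<open>(1/\<delta>, N\<^sup>d]\<close>,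
  \<open>d = \<delta>\<^sup>2\<close>. Up to factors \<open>1 + O(\<delta>)\<close> the constraint \<open>n \<le> N\<close> only concerns \<open>r\<close>, because \<open>s\<close> is
  rarely larger than \<open>N\<^sup>\<delta>\<close> and \<open>\<Sum>n\<le>x. w n\<close> is insensitive to replacing \<open>x\<close> by \<open>x powr (1 + \<delta>)\<close>;
  and \<open>Omega s\<close> is Poisson distributed with parameter \<open>l = \<Sum> z/p \<sim> z ln (ln N)\<close>. For fixed \<open>r\<close>
  the cofactors \<open>s\<close> of a primitive set form a primitive set, so by a LYM inequality they have
  proportion at most the largest Poisson probability, \<open>(2 \<pi> l) powr (-1/2)\<close> by Stirling's formula.
  The level set \<open>Omega n = \<lfloor>l\<rfloor>\<close> attains this, because \<open>Omega r\<close> is almost always bounded.\<close>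

section \<open>Smooth parts and completely multiplicative weights\<close>

text \<open>No asymptotic formula for \<open>\<Sum>n\<le>x. w n\<close> is used, only its slow
  variation. This comes from Chebyshev's bound: multiply the weights by \<open>ln n\<close>, expand
  \<open>ln n\<close> over the prime powers dividing \<open>n\<close>, and exchange the sums. The
  same device shows that the elements of a set of \<open>s\<close> beyond
  \<open>N\<^sup>\<delta>\<close> carry at most
  \<open>O (ln (N\<^sup>d) / ln (N\<^sup>\<delta>))\<close> times the largest weight of its sets of
  cofactors. The choice \<open>d = \<delta>\<^sup>2\<close> makes this factor
  \<open>O(\<delta>)\<close>. For a level set, the cofactors by a prime power form a level set
  again, so the loss is \<open>O(\<delta>)\<close> times the Poisson maximum and not times the full
  mass, which is larger by a factor of order \<open>sqrt l\<close>. \<open>Omega r\<close> is under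
  control because \<open>n \<le> N\<close> has at most \<open>1/\<delta>\<^sup>2\<close> prime
  factors above \<open>N\<^sup>d\<close>, while the finitely many primes up to
  \<open>1/\<delta>\<close> rarely occur with high multiplicity. The limit
  \<open>N \<rightarrow> \<infinity>\<close> is taken for fixed \<open>\<delta>\<close>, and
  \<open>\<delta> \<rightarrow> 0\<close> afterwards. Hence thresholds may depend on
  \<open>\<delta>\<close> in any way, but the constants in the error terms
  \<open>O(\<delta>)\<close> may not.\<close>

definition smooth :: "nat set \<Rightarrow> nat set" where
  "smooth P = {n. n > 0 \<and> prime_factors n \<subseteq> P}"

text \<open>Read off from the multiset of prime factors, so that it is multiplicative by
  construction. At \<open>n = 0\<close> the multiset is empty and the value is 1, hence it is always
  positive.\<close>

definition smooth_part :: "nat set \<Rightarrow> nat \<Rightarrow> nat" where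
  "smooth_part P n = prod_mset (filter_mset (\<lambda>p. p \<in> P) (prime_factorization n))"

lemma Omega_mult: "m > 0 \<Longrightarrow> n > 0 \<Longrightarrow> Omega (m * n) = Omega m + Omega n"
  by (simp add: Omega_def prime_factorization_mult)

lemma Omega_1 [simp]: "Omega (Suc 0) = 0"
  by (simp add: Omega_def)

lemma Omega_prime_power: "prime p \<Longrightarrow> Omega (p ^ j) = j"
  by (simp add: Omega_def prime_factorization_prime_power)

lemma Omega_prime: "prime p \<Longrightarrow> Omega p = 1"
  using Omega_prime_power[of p 1] by simp

lemma Omega_eq_0: "n > 0 \<Longrightarrow> Omega n = 0 \<Longrightarrow> n = 1"
  by (auto simp: Omega_def prime_factorization_empty_iff)

lemma smooth_pos: "n \<in> smooth P \<Longrightarrow> n > 0"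
  by (simp add: smooth_def)

lemma smooth_prime_dvd: "n \<in> smooth P \<Longrightarrow> prime p \<Longrightarrow> p dvd n \<Longrightarrow> p \<in> P"
  by (auto simp: smooth_def prime_factors_dvd)

lemma smoothI: "n > 0 \<Longrightarrow> (\<And>p. prime p \<Longrightarrow> p dvd n \<Longrightarrow> p \<in> P) \<Longrightarrow> n \<in> smooth P"
  by (auto simp: smooth_def prime_factors_dvd)

lemma smooth_mult_iff: "m * n \<in> smooth P \<longleftrightarrow> m \<in> smooth P \<and> n \<in> smooth P"
  by (auto simp: smooth_def prime_factors_product)

lemma smooth_dvd: "n \<in> smooth P \<Longrightarrow> d dvd n \<Longrightarrow> d \<in> smooth P"
  by (metis dvd_def smooth_mult_iff)

lemma smooth_empty: "smooth {} = {1}"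
  by (auto simp: smooth_def prime_factorization_empty_iff)

lemma smooth_mono: "P \<subseteq> Q \<Longrightarrow> smooth P \<subseteq> smooth Q"
  by (auto simp: smooth_def)

lemma prime_factorization_part:
  "prime_factorization (smooth_part P n) = filter_mset (\<lambda>p. p \<in> P) (prime_factorization n)"
  unfolding smooth_part_def by (rule prime_factorization_prod_mset_primes) auto

lemma smooth_part_pos: "smooth_part P n > 0"
  unfolding smooth_part_def by (auto simp: prod_mset_zero_iff intro!: Nat.gr0I)

lemma smooth_part_smooth: "smooth_part P n \<in> smooth P"
  by (auto simp: smooth_def smooth_part_pos prime_factorization_part)

lemma smooth_part_mult_compl:
  assumes "n > 0" shows "smooth_part P n * smooth_part (-P) n = n"
proof -
  have "smooth_part P n * smooth_part (-P) n = prod_mset (prime_factorization n)"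
    unfolding smooth_part_def Compl_iff prod_mset.union [symmetric]
    by (subst multiset_partition [symmetric]) (rule refl)
  then show ?thesis using assms by (simp add: prod_mset_prime_factorization)
qed

lemma smooth_part_of_smooth: "n \<in> smooth P \<Longrightarrow> smooth_part P n = n"
proof -
  assume n: "n \<in> smooth P"
  then have "filter_mset (\<lambda>p. p \<in> P) (prime_factorization n) = prime_factorization n"
    by (intro filter_mset_eq_conv[THEN iffD2]) (auto simp: smooth_def)
  with n show ?thesis
    by (simp add: smooth_part_def prod_mset_prime_factorization smooth_def)
qed

lemma smooth_part_of_compl_smooth: "n \<in> smooth (-P) \<Longrightarrow> smooth_part P n = 1"
proof -
  assume n: "n \<in> smooth (-P)"
  then have "filter_mset (\<lambda>p. p \<in> P) (prime_factorization n) = {#}"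
    by (auto simp: smooth_def filter_mset_eq_mempty_iff)
  then show ?thesis by (simp only: smooth_part_def prod_mset_empty)
qed

lemma smooth_part_mult: "m > 0 \<Longrightarrow> n > 0 \<Longrightarrow> smooth_part P (m * n) = smooth_part P m * smooth_part P n"
  by (simp add: smooth_part_def prime_factorization_mult)

text \<open>This is uniqueness of the factorization into a part built from \<open>P\<close> and a
  part free of \<open>P\<close>; it makes \<open>(s, r) \<mapsto> s * r\<close> injective.\<close>

lemma smooth_part_prod:
  assumes "s \<in> smooth P" "r \<in> smooth (-P)"
  shows "smooth_part P (s * r) = s" "smooth_part (-P) (s * r) = r"
  using assms smooth_part_of_smooth[of s P] smooth_part_of_smooth[of r "-P"] smooth_part_of_compl_smooth[of r P]
    smooth_part_of_compl_smooth[of s "-P"] by (auto simp: smooth_part_mult smooth_pos)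

lemma smooth_part_dvd: "n > 0 \<Longrightarrow> smooth_part P n dvd n"
  by (metis dvd_triv_left smooth_part_mult_compl)

lemma smooth_part_le: "n > 0 \<Longrightarrow> smooth_part P n \<le> n"
  using smooth_part_dvd dvd_imp_le by blast

text \<open>Cancelling the common factor \<open>r\<close> preserves divisibility in both directions.
  The set \<open>S\<close> is left open because the lemma is applied to smooth, to squarefree and to
  arbitrary cofactors.\<close>

lemma primitive_fiber:
  assumes "primitive_set A" "r > 0" shows "primitive_set {s \<in> S. s * r \<in> A}"
  unfolding primitive_set_def
proof (intro ballI impI)
  fix a b assume ab: "a \<in> {s \<in> S. s * r \<in> A}" "b \<in> {s \<in> S. s * r \<in> A}" "a dvd b"
  then have "a * r dvd b * r" by (intro mult_dvd_mono) auto
  then have "a * r = b * r" using ab assms(1) unfolding primitive_set_def by blast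
  then show "a = b" using assms(2) by simp
qed

text \<open>A proper multiple has strictly more prime factors, so a level set of
  \<open>Omega\<close> is an antichain for divisibility.\<close>

lemma primitive_level:
  assumes "\<And>a. a \<in> A \<Longrightarrow> a > 0 \<and> Omega a = k" shows "primitive_set A"
  unfolding primitive_set_def
proof (intro ballI impI)
  fix a b assume ab: "a \<in> A" "b \<in> A" "a dvd b"
  then obtain c where c: "b = a * c" by (auto elim: dvdE)
  have "c > 0" using assms[OF ab(2)] c by (cases c) auto
  then have "Omega c = 0" using assms[OF ab(1)] assms[OF ab(2)] c Omega_mult[of a c] by simp
  then show "a = b" using Omega_eq_0 \<open>c > 0\<close> c by simp
qed

text \<open>Kept abstract because four weights are used: \<open>omega_weight z\<close>, its
  restriction \<open>odd_weight\<close> to odd numbers, \<open>recip_weight s\<close>, and the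
  square of a given weight.\<close>

locale multiplicative_weight =
  fixes f :: "nat \<Rightarrow> real"
  assumes f_mult: "f (m * n) = f m * f n"
    and f_1: "f 1 = 1"
    and f_nonneg: "f n \<ge> 0"
begin

lemma f_power: "f (p ^ j) = f p ^ j"
  by (induction j) (use f_1 in \<open>auto simp: f_mult\<close>)

text \<open>Grouping by the \<open>P\<close>-free part \<open>r\<close> reduces a sum over
  \<open>F\<close> to the fibres of smooth cofactors, on which properties such as primitivity
  survive.\<close>

lemma sum_split:
  assumes "finite F" "F \<subseteq> {0<..}"
  shows "sum f F = (\<Sum>r\<in>smooth_part (-P) ` F. f r * sum f {s \<in> smooth P. s * r \<in> F})"
proof -
  have "sum f F = (\<Sum>r\<in>smooth_part (-P) ` F. sum f {n \<in> F. smooth_part (-P) n = r})"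
    using assms by (intro sum.image_gen)
  also have "\<dots> = (\<Sum>r\<in>smooth_part (-P) ` F. f r * sum f {s \<in> smooth P. s * r \<in> F})"
  proof (intro sum.cong refl)
    fix r assume r: "r \<in> smooth_part (-P) ` F"
    then have r': "r \<in> smooth (-P)" using smooth_part_smooth by auto
    have "{n \<in> F. smooth_part (-P) n = r} = (\<lambda>s. s * r) ` {s \<in> smooth P. s * r \<in> F}"
    proof safe
      fix n assume n: "n \<in> F" "r = smooth_part (-P) n"
      then show "n \<in> (\<lambda>s. s * smooth_part (-P) n) ` {s \<in> smooth P. s * smooth_part (-P) n \<in> F}"
        using assms smooth_part_mult_compl[of n P] smooth_part_smooth[of P n]
        by (intro image_eqI[of _ _ "smooth_part P n"]) auto
    next
      fix s assume "s \<in> smooth P"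
      with r' show "smooth_part (-P) (s * r) = r" using smooth_part_prod by blast
    qed
    then have "sum f {n \<in> F. smooth_part (-P) n = r} = sum f ((\<lambda>s. s * r) ` {s \<in> smooth P. s * r \<in> F})"
      by simp
    also have "\<dots> = sum (\<lambda>s. f (s * r)) {s \<in> smooth P. s * r \<in> F}"
      using smooth_pos[OF r'] by (subst sum.reindex) (auto simp: inj_on_def)
    finally show "sum f {n \<in> F. smooth_part (-P) n = r} = f r * sum f {s \<in> smooth P. s * r \<in> F}"
      by (simp add: f_mult sum_distrib_left mult.commute)
  qed
  finally show ?thesis .
qed

text \<open>Distinct pairs give distinct products by unique factorization, and the weights are
  nonnegative. The range \<open>H r\<close> of cofactors may vary with \<open>r\<close>, as it must
  when \<open>Omega (s * r)\<close> or the top of a chain is prescribed.\<close>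

lemma sum_prod_le:
  assumes F: "finite F" and G: "finite G" "G \<subseteq> smooth (-P)"
    and H: "\<And>r. r \<in> G \<Longrightarrow> H r \<subseteq> smooth P"
    and sub: "\<And>r s. r \<in> G \<Longrightarrow> s \<in> H r \<Longrightarrow> s * r \<in> F"
  shows "(\<Sum>r\<in>G. f r * sum f (H r)) \<le> sum f F"
proof -
  have fin: "finite (H r)" if "r \<in> G" for r
  proof -
    have "(\<lambda>s. s * r) ` H r \<subseteq> F" using sub that by auto
    then have "finite ((\<lambda>s. s * r) ` H r)" using F finite_subset by blast
    moreover have "inj_on (\<lambda>s. s * r) (H r)"
      using smooth_pos[of r "-P"] G(2) that by (auto simp: inj_on_def)
    ultimately show ?thesis using finite_imageD by blast
  qed
  have "(\<Sum>r\<in>G. f r * sum f (H r)) = (\<Sum>r\<in>G. \<Sum>s\<in>H r. f (s * r))"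
    by (simp add: f_mult sum_distrib_left mult.commute)
  also have "\<dots> = (\<Sum>(r,s)\<in>Sigma G H. f (s * r))"
    using G fin by (subst sum.Sigma) auto
  also have "\<dots> = sum f ((\<lambda>(r,s). s * r) ` Sigma G H)"
  proof (subst sum.reindex)
    show "inj_on (\<lambda>(r,s). s * r) (Sigma G H)"
    proof (rule inj_onI, clarify)
      fix r s r' s' assume *: "r \<in> G" "s \<in> H r" "r' \<in> G" "s' \<in> H r'" "s * r = s' * r'"
      then have "r \<in> smooth (-P)" "r' \<in> smooth (-P)" "s \<in> smooth P" "s' \<in> smooth P"
        using G H by auto
      then show "r = r' \<and> s = s'" using smooth_part_prod *(5) by metis
    qed
  qed (auto simp: case_prod_unfold)
  also have "\<dots> \<le> sum f F"
    using F sub by (intro sum_mono2) (auto simp: f_nonneg)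
  finally show ?thesis .
qed

lemma geometric_prime_le:
  assumes p: "prime p" "f p < 1" and F: "finite F" "F \<subseteq> smooth {p}"
  shows "sum f F \<le> 1 / (1 - f p)"
proof -
  have "\<exists>j. n = p ^ j" if "n \<in> F" for n
  proof -
    have "prime_factors n \<subseteq> {p}" "n > 0" using that F by (auto simp: smooth_def)
    then have "n = (\<Prod>q\<in>prime_factors n. q ^ multiplicity q n)"
      by (simp add: prime_factorization_nat)
    then show ?thesis using \<open>prime_factors n \<subseteq> {p}\<close>
      by (cases "prime_factors n = {}") (force simp: subset_singleton_iff intro: exI[of _ 0])+
  qed
  then have sub: "F \<subseteq> range (\<lambda>j. p ^ j)" by auto
  then obtain J where J: "F = (\<lambda>j. p ^ j) ` J" by (auto simp: subset_image_iff)
  have inj: "inj (\<lambda>j. p ^ j)" using p prime_gt_1_nat by (auto simp: inj_on_def)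
  have finJ: "finite J" using F(1) J inj by (metis finite_imageD inj_on_subset subset_UNIV)
  have "sum f F = (\<Sum>j\<in>J. f p ^ j)"
    unfolding J using inj by (subst sum.reindex) (auto simp: inj_on_def f_power)
  also have "\<dots> \<le> (\<Sum>j. f p ^ j)"
    using p f_nonneg[of p] finJ by (intro sum_le_suminf summable_geometric) auto
  also have "\<dots> = 1 / (1 - f p)" using p f_nonneg[of p] by (intro suminf_geometric) auto
  finally show ?thesis .
qed

text \<open>One prime is split off at a time and contributes a geometric series. Bounding all finite
  partial sums avoids any discussion of convergence over \<open>smooth P\<close>.\<close>

lemma euler_product_le:
  assumes "finite P" "\<And>p. p \<in> P \<Longrightarrow> prime p \<and> f p < 1" "finite F" "F \<subseteq> smooth P"
  shows "sum f F \<le> (\<Prod>p\<in>P. 1 / (1 - f p))"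
  using assms
proof (induction P arbitrary: F)
  case empty
  then have "F \<subseteq> {1}" by (simp add: smooth_empty)
  then show ?case using f_1 by (auto simp: subset_singleton_iff)
next
  case (insert p P)
  have Fpos: "F \<subseteq> {0<..}" using insert.prems smooth_pos by auto
  have pf: "0 < 1 - f p" using insert.prems by auto
  have "sum f F = (\<Sum>r\<in>smooth_part (-{p}) ` F. f r * sum f {s \<in> smooth {p}. s * r \<in> F})"
    using insert.prems Fpos by (intro sum_split)
  also have "\<dots> \<le> (\<Sum>r\<in>smooth_part (-{p}) ` F. f r * (1 / (1 - f p)))"
  proof (intro sum_mono mult_left_mono geometric_prime_le)
    fix r assume "r \<in> smooth_part (-{p}) ` F"
    then have "r > 0" using smooth_part_pos by auto
    have "finite ((\<lambda>s. s * r) -` F)"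
      using \<open>r > 0\<close> insert.prems by (intro finite_vimageI) (auto simp: inj_def)
    then show "finite {s \<in> smooth {p}. s * r \<in> F}"
      by (rule rev_finite_subset) auto
  qed (use insert.prems f_nonneg in auto)
  also have "\<dots> = sum f (smooth_part (-{p}) ` F) * (1 / (1 - f p))"
    by (simp only: sum_distrib_right)
  also have "\<dots> \<le> (\<Prod>p\<in>P. 1 / (1 - f p)) * (1 / (1 - f p))"
  proof (intro mult_right_mono insert.IH)
    show "smooth_part (-{p}) ` F \<subseteq> smooth P"
    proof safe
      fix n assume "n \<in> F"
      then have n: "n \<in> smooth (insert p P)" using insert.prems by auto
      have "smooth_part (-{p}) n \<in> smooth (insert p P)"
        using smooth_dvd[OF n smooth_part_dvd[OF smooth_pos[OF n]]] .
      with smooth_part_smooth[of "-{p}" n] show "smooth_part (-{p}) n \<in> smooth P"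
        by (auto simp: smooth_def)
    qed
  qed (use insert.prems pf in \<open>auto simp: less_imp_le\<close>)
  finally show ?case using insert.hyps by (simp add: mult.commute)
qed

end

section \<open>Logarithms as sums over prime powers\<close>

lemma ln_prime_factorization:
  assumes "n > 0"
  shows "ln (real n) = (\<Sum>p\<in>prime_factors n. real (multiplicity p n) * ln (real p))"
proof -
  have "ln (real n) = ln (real (\<Prod>p\<in>prime_factors n. p ^ multiplicity p n))"
    using assms prime_factorization_nat by simp
  also have "\<dots> = (\<Sum>p\<in>prime_factors n. ln (real p ^ multiplicity p n))"
    by (simp, subst ln_prod) (auto simp: in_prime_factors_iff prime_gt_0_nat)
  also have "\<dots> = (\<Sum>p\<in>prime_factors n. real (multiplicity p n) * ln (real p))"
    by (intro sum.cong refl) (auto simp: ln_realpow in_prime_factors_iff prime_gt_0_nat)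
  finally show ?thesis .
qed

text \<open>This is the identity \<open>ln = \<Lambda> * 1\<close> for the von Mangoldt function,
  with prime powers coded as pairs. The index set \<open>Q\<close> may be larger than
  \<open>n\<close> requires, so that one \<open>Q\<close> can serve a whole range of
  \<open>n\<close> when sums are exchanged.\<close>

lemma ln_eq_sum:
  fixes Q :: "(nat \<times> nat) set"
  assumes n: "n > 0" "finite Q" and Q: "\<And>p j. prime p \<Longrightarrow> j \<ge> 1 \<Longrightarrow> p ^ j dvd n \<Longrightarrow> (p, j) \<in> Q"
    and Q': "\<And>p j. (p, j) \<in> Q \<Longrightarrow> prime p \<and> j \<ge> 1"
  shows "ln (real n) = (\<Sum>(p,j)\<in>{(p,j) \<in> Q. p ^ j dvd n}. ln (real p))"
proof -
  have eq: "{(p,j) \<in> Q. p ^ j dvd n} = Sigma (prime_factors n) (\<lambda>p. {1..multiplicity p n})"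
  proof safe
    fix p j assume pj: "(p, j) \<in> Q" "p ^ j dvd n"
    have "p dvd p ^ j" using Q'[OF pj(1)] by (intro dvd_power) auto
    then have "p dvd n" using pj(2) by (rule dvd_trans)
    then show "p \<in> prime_factors n" using Q'[OF pj(1)] n by (auto simp: prime_factors_dvd)
    have "\<not> is_unit p" using Q'[OF pj(1)] not_prime_unit by blast
    then show "j \<in> {1..multiplicity p n}" using Q'[OF pj(1)] pj n
      by (auto simp: power_dvd_iff_le_multiplicity)
  next
    fix p j assume pj: "p \<in> prime_factors n" "j \<in> {1..multiplicity p n}"
    then show "p ^ j dvd n" by (auto simp: multiplicity_dvd')
    then show "(p, j) \<in> Q" using pj by (intro Q) auto
  qed
  have "ln (real n) = (\<Sum>p\<in>prime_factors n. real (multiplicity p n) * ln (real p))"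
    using n by (intro ln_prime_factorization) auto
  also have "\<dots> = (\<Sum>p\<in>prime_factors n. \<Sum>j\<in>{1..multiplicity p n}. ln (real p))"
    by simp
  also have "\<dots> = (\<Sum>(p,j)\<in>Sigma (prime_factors n) (\<lambda>p. {1..multiplicity p n}). ln (real p))"
    by (subst sum.Sigma) auto
  finally show ?thesis unfolding eq .
qed

section \<open>Antichains, level sets and logarithmically weighted sums\<close>

context multiplicative_weight
begin

text \<open>The LYM inequality: \<open>f a * Omega a! / l ^ Omega a\<close> is the probability that \<open>a\<close> is one of the
  partial products of a sequence of independent random primes, \<open>p\<close> having probability \<open>f p / l\<close>.
  The partial products form a divisibility chain, which meets a primitive set at most once.\<close>

lemma lym_squarefree:
  assumes P: "finite P" "\<And>p. p \<in> P \<Longrightarrow> prime p" and l: "l = sum f P" "l > 0"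
    and A: "finite A" "A \<subseteq> smooth P" "\<And>a. a \<in> A \<Longrightarrow> squarefree a" "primitive_set A"
    and K: "\<And>a. a \<in> A \<Longrightarrow> Omega a \<le> K"
  shows "(\<Sum>a\<in>A. f a * fact (Omega a) / l ^ Omega a) \<le> 1"
  using A K
proof (induction K arbitrary: A)
  case 0
  have "a = 1" if "a \<in> A" for a
    using Omega_eq_0[of a] smooth_pos[of a P] 0 that by auto
  then have "A \<subseteq> {1}" by blast
  then show ?case using f_1 by (auto simp: subset_singleton_iff)
next
  case (Suc K)
  let ?c = "\<lambda>a. f a * fact (Omega a) / l ^ Omega a"
  show ?case
  proof (cases "1 \<in> A")
    case True
    then have "A = {1}" using Suc.prems(4) unfolding primitive_set_def by auto
    then show ?thesis using f_1 by simp
  next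
    case False
    define B where "B p = {b. p * b \<in> A}" for p
    \<comment> \<open>In the random picture \<open>p\<close> is the last prime drawn before reaching
      \<open>a\<close>. Squarefreeness gives exactly \<open>Omega a\<close> choices of
      \<open>p\<close>, each contributing the same share \<open>?c a / Omega a\<close>.\<close>
    have step: "?c a = (\<Sum>p\<in>prime_factors a. f p / l * ?c (a div p))" if "a \<in> A" for a
    proof -
      have a: "a > 0" "a \<noteq> 1" "squarefree a" using that False Suc.prems smooth_pos by auto
      have "Omega a > 0" using Omega_eq_0[of a] a by auto
      have "card (prime_factors a) = Omega a"
      proof -
        have "Omega a = (\<Sum>p\<in>prime_factors a. multiplicity p a)"
          unfolding Omega_def size_multiset_overloaded_eq
          by (intro sum.cong refl) (auto simp: count_prime_factorization)
        also have "\<dots> = (\<Sum>p\<in>prime_factors a. 1)"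
          using a by (intro sum.cong refl) (auto simp: squarefree_factorial_semiring')
        finally show ?thesis by simp
      qed
      have "f p / l * ?c (a div p) = ?c a / Omega a" if p: "p \<in> prime_factors a" for p
      proof -
        have pp: "prime p" "p dvd a" using p by auto
        then obtain b where b: "a = p * b" by (auto elim: dvdE)
        have "b > 0" using b a by (cases b) auto
        then have "Omega a = Suc (Omega b)"
          using b pp Omega_mult[of p b] Omega_prime prime_gt_0_nat by simp
        moreover have "a div p = b" using b pp prime_gt_0_nat by simp
        moreover have "f p / l * (f b * fact m / l ^ m) = f p * f b * fact (Suc m) / l ^ Suc m / real (Suc m)"
          for m using l(2) by (simp add: divide_simps del: of_nat_Suc)
        ultimately show ?thesis by (simp only: b f_mult)
      qed
      then have "(\<Sum>p\<in>prime_factors a. f p / l * ?c (a div p)) = (\<Sum>p\<in>prime_factors a. ?c a / Omega a)"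
        by (intro sum.cong) auto
      also have "\<dots> = ?c a" using \<open>card _ = _\<close> \<open>Omega a > 0\<close> by simp
      finally show ?thesis ..
    qed
    have finB: "finite (B p)" if "p \<in> P" for p
    proof -
      have "finite ((\<lambda>b. p * b) -` A)"
        using Suc.prems P(2)[OF that] prime_gt_0_nat[of p] by (intro finite_vimageI) (auto simp: inj_def)
      then show ?thesis by (simp add: B_def vimage_def)
    qed
    \<comment> \<open>Dividing out \<open>p\<close> keeps the set primitive and lowers
      \<open>Omega\<close> by one, so the induction runs on the upper bound \<open>K\<close> for
      \<open>Omega\<close>.\<close>
    have IH: "sum ?c (B p) \<le> 1" if p: "p \<in> P" for p
    proof (rule Suc.IH)
      note pp = P(2)[OF p]
      show "finite (B p)" using finB p .
      show sm: "B p \<subseteq> smooth P" using Suc.prems(2) by (auto simp: B_def smooth_mult_iff)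
      show "squarefree b" if "b \<in> B p" for b
        using Suc.prems(3)[of "p * b"] that squarefree_mono[of b "p * b"] by (auto simp: B_def)
      show "primitive_set (B p)"
        using primitive_fiber[OF Suc.prems(4), of p UNIV] prime_gt_0_nat[OF pp]
        by (simp add: B_def mult.commute)
      show "Omega b \<le> K" if "b \<in> B p" for b
      proof -
        have "b > 0" using sm that smooth_pos by auto
        then have "Omega (p * b) = Suc (Omega b)"
          using pp Omega_mult[of p b] Omega_prime prime_gt_0_nat by simp
        then show ?thesis using Suc.prems(5)[of "p * b"] that by (simp add: B_def)
      qed
    qed
    have "sum ?c A = (\<Sum>a\<in>A. \<Sum>p\<in>prime_factors a. f p / l * ?c (a div p))"
      using step by (intro sum.cong) auto
    also have "\<dots> = (\<Sum>a\<in>A. \<Sum>p\<in>{p \<in> P. p dvd a}. f p / l * ?c (a div p))"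
    proof (intro sum.cong refl)
      fix a assume "a \<in> A"
      then show "prime_factors a = {p \<in> P. p dvd a}"
        using Suc.prems(2) P(2) by (auto simp: smooth_def prime_factors_dvd)
    qed
    also have "\<dots> = (\<Sum>p\<in>P. \<Sum>a\<in>{a \<in> A. p dvd a}. f p / l * ?c (a div p))"
      using P Suc.prems by (intro sum.swap_restrict) auto
    also have "\<dots> = (\<Sum>p\<in>P. \<Sum>b\<in>B p. f p / l * ?c b)"
    proof (rule sum.cong [OF refl])
      fix p assume "p \<in> P"
      then have "p > 0" using P prime_gt_0_nat by auto
      show "(\<Sum>a\<in>{a \<in> A. p dvd a}. f p / l * ?c (a div p)) = (\<Sum>b\<in>B p. f p / l * ?c b)"
        by (rule sum.reindex_bij_witness[of _ "\<lambda>b. p * b" "\<lambda>a. a div p"])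
           (use \<open>p > 0\<close> in \<open>auto simp: B_def\<close>)
    qed
    also have "\<dots> = (\<Sum>p\<in>P. f p / l * sum ?c (B p))"
      by (simp only: sum_distrib_left)
    also have "\<dots> \<le> (\<Sum>p\<in>P. f p / l * 1)"
      using IH f_nonneg l(2) by (intro sum_mono mult_left_mono) auto
    also have "\<dots> = 1" using l by (simp flip: sum_divide_distrib)
    finally show ?thesis .
  qed
qed

lemma square_weight: "multiplicative_weight (\<lambda>n. f n ^ 2)"
  by unfold_locales (use f_1 in \<open>auto simp: f_mult power_mult_distrib\<close>)

text \<open>The LYM inequality covers squarefree elements only. Writing \<open>a = m * d ^ 2\<close>
  with \<open>m\<close> squarefree, the \<open>m\<close> belonging to a fixed \<open>d\<close> form
  a primitive set of weight at most \<open>B\<close>, and summing \<open>f d ^ 2\<close> over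
  \<open>d\<close> costs the Euler product of the squared weight, which is close to 1 when
  \<open>P\<close> avoids small primes.\<close>

lemma primitive_sum_le:
  assumes P: "finite P" "\<And>p. p \<in> P \<Longrightarrow> prime p \<and> f p < 1" and l: "l = sum f P" "l > 0"
    and A: "finite A" "A \<subseteq> smooth P" "primitive_set A"
    and B: "\<And>k. l ^ k / fact k \<le> B"
  shows "sum f A \<le> (\<Prod>p\<in>P. 1 / (1 - f p ^ 2)) * B"
proof -
  interpret sq: multiplicative_weight "\<lambda>n. f n ^ 2" by (rule square_weight)
  define Q where "Q d = {a. squarefree a \<and> a * d ^ 2 \<in> A}" for d
  have "B \<ge> 0" using B[of 0] by simp
  have dec: "a = squarefree_part a * square_part a ^ 2" for a :: nat
    using squarefree_decompose by blast
  have Qbound: "sum f (Q d) \<le> B" if "d > 0" for d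
  proof -
    have fin: "finite (Q d)"
    proof -
      have "finite ((\<lambda>a. a * d ^ 2) -` A)"
        using A that by (intro finite_vimageI) (auto simp: inj_def)
      then show ?thesis by (rule rev_finite_subset) (auto simp: Q_def)
    qed
    have sm: "Q d \<subseteq> smooth P" using A(2) by (auto simp: Q_def smooth_mult_iff)
    have "primitive_set (Q d)"
      using primitive_fiber[OF A(3), of "d ^ 2" "Collect squarefree"] that by (simp add: Q_def)
    then have lym: "(\<Sum>a\<in>Q d. f a * fact (Omega a) / l ^ Omega a) \<le> 1"
      using fin sm P l
      by (intro lym_squarefree[of P _ _ "Max (Omega ` Q d)"]) (auto simp: Q_def)
    \<comment> \<open>Since \<open>B\<close> dominates every \<open>l ^ k / fact k\<close>, each
      weight is at most \<open>B\<close> times its LYM term, whatever its level.\<close>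
    have "sum f (Q d) \<le> (\<Sum>a\<in>Q d. B * (f a * fact (Omega a) / l ^ Omega a))"
    proof (intro sum_mono)
      fix a
      have "l ^ Omega a \<le> B * fact (Omega a)"
        using B[of "Omega a"] by (simp add: divide_le_eq)
      then have "f a * l ^ Omega a \<le> f a * (B * fact (Omega a))"
        using f_nonneg mult_left_mono by blast
      then show "f a \<le> B * (f a * fact (Omega a) / l ^ Omega a)"
        using l(2) by (simp add: field_simps)
    qed
    also have "\<dots> = B * (\<Sum>a\<in>Q d. f a * fact (Omega a) / l ^ Omega a)"
      by (simp only: sum_distrib_left)
    also have "\<dots> \<le> B" using lym \<open>B \<ge> 0\<close> by (simp add: mult_left_le)
    finally show ?thesis .
  qed
  have sqpos: "square_part a > 0" if "a \<in> A" for a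
    using that A(2) smooth_pos[of a P] by (auto intro!: Nat.gr0I)
  have "sum f A = (\<Sum>d\<in>square_part ` A. sum f {a \<in> A. square_part a = d})"
    using A by (intro sum.image_gen)
  also have "\<dots> \<le> (\<Sum>d\<in>square_part ` A. f d ^ 2 * B)"
  proof (intro sum_mono)
    fix d assume "d \<in> square_part ` A"
    then have d: "d > 0" using sqpos by auto
    have fin: "finite (Q d)"
    proof -
      have "finite ((\<lambda>a. a * d ^ 2) -` A)"
        using A d by (intro finite_vimageI) (auto simp: inj_def)
      then show ?thesis by (rule rev_finite_subset) (auto simp: Q_def)
    qed
    have "sum f {a \<in> A. square_part a = d} \<le> sum f ((\<lambda>a. a * d ^ 2) ` Q d)"
    proof (intro sum_mono2)
      show "{a \<in> A. square_part a = d} \<subseteq> (\<lambda>a. a * d\<^sup>2) ` Q d"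
      proof safe
        fix a assume "a \<in> A"
        then show "a \<in> (\<lambda>b. b * (square_part a)\<^sup>2) ` Q (square_part a)"
          using dec[of a] smooth_pos[of a P] A(2)
          by (intro image_eqI[of _ _ "squarefree_part a"]) (auto simp: Q_def)
      qed
    qed (use fin f_nonneg in auto)
    also have "\<dots> = f d ^ 2 * sum f (Q d)"
      using d by (subst sum.reindex) (auto simp: inj_on_def f_mult f_power sum_distrib_right mult.commute)
    also have "\<dots> \<le> f d ^ 2 * B" using Qbound[OF d] by (intro mult_left_mono) auto
    finally show "sum f {a \<in> A. square_part a = d} \<le> f d ^ 2 * B" .
  qed
  also have "\<dots> = (\<Sum>d\<in>square_part ` A. f d ^ 2) * B"
    by (simp add: sum_distrib_right)
  also have "\<dots> \<le> (\<Prod>p\<in>P. 1 / (1 - f p ^ 2)) * B"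
  proof (intro mult_right_mono sq.euler_product_le)
    show "square_part ` A \<subseteq> smooth P"
      using A(2) by (metis (no_types, lifting) dec image_subsetI smooth_mult_iff power2_eq_square subsetD)
    show "prime p \<and> (f p)\<^sup>2 < 1" if "p \<in> P" for p
      using P(2)[OF that] f_nonneg[of p] by (auto simp: power_less_one_iff)
  qed (use P A \<open>B \<ge> 0\<close> in auto)
  finally show ?thesis .
qed

text \<open>Expanding \<open>sum f P ^ k\<close> produces each \<open>s\<close> of level
  \<open>k\<close> at most \<open>k!\<close> times. The induction multiplies level \<open>k\<close>
  by one more prime.\<close>

lemma level_sum_ge:
  assumes P: "finite P" "\<And>p. p \<in> P \<Longrightarrow> prime p"
  shows "finite {s \<in> smooth P. Omega s = k}" "sum f P ^ k / fact k \<le> sum f {s \<in> smooth P. Omega s = k}"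
proof (induction k)
  case 0
  have *: "{s \<in> smooth P. Omega s = 0} = {1}"
  proof safe
    fix s assume "s \<in> smooth P" "Omega s = 0"
    then show "s = 1" using Omega_eq_0[of s] smooth_pos[of s P] by simp
  qed (auto simp: smooth_def)
  { case 1 then show ?case unfolding * by simp }
  { case 2 then show ?case unfolding * using f_1 by simp }
next
  case (Suc k)
  let ?L = "\<lambda>k. {s \<in> smooth P. Omega s = k}"
  have dec: "\<exists>p b. p \<in> P \<and> b \<in> ?L k \<and> s = p * b" if s: "s \<in> ?L (Suc k)" for s
  proof -
    have "s \<noteq> 1" using s by auto
    then obtain p where p: "prime p" "p dvd s" using prime_factor_nat by blast
    then obtain b where b: "s = p * b" by (auto elim: dvdE)
    have bs: "b \<in> smooth P" "p \<in> P" using s b p smooth_mult_iff smooth_prime_dvd by auto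
    then have "Omega b = k"
      using s b p Omega_mult[of p b] Omega_prime[of p] prime_gt_0_nat[of p] smooth_pos[of b P]
      by simp
    then show ?thesis using bs b by blast
  qed
  have "?L (Suc k) \<subseteq> (\<lambda>(p,b). p * b) ` (P \<times> ?L k)" using dec by auto
  moreover have "finite ((\<lambda>(p,b). p * b) ` (P \<times> ?L k))" using P(1) Suc(1) by blast
  ultimately show fin: "finite (?L (Suc k))" by (rule finite_subset)
  \<comment> \<open>An element of level \<open>k + 1\<close> arises once for each distinct prime
    divisor, hence at most \<open>k + 1\<close> times; repeated primes only lower this count, and so
    the result is an inequality.\<close>
  have cardle: "card {p \<in> P. p dvd s} \<le> Suc k" if s: "s \<in> ?L (Suc k)" for s
  proof -
    have "{p \<in> P. p dvd s} \<subseteq> prime_factors s"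
      using P(2) s smooth_pos[of s P] by (auto simp: prime_factors_dvd)
    then have "card {p \<in> P. p dvd s} \<le> card (prime_factors s)" by (intro card_mono) auto
    also have "\<dots> = (\<Sum>p\<in>prime_factors s. 1)" by simp
    also have "\<dots> \<le> Omega s"
      unfolding Omega_def size_multiset_overloaded_eq by (intro sum_mono) (simp add: Suc_le_eq)
    finally show ?thesis using s by simp
  qed
  have "sum f P ^ Suc k / fact k = sum f P * (sum f P ^ k / fact k)" by simp
  also have "\<dots> \<le> sum f P * sum f (?L k)"
    using Suc(2) by (intro mult_left_mono sum_nonneg f_nonneg)
  also have "\<dots> = (\<Sum>p\<in>P. \<Sum>b\<in>?L k. f (p * b))"
    by (simp add: sum_product f_mult)
  also have "\<dots> \<le> (\<Sum>p\<in>P. sum f {s \<in> ?L (Suc k). p dvd s})"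
  proof (intro sum_mono)
    fix p assume p: "p \<in> P"
    then have pp: "prime p" using P by auto
    have "(\<Sum>b\<in>?L k. f (p * b)) = sum f ((*) p ` ?L k)"
      using prime_gt_0_nat[OF pp] by (subst sum.reindex) (auto simp: inj_on_def)
    also have "\<dots> \<le> sum f {s \<in> ?L (Suc k). p dvd s}"
    proof (intro sum_mono2)
      have "p \<in> smooth P" using p pp prime_gt_0_nat by (auto simp: smooth_def prime_factorization_prime)
      then show "(*) p ` ?L k \<subseteq> {s \<in> ?L (Suc k). p dvd s}"
        using pp Omega_mult[of p] Omega_prime[of p] prime_gt_0_nat[of p] smooth_pos[of _ P]
        by (auto simp: smooth_mult_iff)
      show "finite {s \<in> ?L (Suc k). p dvd s}" using fin by (rule rev_finite_subset) blast
    qed (use f_nonneg in auto)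
    finally show "(\<Sum>b\<in>?L k. f (p * b)) \<le> sum f {s \<in> ?L (Suc k). p dvd s}" .
  qed
  also have "\<dots> = (\<Sum>s\<in>?L (Suc k). \<Sum>p\<in>{p \<in> P. p dvd s}. f s)"
    using fin P by (intro sum.swap_restrict) auto
  also have "\<dots> \<le> (\<Sum>s\<in>?L (Suc k). real (Suc k) * f s)"
    using cardle f_nonneg by (intro sum_mono) (auto intro!: mult_right_mono simp del: of_nat_Suc)
  also have "\<dots> = real (Suc k) * sum f (?L (Suc k))" by (simp only: sum_distrib_left)
  finally have "sum f P ^ Suc k / fact k / real (Suc k) \<le> sum f (?L (Suc k))"
    by (simp only: divide_le_eq mult.commute) simp
  then show "sum f P ^ Suc k / fact (Suc k) \<le> sum f (?L (Suc k))"
    by (simp only: fact_Suc divide_divide_eq_left mult.commute of_nat_fact)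
qed

text \<open>Expanding \<open>ln n\<close> and exchanging sums leaves, by complete multiplicativity,
  the weights of the cofactor sets \<open>{m. m * p ^ j \<in> F}\<close>. Both slow variation and
  the tail estimate consist in bounding the right-hand side.\<close>

lemma log_weighted_sum:
  fixes Q :: "(nat \<times> nat) set"
  assumes F: "finite F" "F \<subseteq> {0<..}" and Q: "finite Q"
    "\<And>p j n. n \<in> F \<Longrightarrow> prime p \<Longrightarrow> j \<ge> 1 \<Longrightarrow> p ^ j dvd n \<Longrightarrow> (p, j) \<in> Q"
    "\<And>p j. (p, j) \<in> Q \<Longrightarrow> prime p \<and> j \<ge> 1"
  shows "(\<Sum>n\<in>F. f n * ln (real n)) = (\<Sum>(p,j)\<in>Q. ln (real p) * f p ^ j * sum f {m. m * p ^ j \<in> F})"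
proof -
  have "(\<Sum>n\<in>F. f n * ln (real n)) = (\<Sum>n\<in>F. \<Sum>(p,j)\<in>{(p,j) \<in> Q. p ^ j dvd n}. f n * ln (real p))"
  proof (intro sum.cong refl)
    fix n assume n: "n \<in> F"
    have "ln (real n) = (\<Sum>(p,j)\<in>{(p,j) \<in> Q. p ^ j dvd n}. ln (real p))"
    proof (rule ln_eq_sum)
      show "n > 0" using F n by auto
    qed (use Q n in blast)+
    then show "f n * ln (real n) = (\<Sum>(p,j)\<in>{(p,j) \<in> Q. p ^ j dvd n}. f n * ln (real p))"
      by (simp only: sum_distrib_left case_prod_unfold)
  qed
  also have "\<dots> = (\<Sum>n\<in>F. \<Sum>q\<in>{q \<in> Q. fst q ^ snd q dvd n}. f n * ln (real (fst q)))"
    by (simp add: case_prod_unfold)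
  also have "\<dots> = (\<Sum>q\<in>Q. \<Sum>n\<in>{n \<in> F. fst q ^ snd q dvd n}. f n * ln (real (fst q)))"
    using F Q by (intro sum.swap_restrict) auto
  also have "\<dots> = (\<Sum>(p,j)\<in>Q. ln (real p) * f p ^ j * sum f {m. m * p ^ j \<in> F})"
  proof (intro sum.cong refl, clarify)
    fix p j assume "(p, j) \<in> Q"
    then have "prime p" using Q(3) by blast
    then have pos: "p ^ j > 0" using prime_gt_0_nat by simp
    have "(\<Sum>n\<in>{n \<in> F. p ^ j dvd n}. f n * ln (real p)) = (\<Sum>m\<in>{m. m * p ^ j \<in> F}. f (m * p ^ j) * ln (real p))"
      by (rule sum.reindex_bij_witness[of _ "\<lambda>m. m * p ^ j" "\<lambda>n. n div p ^ j"])
         (use pos in auto)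
    then show "(\<Sum>n\<in>{n \<in> F. fst (p, j) ^ snd (p, j) dvd n}. f n * ln (real (fst (p, j)))) =
        ln (real p) * f p ^ j * sum f {m. m * p ^ j \<in> F}"
      by (simp add: f_mult f_power sum_distrib_left mult_ac)
  qed
  finally show ?thesis .
qed

end

section \<open>Sums over primes\<close>

lemma sum_ln_primes_le:
  assumes "n > 0" "finite S" "\<And>p. p \<in> S \<Longrightarrow> prime p \<and> p dvd n"
  shows "(\<Sum>p\<in>S. ln (real p)) \<le> ln (real n)"
proof -
  have S: "S \<subseteq> prime_factors n" using assms by (auto simp: prime_factors_dvd)
  have "(\<Sum>p\<in>S. ln (real p)) \<le> (\<Sum>p\<in>prime_factors n. ln (real p))"
    using S by (intro sum_mono2) (auto simp: in_prime_factors_iff prime_gt_0_nat Suc_le_eq)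
  also have "\<dots> \<le> (\<Sum>p\<in>prime_factors n. real (multiplicity p n) * ln (real p))"
  proof (intro sum_mono)
    fix p assume p: "p \<in> prime_factors n"
    then have "multiplicity p n \<ge> 1" using assms by (simp add: prime_factors_multiplicity Suc_le_eq)
    moreover have "ln (real p) \<ge> 0" using p by (auto simp: in_prime_factors_iff prime_gt_0_nat Suc_le_eq)
    ultimately show "ln (real p) \<le> real (multiplicity p n) * ln (real p)"
      by (simp add: mult_le_cancel_right1)
  qed
  also have "\<dots> = ln (real n)" using assms by (simp add: ln_prime_factorization)
  finally show ?thesis .
qed

text \<open>Chebyshev's argument: primes in \<open>(m, 2m]\<close> divide the binomial coefficient
  \<open>(2 * m) choose m\<close>, which is at most \<open>4 ^ m\<close>. They contribute at most 2,
  and one exceptional prime contributes at most 1.\<close>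

lemma sum_ln_primes_dyadic:
  fixes t :: real
  assumes S: "finite S" "\<And>p. p \<in> S \<Longrightarrow> prime p \<and> t < real p \<and> real p \<le> 2 * t"
  shows "(\<Sum>p\<in>S. ln (real p) / real p) \<le> 3"
proof (cases "t < 1")
  case True
  have "S = {}"
  proof (rule ccontr)
    assume "S \<noteq> {}"
    then obtain p where "p \<in> S" by blast
    then have "prime p" "real p < 2" using S(2)[of p] True by auto
    then show False using prime_ge_2_nat[of p] by simp
  qed
  then show ?thesis by simp
next
  case False
  define m where "m = nat \<lfloor>t\<rfloor>"
  have m: "real m \<le> t" "t < real m + 1" "m \<ge> 1" using False by (auto simp: m_def le_nat_floor)
  define c where "c = (2 * m) choose m"
  have c: "fact m * fact m * c = fact (2 * m)"
    unfolding c_def using binomial_fact_lemma[of m "2 * m"] by simp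
  have "c > 0" unfolding c_def by simp
  \<comment> \<open>From \<open>p \<le> 2 * t < 2 * m + 2\<close> a prime of the range may be
    \<open>2 * m + 1\<close>, just above the reach of the binomial coefficient; it is treated
    separately.\<close>
  have "p dvd c" if p: "p \<in> S - {2 * m + 1}" for p
  proof -
    have "real m < real p" "real p < real (2 * m + 2)" using S(2)[of p] p m by auto
    then have "m < p" "p < 2 * m + 2" by linarith+
    then have pm: "m < p" "p \<le> 2 * m" using p by auto
    have "prime p" using S p by auto
    then have "p dvd fact m * fact m * c" using pm c prime_dvd_fact_iff by simp
    then show ?thesis using \<open>prime p\<close> pm by (auto simp: prime_dvd_mult_iff prime_dvd_fact_iff)
  qed
  then have *: "(\<Sum>p\<in>S - {2 * m + 1}. ln (real p)) \<le> ln (real c)"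
    using S \<open>c > 0\<close> by (intro sum_ln_primes_le) auto
  have "c \<le> 2 ^ (2 * m)" unfolding c_def by (rule binomial_le_pow2)
  then have "real c \<le> 2 ^ (2 * m)" using of_nat_mono by fastforce
  then have "ln (real c) \<le> ln (2 ^ (2 * m))" using \<open>c > 0\<close> by (subst ln_le_cancel_iff) auto
  also have "\<dots> = real (2 * m) * ln 2" by (simp add: ln_realpow)
  also have "\<dots> \<le> real (2 * m) * 1" using ln_2_less_1 by (intro mult_left_mono) auto
  finally have lc: "ln (real c) \<le> 2 * real m" by simp
  have "(\<Sum>p\<in>S. ln (real p) / real p) \<le>
     (\<Sum>p\<in>insert (2 * m + 1) (S - {2 * m + 1}). ln (real p) / real p)"
    using S by (intro sum_mono2) (auto simp: Suc_le_eq)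
  also have "\<dots> = ln (real (2 * m + 1)) / real (2 * m + 1) + (\<Sum>p\<in>S - {2 * m + 1}. ln (real p) / real p)"
    using S by (subst sum.insert) auto
  also have "(\<Sum>p\<in>S - {2 * m + 1}. ln (real p) / real p) \<le> (\<Sum>p\<in>S - {2 * m + 1}. ln (real p) / real m)"
  proof (intro sum_mono divide_left_mono)
    fix p assume p: "p \<in> S - {2 * m + 1}"
    show "real m \<le> real p" using S(2)[of p] p m by auto
    show "ln (real p) \<ge> 0" "0 < real p * real m" using S(2)[of p] p m prime_gt_0_nat[of p] by auto
  qed
  also have "\<dots> \<le> 2" using lc * m by (simp add: sum_divide_distrib [symmetric] divide_le_eq)
  also have "ln (real (2 * m + 1)) / real (2 * m + 1) \<le> 1"
    by (simp add: divide_le_eq) (smt (verit) ln_bound of_nat_0_le_iff)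
  finally show ?thesis by simp
qed

text \<open>At most \<open>log 2 (b / a) + 1\<close> dyadic intervals cover \<open>(a, b]\<close>,
  each costing 3. What matters later is that the bound depends on the ratio \<open>b / a\<close>
  alone.\<close>

lemma sum_ln_primes_interval:
  fixes a b :: real
  assumes "0 < a" "a \<le> b" "finite S" "\<And>p. p \<in> S \<Longrightarrow> prime p \<and> a < real p \<and> real p \<le> b"
  shows "(\<Sum>p\<in>S. ln (real p) / real p) \<le> 6 * (ln (b / a) + 1)"
proof -
  have main: "(\<Sum>p\<in>S. ln (real p) / real p) \<le> 3 * real n"
    if "finite S" "\<And>p. p \<in> S \<Longrightarrow> prime p \<and> a < real p \<and> real p \<le> a * 2 ^ n" for n S
    using that
  proof (induction n arbitrary: S)
    case 0
    then have "S = {}" by fastforce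
    then show ?case by simp
  next
    case (Suc n)
    let ?S1 = "{p \<in> S. real p \<le> a * 2 ^ n}" and ?S2 = "{p \<in> S. real p > a * 2 ^ n}"
    have "(\<Sum>p\<in>S. ln (real p) / real p) = (\<Sum>p\<in>?S1 \<union> ?S2. ln (real p) / real p)"
      by (intro sum.cong) auto
    also have "\<dots> = (\<Sum>p\<in>?S1. ln (real p) / real p) + (\<Sum>p\<in>?S2. ln (real p) / real p)"
      using Suc.prems by (intro sum.union_disjoint) auto
    also have "(\<Sum>p\<in>?S1. ln (real p) / real p) \<le> 3 * real n"
      using Suc.prems by (intro Suc.IH) auto
    also have "(\<Sum>p\<in>?S2. ln (real p) / real p) \<le> 3"
      using Suc.prems by (intro sum_ln_primes_dyadic[of _ "a * 2 ^ n"]) (auto simp: mult_ac)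
    finally show ?case by simp
  qed
  define n where "n = nat \<lceil>log 2 (b / a)\<rceil>"
  have ba: "b / a \<ge> 1" using assms by simp
  then have lg: "0 \<le> log 2 (b / a)" by simp
  have n: "log 2 (b / a) \<le> real n" "real n \<le> log 2 (b / a) + 1"
    using lg by (auto simp: n_def ceiling_le_iff intro: real_nat_ceiling_ge)
  have "b / a \<le> 2 ^ n" using n(1) ba by (simp add: log_le_iff powr_realpow)
  then have "b \<le> a * 2 ^ n" using assms by (simp add: field_simps)
  then have "(\<Sum>p\<in>S. ln (real p) / real p) \<le> 3 * real n"
    using assms by (intro main) force+
  also have "\<dots> \<le> 3 * (log 2 (b / a) + 1)" using n by simp
  also have "log 2 (b / a) \<le> 2 * ln (b / a)"
  proof -
    have "ln (2::real) \<ge> 1 / 2" using ln_2_less_1 ln2_ge_two_thirds by linarith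
    then have "ln (b / a) * 1 \<le> ln (b / a) * (2 * ln 2)" using ba by (intro mult_left_mono) auto
    then show ?thesis by (simp add: log_def divide_le_eq)
  qed
  finally show ?thesis using ba by (simp add: algebra_simps)
qed

text \<open>Needed for the prime powers \<open>p ^ j\<close> with \<open>j \<ge> 2\<close>. Here
  \<open>ln n\<close> is bounded by a multiple of \<open>n powr (1/2)\<close>, leaving the
  convergent series of \<open>n powr (-3/2)\<close>.\<close>

lemma ln_over_square_bound: "\<exists>C\<ge>0. \<forall>S::nat set. finite S \<longrightarrow> (\<Sum>n\<in>S. ln (real n) / real n ^ 2) \<le> C"
proof -
  have sm: "summable (\<lambda>n. 2 * real n powr (-3/2))"
    by (intro summable_mult) (simp add: summable_real_powr_iff)
  have le: "ln (real n) / real n ^ 2 \<le> 2 * real n powr (-3/2)" for n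
  proof (cases "n = 0")
    case False
    then have "ln (real n) \<le> real n powr (1/2) / (1/2)" by (intro ln_powr_bound) auto
    then have "ln (real n) / real n ^ 2 \<le> (2 * real n powr (1/2)) / real n ^ 2"
      by (intro divide_right_mono) auto
    also have "\<dots> = 2 * real n powr (1/2 - 2)"
      using False powr_diff[of "real n" "1/2" 2] by (simp only: powr_numeral)
    finally show ?thesis by simp
  qed auto
  have "(\<Sum>n\<in>S. ln (real n) / real n ^ 2) \<le> (\<Sum>n. 2 * real n powr (-3/2))" if "finite S" for S
  proof -
    have "(\<Sum>n\<in>S. ln (real n) / real n ^ 2) \<le> (\<Sum>n\<in>S. 2 * real n powr (-3/2))"
      using le by (intro sum_mono)
    also have "\<dots> \<le> (\<Sum>n. 2 * real n powr (-3/2))" using sm that by (intro sum_le_suminf) auto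
    finally show ?thesis .
  qed
  moreover have "(\<Sum>n. 2 * real n powr (-3/2)) \<ge> 0" using sm by (intro suminf_nonneg) auto
  ultimately show ?thesis by blast
qed

text \<open>By telescoping \<open>1 / n - 1 / (n + 1)\<close>. With \<open>t = 1 / \<delta>\<close>
  it shows that the squared weights of the primes above \<open>1 / \<delta>\<close> sum to
  \<open>O(\<delta>)\<close>.\<close>

lemma sum_inverse_squares_le:
  assumes "finite S" "\<And>n. n \<in> S \<Longrightarrow> t < real n" "t > 0"
  shows "(\<Sum>n\<in>S. 1 / real n ^ 2) \<le> 2 / t"
proof -
  have main: "(\<Sum>n=k..N. 1 / real n ^ 2) \<le> 2 / real k - 1 / real N" if "k \<ge> 1" "N \<ge> k" for k N
    using that(2)
  proof (induction N rule: dec_induct)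
    case base
    have "1 / real k ^ 2 \<le> 1 / real k" using that(1) by (simp add: field_simps power2_eq_square)
    then show ?case by simp
  next
    case (step N)
    have "1 / real (Suc N) ^ 2 \<le> 1 / real N - 1 / real (Suc N)"
      using step that(1) by (simp add: divide_simps power2_eq_square)
    then show ?case using step by (simp del: of_nat_Suc)
  qed
  show ?thesis
  proof (cases "S = {}")
    case False
    define k where "k = Min S"
    define N where "N = Max S"
    have k: "k \<in> S" "N \<ge> k" using False assms by (auto simp: k_def N_def)
    have sub: "S \<subseteq> {k..N}" using assms by (auto simp: k_def N_def)
    have k1: "real k > t" using assms k by auto
    then have kge: "k \<ge> 1" using assms(3) by (cases k) auto
    have "(\<Sum>n\<in>S. 1 / real n ^ 2) \<le> (\<Sum>n=k..N. 1 / real n ^ 2)"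
      using sub by (intro sum_mono2) auto
    also have "\<dots> \<le> 2 / real k - 1 / real N" using k kge by (intro main)
    also have "\<dots> \<le> 2 / real k" by simp
    also have "\<dots> \<le> 2 / t" using k1 assms by (intro divide_left_mono) auto
    finally show ?thesis .
  qed (use assms in auto)
qed

text \<open>The bound \<open>\<zeta>(1 + \<delta>) \<le> 1 + 1 / \<delta>\<close>. The subtracted
  term of the induction is the tail integral of \<open>t powr (-(1 + \<delta>))\<close> from
  \<open>N\<close> on.\<close>

lemma recip_sum_powr_le:
  assumes "\<delta> > 0" "finite F" "F \<subseteq> {0<..}"
  shows "(\<Sum>n\<in>F. real n powr (-(1 + \<delta>))) \<le> 1 + 1 / \<delta>"
proof -
  have main: "(\<Sum>n=1..N. real n powr (-(1 + \<delta>))) \<le> 1 + 1 / \<delta> - (1 / \<delta>) * real N powr (-\<delta>)" if "N \<ge> 1" for N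
    using that
  proof (induction N rule: dec_induct)
    case (step N)
    define r where "r = (real N + 1) / real N"
    have r: "r > 0" "real (Suc N) = real N * r" using step by (auto simp: r_def field_simps)
    have "1 - 1 / r \<le> ln r" using ln_le_minus_one[of "1 / r"] r by (simp add: ln_div)
    moreover have "1 / r = 1 - 1 / real (Suc N)" using step by (simp add: r_def field_simps)
    ultimately have "1 / real (Suc N) \<le> ln r" by simp
    then have "1 + \<delta> / real (Suc N) \<le> 1 + \<delta> * ln r"
      using assms(1) mult_left_mono[of "1 / real (Suc N)" "ln r" \<delta>] by simp
    also have "\<dots> \<le> exp (\<delta> * ln r)" by (rule exp_ge_add_one_self)
    also have "\<dots> = r powr \<delta>" using r by (simp add: powr_def)
    finally have "(1 + \<delta> / real (Suc N)) * real (Suc N) powr (-\<delta>) \<le> r powr \<delta> * real (Suc N) powr (-\<delta>)"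
      by (intro mult_right_mono) auto
    also have "\<dots> = real N powr (-\<delta>)"
      using r step by (simp only: r(2)) (simp add: powr_mult powr_minus)
    finally have "\<delta> * real (Suc N) powr (-(1 + \<delta>)) \<le> real N powr (-\<delta>) - real (Suc N) powr (-\<delta>)"
      by (simp add: powr_diff powr_minus field_simps del: of_nat_Suc)
    then have "real (Suc N) powr (-(1 + \<delta>)) \<le> (1 / \<delta>) * real N powr (-\<delta>) - (1 / \<delta>) * real (Suc N) powr (-\<delta>)"
      using assms(1) by (simp add: field_simps)
    then show ?case using step by (simp del: of_nat_Suc)
  qed simp
  show ?thesis
  proof (cases "F = {}")
    case False
    define N where "N = Max F"
    have sub: "F \<subseteq> {1..N}" using assms by (auto simp: N_def Suc_le_eq)
    have "N \<ge> 1" using assms False Max_in[of F] unfolding N_def by fastforce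
    have "(\<Sum>n\<in>F. real n powr (-(1 + \<delta>))) \<le> (\<Sum>n=1..N. real n powr (-(1 + \<delta>)))"
      using sub by (intro sum_mono2) auto
    also have "\<dots> \<le> 1 + 1 / \<delta> - (1 / \<delta>) * real N powr (-\<delta>)" using main \<open>N \<ge> 1\<close> by blast
    also have "\<dots> \<le> 1 + 1 / \<delta>" using assms(1) by simp
    finally show ?thesis .
  qed (use assms in auto)
qed

section \<open>Slow variation of summatory functions and tails of smooth numbers\<close>

context multiplicative_weight
begin

text \<open>The argument is real because the function is evaluated at non-integral points such as
  \<open>N powr (1 - \<delta>)\<close>.\<close>

definition total :: "real \<Rightarrow> real" where
  "total x = sum f {n. 0 < n \<and> real n \<le> x}"

lemma finite_pos_le: "finite {n. 0 < n \<and> real n \<le> x}"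
proof (rule finite_subset)
  show "{n. 0 < n \<and> real n \<le> x} \<subseteq> {..nat \<lfloor>x\<rfloor>}" by (auto simp: le_nat_floor)
qed auto

lemma total_mono: "x \<le> y \<Longrightarrow> total x \<le> total y"
  unfolding total_def by (intro sum_mono2) (use finite_pos_le f_nonneg in auto)

lemma total_ge_1: "x \<ge> 1 \<Longrightarrow> total x \<ge> 1"
proof -
  assume "x \<ge> 1"
  then have "sum f {1} \<le> total x"
    unfolding total_def by (intro sum_mono2) (use finite_pos_le f_nonneg in auto)
  then show ?thesis using f_1 by simp
qed

end

text \<open>For \<open>z = 2\<close> the bound \<open>z / p\<close> would permit
  \<open>f 2 = 1\<close>, where the geometric series of powers of 2 diverges. The uniform bound
  \<open>\<rho> < 1\<close> excludes this.\<close>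

locale bounded_weight = multiplicative_weight +
  fixes z \<rho> :: real
  assumes f_prime_le: "prime p \<Longrightarrow> f p \<le> z / real p"
    and f_prime_le_rho: "prime p \<Longrightarrow> f p \<le> \<rho>"
    and rho: "\<rho> < 1"
begin

lemma z_nonneg: "z \<ge> 0"
  using f_prime_le[of 2] f_nonneg[of 2] by (auto simp: field_simps)

text \<open>For each prime the powers from the square on sum to at most
  \<open>f p ^ 2 / (1 - \<rho>)\<close>, which leaves the convergent sum of
  \<open>ln p / p ^ 2\<close>.\<close>

lemma higher_powers_bound:
  "\<exists>C\<ge>0. \<forall>Q::(nat \<times> nat) set. finite Q \<longrightarrow> (\<forall>(p,j)\<in>Q. prime p \<and> j \<ge> 2) \<longrightarrow>
     (\<Sum>(p,j)\<in>Q. ln (real p) * f p ^ j) \<le> C"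
proof -
  obtain C where C: "C \<ge> 0" "\<And>S::nat set. finite S \<Longrightarrow> (\<Sum>n\<in>S. ln (real n) / real n ^ 2) \<le> C"
    using ln_over_square_bound by blast
  have "(\<Sum>(p,j)\<in>Q. ln (real p) * f p ^ j) \<le> z ^ 2 / (1 - \<rho>) * C"
    if Q: "finite Q" "\<forall>(p,j)\<in>Q. prime p \<and> j \<ge> 2" for Q :: "(nat \<times> nat) set"
  proof -
    define J where "J = Max (snd ` Q)"
    define S where "S = fst ` Q"
    have S: "finite S" "\<And>p. p \<in> S \<Longrightarrow> prime p" using Q by (auto simp: S_def)
    have sub: "Q \<subseteq> S \<times> {2..J}"
    proof
      fix q assume q: "q \<in> Q"
      then have "snd q \<le> J" unfolding J_def using Q(1) by (intro Max_ge) auto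
      moreover have "2 \<le> snd q" using Q(2) q by (auto simp: case_prod_unfold)
      ultimately show "q \<in> S \<times> {2..J}" using q by (auto simp: S_def mem_Times_iff)
    qed
    have pl: "ln (real p) \<ge> 0" if "p \<in> S" for p
      using S(2)[OF that] prime_gt_0_nat[of p] by (simp add: Suc_le_eq)
    have "(\<Sum>(p,j)\<in>Q. ln (real p) * f p ^ j) \<le> (\<Sum>(p,j)\<in>S \<times> {2..J}. ln (real p) * f p ^ j)"
      using sub S(1) pl f_nonneg by (intro sum_mono2) auto
    also have "\<dots> = (\<Sum>p\<in>S. \<Sum>j\<in>{2..J}. ln (real p) * f p ^ j)"
      by (simp only: sum.cartesian_product)
    also have "\<dots> \<le> (\<Sum>p\<in>S. z ^ 2 / (1 - \<rho>) * (ln (real p) / real p ^ 2))"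
    proof (intro sum_mono)
      fix p assume p: "p \<in> S"
      have fp: "f p < 1" "1 - \<rho> \<le> 1 - f p" using f_prime_le_rho[OF S(2)[OF p]] rho by auto
      have "(\<Sum>j\<in>{2..J}. f p ^ j) \<le> f p ^ 2 / (1 - f p)"
      proof -
        have "(\<Sum>j\<in>{2..J}. f p ^ j) \<le> (\<Sum>j. f p ^ (j + 2))"
        proof -
          have "(\<Sum>j\<in>{2..J}. f p ^ j) = (\<Sum>i\<in>{..<J-1}. f p ^ (i + 2))"
          proof (rule sum.reindex_bij_witness[of _ "\<lambda>i. i + 2" "\<lambda>j. j - 2"])
            fix j assume "j \<in> {2..J}"
            then have "j - 2 + 2 = j" by (metis atLeastAtMost_iff le_add_diff_inverse2)
            then show "f p ^ (j - 2 + 2) = f p ^ j" by (simp only:)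
          qed auto
          also have "\<dots> \<le> (\<Sum>j. f p ^ (j + 2))"
            using fp f_nonneg[of p]
            by (intro sum_le_suminf summable_ignore_initial_segment summable_geometric) auto
          finally show ?thesis .
        qed
        also have "\<dots> = (\<Sum>j. f p ^ 2 * f p ^ j)" by (simp only: power_add mult.commute)
        also have "\<dots> = f p ^ 2 * (\<Sum>j. f p ^ j)"
          using fp f_nonneg[of p] by (intro suminf_mult summable_geometric) auto
        also have "\<dots> = f p ^ 2 / (1 - f p)"
          using fp f_nonneg[of p] by (subst suminf_geometric) auto
        finally show ?thesis .
      qed
      also have "\<dots> \<le> (z / real p) ^ 2 / (1 - \<rho>)"
        using fp rho f_nonneg[of p] f_prime_le[OF S(2)[OF p]] by (intro frac_le power_mono) auto
      finally have "ln (real p) * (\<Sum>j\<in>{2..J}. f p ^ j) \<le> ln (real p) * ((z / real p) ^ 2 / (1 - \<rho>))"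
        using pl[OF p] by (intro mult_left_mono)
      then show "(\<Sum>j\<in>{2..J}. ln (real p) * f p ^ j) \<le> z ^ 2 / (1 - \<rho>) * (ln (real p) / real p ^ 2)"
        by (simp add: sum_distrib_left power_divide mult_ac)
    qed
    also have "\<dots> = z ^ 2 / (1 - \<rho>) * (\<Sum>p\<in>S. ln (real p) / real p ^ 2)"
      by (simp only: sum_distrib_left)
    also have "\<dots> \<le> z ^ 2 / (1 - \<rho>) * C"
      using C(2)[OF S(1)] rho by (intro mult_left_mono) auto
    finally show ?thesis .
  qed
  moreover have "z ^ 2 / (1 - \<rho>) * C \<ge> 0" using C rho by auto
  ultimately show ?thesis by blast
qed

text \<open>Only the primes themselves have to be confined to \<open>(a, b]\<close>: the proper
  powers have bounded total contribution, which the \<open>+ 1\<close> absorbs.\<close>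

lemma prime_powers_bound:
  "\<exists>C>0. \<forall>a b. \<forall>Q::(nat \<times> nat) set. 0 < a \<longrightarrow> a \<le> b \<longrightarrow> finite Q \<longrightarrow>
     (\<forall>(p,j)\<in>Q. prime p \<and> j \<ge> 1 \<and> (j = 1 \<longrightarrow> a < real p \<and> real p \<le> b)) \<longrightarrow>
     (\<Sum>(p,j)\<in>Q. ln (real p) * f p ^ j) \<le> C * (ln (b / a) + 1)"
proof -
  obtain C0 where C0: "C0 \<ge> 0" "\<And>Q::(nat \<times> nat) set. finite Q \<Longrightarrow> (\<forall>(p,j)\<in>Q. prime p \<and> j \<ge> 2) \<Longrightarrow>
     (\<Sum>(p,j)\<in>Q. ln (real p) * f p ^ j) \<le> C0"
    using higher_powers_bound by blast
  have "(\<Sum>(p,j)\<in>Q. ln (real p) * f p ^ j) \<le> (6 * z + C0 + 1) * (ln (b / a) + 1)"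
    if ab: "0 < a" "a \<le> b" and Q: "finite Q"
      "\<forall>(p,j)\<in>Q. prime p \<and> j \<ge> 1 \<and> (j = 1 \<longrightarrow> a < real p \<and> real p \<le> b)" for a b and Q :: "(nat \<times> nat) set"
  proof -
    define Q1 where "Q1 = {q \<in> Q. snd q = 1}"
    define Q2 where "Q2 = {q \<in> Q. snd q \<noteq> 1}"
    define S where "S = fst ` Q1"
    have Q12: "Q = Q1 \<union> Q2" "Q1 \<inter> Q2 = {}" "finite Q1" "finite Q2"
      using Q by (auto simp: Q1_def Q2_def)
    have S: "finite S" "\<And>p. p \<in> S \<Longrightarrow> prime p \<and> a < real p \<and> real p \<le> b"
    proof -
      show "finite S" using Q12(3) by (simp add: S_def)
      fix p assume "p \<in> S"
      then have "(p, 1) \<in> Q" by (auto simp: S_def Q1_def)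
      then show "prime p \<and> a < real p \<and> real p \<le> b" using Q(2) by blast
    qed
    have Q2: "\<forall>(p,j)\<in>Q2. prime p \<and> j \<ge> 2"
    proof clarify
      fix p j assume "(p, j) \<in> Q2"
      then have "(p, j) \<in> Q" "j \<noteq> 1" by (auto simp: Q2_def)
      with Q(2) have "prime p" "j \<ge> 1" by blast+
      with \<open>j \<noteq> 1\<close> show "prime p \<and> j \<ge> 2" by simp
    qed
    have "(\<Sum>(p,j)\<in>Q. ln (real p) * f p ^ j) =
        (\<Sum>(p,j)\<in>Q1. ln (real p) * f p ^ j) + (\<Sum>(p,j)\<in>Q2. ln (real p) * f p ^ j)"
      unfolding Q12(1) using Q12 by (intro sum.union_disjoint)
    also have "(\<Sum>(p,j)\<in>Q1. ln (real p) * f p ^ j) = (\<Sum>p\<in>S. ln (real p) * f p)"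
      by (rule sum.reindex_bij_witness[of _ "\<lambda>p. (p, 1)" fst]) (auto simp: S_def Q1_def)
    also have "\<dots> \<le> (\<Sum>p\<in>S. z * (ln (real p) / real p))"
    proof (intro sum_mono)
      fix p assume "p \<in> S"
      then have "prime p" using S by auto
      then have "ln (real p) * f p \<le> ln (real p) * (z / real p)"
        using f_prime_le prime_gt_0_nat[of p] by (intro mult_left_mono) (auto simp: Suc_le_eq)
      then show "ln (real p) * f p \<le> z * (ln (real p) / real p)" by (simp add: mult_ac)
    qed
    also have "\<dots> = z * (\<Sum>p\<in>S. ln (real p) / real p)" by (simp only: sum_distrib_left)
    also have "\<dots> \<le> z * (6 * (ln (b / a) + 1))"
      using z_nonneg ab S by (intro mult_left_mono sum_ln_primes_interval) auto
    also have "(\<Sum>(p,j)\<in>Q2. ln (real p) * f p ^ j) \<le> C0"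
      using Q12(4) Q2 by (rule C0(2))
    also have "z * (6 * (ln (b / a) + 1)) + C0 \<le> (6 * z + C0 + 1) * (ln (b / a) + 1)"
    proof -
      have "ln (b / a) \<ge> 0" using ab by simp
      then show ?thesis using C0(1) by (simp add: algebra_simps)
    qed
    finally show ?thesis by simp
  qed
  moreover have "6 * z + C0 + 1 > 0" using z_nonneg C0 by simp
  ultimately show ?thesis by blast
qed

lemma power_pair_bound:
  fixes p j n :: nat
  assumes "prime p" "n > 0" "p ^ j dvd n"
  shows "j < n" "p ^ j \<le> n"
proof -
  show "p ^ j \<le> n" using assms dvd_imp_le by blast
  have "j < 2 ^ j" by simp
  also have "\<dots> \<le> p ^ j" using prime_ge_2_nat[OF assms(1)] by (intro power_mono) auto
  finally show "j < n" using \<open>p ^ j \<le> n\<close> by simp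
qed

text \<open>On \<open>(x, X]\<close> the factor \<open>ln x\<close> is at most \<open>ln n\<close>,
  and \<open>ln n\<close> is expanded over prime powers. For
  \<open>X = x powr (1 + \<delta>)\<close> with \<open>\<delta> * ln x \<ge> 1\<close> the result
  says that \<open>total X\<close> and \<open>total x\<close> differ by \<open>O(\<delta>)\<close>
  times \<open>total X\<close>.\<close>

lemma slow_variation:
  "\<exists>C>0. \<forall>x X. 1 \<le> x \<longrightarrow> x \<le> X \<longrightarrow> ln x * (total X - total x) \<le> C * (ln (X / x) + 1) * total X"
proof -
  obtain C where C: "C > 0" "\<And>a b. \<And>Q::(nat \<times> nat) set. 0 < a \<Longrightarrow> a \<le> b \<Longrightarrow> finite Q \<Longrightarrow>
     (\<forall>(p,j)\<in>Q. prime p \<and> j \<ge> 1 \<and> (j = 1 \<longrightarrow> a < real p \<and> real p \<le> b)) \<Longrightarrow>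
     (\<Sum>(p,j)\<in>Q. ln (real p) * f p ^ j) \<le> C * (ln (b / a) + 1)"
    using prime_powers_bound by blast
  have "ln x * (total X - total x) \<le> C * (ln (X / x) + 1) * total X" if x: "1 \<le> x" "x \<le> X" for x X
  proof -
    define G where "G = {n. 0 < n \<and> real n \<le> X}"
    define F where "F = {n. x < real n \<and> real n \<le> X}"
    define M where "M = nat \<lfloor>X\<rfloor>"
    define Q where "Q = {(p, j). prime p \<and> j \<ge> 1 \<and> p \<le> M \<and> j \<le> M}"
    have finG: "finite G" unfolding G_def by (rule finite_pos_le)
    have FG: "F \<subseteq> G" using x by (auto simp: F_def G_def intro!: Nat.gr0I)
    have finF: "finite F" using FG finG finite_subset by blast
    have "Q \<subseteq> {..M} \<times> {..M}" by (auto simp: Q_def)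
    then have finQ: "finite Q" by (rule finite_subset) auto
    have "total X = sum f (F \<union> {n. 0 < n \<and> real n \<le> x})"
      unfolding total_def using x by (intro sum.cong) (auto simp: F_def intro!: Nat.gr0I)
    also have "\<dots> = sum f F + total x" unfolding total_def
      using finF finite_pos_le by (intro sum.union_disjoint) (auto simp: F_def)
    finally have "ln x * (total X - total x) = (\<Sum>n\<in>F. f n * ln x)"
      by (simp add: sum_distrib_left mult.commute)
    also have "\<dots> \<le> (\<Sum>n\<in>F. f n * ln (real n))"
      using x f_nonneg by (intro sum_mono mult_left_mono) (auto simp: F_def)
    also have "\<dots> = (\<Sum>(p,j)\<in>Q. ln (real p) * f p ^ j * sum f {m. m * p ^ j \<in> F})"
    proof (rule log_weighted_sum)
      show "F \<subseteq> {0<..}" using FG by (auto simp: G_def)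
      fix p j n assume *: "n \<in> F" "prime p" "1 \<le> j" "p ^ j dvd n"
      have n: "n \<le> M" "n > 0" using *(1) FG by (auto simp: F_def G_def M_def le_nat_floor)
      have "p ^ 1 \<le> p ^ j" using *(2,3) prime_gt_0_nat[of p] by (intro power_increasing) auto
      then show "(p, j) \<in> Q" using power_pair_bound[OF *(2) n(2) *(4)] n * by (auto simp: Q_def)
    qed (use finF finQ in \<open>auto simp: Q_def\<close>)
    also have "\<dots> = (\<Sum>q\<in>Q. \<Sum>m\<in>{m \<in> G. m * fst q ^ snd q \<in> F}. f m * (ln (real (fst q)) * f (fst q) ^ snd q))"
    proof (intro sum.cong refl, clarify)
      fix p j assume "(p, j) \<in> Q"
      then have "p > 0" using prime_gt_0_nat by (auto simp: Q_def)
      have "{m. m * p ^ j \<in> F} \<subseteq> G"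
      proof
        fix m assume m: "m \<in> {m. m * p ^ j \<in> F}"
        then have mg: "m * p ^ j \<in> G" using FG by auto
        then have "0 < m" by (auto simp: G_def intro!: Nat.gr0I)
        have "real m \<le> real (m * p ^ j)" using \<open>p > 0\<close> by (intro of_nat_mono) simp
        also have "\<dots> \<le> X" using mg by (simp only: G_def mem_Collect_eq)
        finally show "m \<in> G" using \<open>0 < m\<close> by (simp add: G_def)
      qed
      then have "{m. m * p ^ j \<in> F} = {m \<in> G. m * p ^ j \<in> F}" by auto
      then show "ln (real p) * f p ^ j * sum f {m. m * p ^ j \<in> F} =
         (\<Sum>m\<in>{m \<in> G. m * fst (p, j) ^ snd (p, j) \<in> F}. f m * (ln (real (fst (p, j))) * f (fst (p, j)) ^ snd (p, j)))"
        by (simp add: sum_distrib_left mult_ac)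
    qed
    also have "\<dots> = (\<Sum>m\<in>G. \<Sum>q\<in>{q \<in> Q. m * fst q ^ snd q \<in> F}. f m * (ln (real (fst q)) * f (fst q) ^ snd q))"
      using finQ finG by (rule sum.swap_restrict)
    also have "\<dots> \<le> (\<Sum>m\<in>G. f m * (C * (ln (X / x) + 1)))"
    proof (intro sum_mono)
      fix m assume "m \<in> G"
      then have m: "m > 0" by (auto simp: G_def)
      \<comment> \<open>For fixed \<open>m\<close> the condition \<open>m * p \<in> F\<close> puts
        \<open>p\<close> into \<open>(x / m, X / m]\<close>, whose endpoints have the ratio
        \<open>X / x\<close> for every \<open>m\<close>.\<close>
      have "(\<Sum>(p,j)\<in>{q \<in> Q. m * fst q ^ snd q \<in> F}. ln (real p) * f p ^ j) \<le> C * (ln ((X / m) / (x / m)) + 1)"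
        using m x finQ by (intro C(2)) (auto simp: Q_def F_def field_simps)
      then have "(\<Sum>q\<in>{q \<in> Q. m * fst q ^ snd q \<in> F}. ln (real (fst q)) * f (fst q) ^ snd q) \<le> C * (ln (X / x) + 1)"
        using m by (simp add: case_prod_unfold)
      then have "f m * (\<Sum>q\<in>{q \<in> Q. m * fst q ^ snd q \<in> F}. ln (real (fst q)) * f (fst q) ^ snd q)
           \<le> f m * (C * (ln (X / x) + 1))"
        using f_nonneg by (intro mult_left_mono)
      then show "(\<Sum>q\<in>{q \<in> Q. m * fst q ^ snd q \<in> F}. f m * (ln (real (fst q)) * f (fst q) ^ snd q))
           \<le> f m * (C * (ln (X / x) + 1))"
        by (simp only: sum_distrib_left)
    qed
    also have "\<dots> = C * (ln (X / x) + 1) * total X"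
      by (simp only: sum_distrib_right [symmetric] total_def G_def mult.commute)
    finally show ?thesis .
  qed
  then show ?thesis using C(1) by blast
qed

text \<open>Elements beyond \<open>M\<close> have logarithm above \<open>ln M\<close>, while the
  prime powers available below \<open>y\<close> supply only \<open>O (ln y + 1)\<close> in total.
  The hypothesis concerns the cofactor sets of \<open>F\<close> and not all of
  \<open>smooth P\<close>, so that \<open>B\<close> may also be the much smaller bound for primitive
  sets.\<close>

lemma tail_bound:
  "\<exists>C>0. \<forall>y M B P F. y \<ge> 1 \<longrightarrow> M > 1 \<longrightarrow> B \<ge> 0 \<longrightarrow> (\<forall>p\<in>P. prime p \<and> real p \<le> y) \<longrightarrow> finite F \<longrightarrow>
     F \<subseteq> smooth P \<longrightarrow> (\<forall>s\<in>F. M < real s) \<longrightarrow>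
     (\<forall>p\<in>P. \<forall>j\<ge>1. sum f {m. m * p ^ j \<in> F} \<le> B) \<longrightarrow> ln M * sum f F \<le> C * (ln y + 1) * B"
proof -
  obtain C where C: "C > 0" "\<And>a b. \<And>Q::(nat \<times> nat) set. 0 < a \<Longrightarrow> a \<le> b \<Longrightarrow> finite Q \<Longrightarrow>
     (\<forall>(p,j)\<in>Q. prime p \<and> j \<ge> 1 \<and> (j = 1 \<longrightarrow> a < real p \<and> real p \<le> b)) \<Longrightarrow>
     (\<Sum>(p,j)\<in>Q. ln (real p) * f p ^ j) \<le> C * (ln (b / a) + 1)"
    using prime_powers_bound by blast
  have "ln M * sum f F \<le> C * (ln y + 1) * B"
    if y: "y \<ge> 1" and M: "M > 1" and B: "B \<ge> 0" and P: "\<forall>p\<in>P. prime p \<and> real p \<le> y"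
      and F: "finite F" "F \<subseteq> smooth P" "\<forall>s\<in>F. M < real s"
      and le: "\<forall>p\<in>P. \<forall>j\<ge>1. sum f {m. m * p ^ j \<in> F} \<le> B" for y M B P F
  proof -
    define K where "K = Max F"
    define Q where "Q = {(p, j). p \<in> P \<and> j \<ge> 1 \<and> j \<le> K}"
    have "P \<subseteq> {..nat \<lfloor>y\<rfloor>}" using P by (auto simp: le_nat_floor)
    then have "finite P" by (rule finite_subset) auto
    have "Q \<subseteq> P \<times> {..K}" by (auto simp: Q_def)
    then have finQ: "finite Q" by (rule finite_subset) (use \<open>finite P\<close> in auto)
    have QP: "prime p \<and> 1 \<le> j \<and> p \<in> P \<and> real p \<le> y" if "(p, j) \<in> Q" for p j
      using that P by (auto simp: Q_def)
    have "ln M * sum f F = (\<Sum>n\<in>F. f n * ln M)" by (simp add: sum_distrib_left mult.commute)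
    also have "\<dots> \<le> (\<Sum>n\<in>F. f n * ln (real n))"
    proof (intro sum_mono mult_left_mono)
      fix n assume "n \<in> F"
      then have "M < real n" using F by auto
      then show "ln M \<le> ln (real n)" using M by (subst ln_le_cancel_iff) auto
    qed (rule f_nonneg)
    also have "\<dots> = (\<Sum>(p,j)\<in>Q. ln (real p) * f p ^ j * sum f {m. m * p ^ j \<in> F})"
    proof (rule log_weighted_sum)
      show "F \<subseteq> {0<..}" using F smooth_pos by blast
      fix p j n assume *: "n \<in> F" "prime p" "1 \<le> j" "p ^ j dvd n"
      have n: "n \<in> smooth P" "n \<le> K" using * F by (auto simp: K_def)
      have "p dvd p ^ j" using *(3) by (intro dvd_power) auto
      then have "p dvd n" using *(4) by (rule dvd_trans)
      then have "p \<in> P" using smooth_prime_dvd[OF n(1) *(2)] by simp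
      then show "(p, j) \<in> Q" using power_pair_bound(1)[OF *(2) smooth_pos[OF n(1)] *(4)] n(2) *(3)
        by (auto simp: Q_def)
    qed (use F finQ QP in blast)+
    also have "\<dots> \<le> (\<Sum>(p,j)\<in>Q. ln (real p) * f p ^ j * B)"
    proof (intro sum_mono, clarify)
      fix p j assume pj: "(p, j) \<in> Q"
      note q = QP[OF pj]
      have "p \<ge> 1" using q prime_gt_0_nat[of p] by auto
      then show "ln (real p) * f p ^ j * sum f {m. m * p ^ j \<in> F} \<le> ln (real p) * f p ^ j * B"
        using le q f_nonneg by (intro mult_left_mono) auto
    qed
    also have "\<dots> = (\<Sum>(p,j)\<in>Q. ln (real p) * f p ^ j) * B"
      by (simp add: sum_distrib_right case_prod_unfold)
    also have "\<dots> \<le> C * (ln (y / 1) + 1) * B"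
    proof (intro mult_right_mono C(2))
      show "\<forall>(p,j)\<in>Q. prime p \<and> j \<ge> 1 \<and> (j = 1 \<longrightarrow> 1 < real p \<and> real p \<le> y)"
        using QP prime_gt_1_nat by fastforce
    qed (use y B finQ in auto)
    finally show ?thesis by simp
  qed
  then show ?thesis using C(1) by blast
qed

end

section \<open>Mertens' estimate for the sum of reciprocals of primes\<close>

definition recip_weight :: "real \<Rightarrow> nat \<Rightarrow> real" where
  "recip_weight s n = real n powr (- s)"

lemma recip_weight: "multiplicative_weight (recip_weight s)"
  by unfold_locales (auto simp: recip_weight_def powr_mult)

text \<open>From below, the Euler product over primes up to \<open>y\<close> dominates the harmonic
  sum. From above, the exponent is moved to \<open>1 + 1 / ln y\<close>, where the zeta function is
  at most \<open>ln y + 1\<close>. A bounded error suffices, since only the ratio to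
  \<open>ln (ln N)\<close> matters later.\<close>

lemma prime_recip_sum:
  "\<exists>C. \<forall>y\<ge>2. \<bar>(\<Sum>p | prime p \<and> real p \<le> y. 1 / real p) - ln (ln y)\<bar> \<le> C"
proof -
  have "\<bar>(\<Sum>p | prime p \<and> real p \<le> y. 1 / real p) - ln (ln y)\<bar> \<le> 30" if y: "y \<ge> 2" for y :: real
  proof -
    define P where "P = {p. prime p \<and> real p \<le> y}"
    have ly: "ln y \<ge> 1 / 2"
    proof -
      have "ln 2 \<le> ln y" using y by simp
      then show ?thesis using ln2_ge_two_thirds by linarith
    qed
    have "P \<subseteq> {..nat \<lfloor>y\<rfloor>}" by (auto simp: P_def le_nat_floor)
    then have finP: "finite P" by (rule finite_subset) auto
    have P: "prime p" "real p \<ge> 2" if "p \<in> P" for p using that prime_ge_2_nat[of p] by (auto simp: P_def)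
    have lower: "ln (ln y) \<le> (\<Sum>p\<in>P. 1 / real p) + 4"
    proof -
      interpret multiplicative_weight "recip_weight 1" by (rule recip_weight)
      have rw: "recip_weight 1 n = 1 / real n" for n
        by (simp add: recip_weight_def powr_minus_divide)
      define N where "N = nat \<lfloor>y\<rfloor>"
      have "y \<le> real N + 1" using y unfolding N_def by linarith
      then have "ln y \<le> ln (real N + 1)" using y by simp
      also have "\<dots> \<le> harm N" by (rule harm_ge_ln)
      also have "\<dots> = sum (recip_weight 1) {1..N}" by (simp add: harm_def rw divide_inverse)
      also have "\<dots> \<le> (\<Prod>p\<in>P. 1 / (1 - recip_weight 1 p))"
      proof (rule euler_product_le)
        show "{1..N} \<subseteq> smooth P"
        proof
          fix n assume n: "n \<in> {1..N}"
          show "n \<in> smooth P"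
          proof (rule smoothI)
            fix p assume p: "prime p" "p dvd n"
            then have "p \<le> n" using n dvd_imp_le[of p n] by auto
            then have "p \<le> N" using n by auto
            then have "real p \<le> y" using y by (simp add: N_def le_nat_iff le_floor_iff)
            then show "p \<in> P" using p by (simp add: P_def)
          qed (use n in auto)
        qed
        fix p assume "p \<in> P"
        then show "prime p \<and> recip_weight 1 p < 1" using P[of p] by (simp add: rw)
      qed (use finP in auto)
      also have "\<dots> \<le> (\<Prod>p\<in>P. exp (1 / real p + 2 * (1 / real p ^ 2)))"
      proof (intro prod_mono conjI)
        fix p assume p: "p \<in> P"
        define u where "u = 1 / real p"
        have u: "0 < u" "u \<le> 1 / 2" using P[OF p] by (auto simp: u_def)
        show "0 \<le> 1 / (1 - recip_weight 1 p)" using u by (simp add: rw u_def)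
        have "1 / (1 - u) \<le> 1 + (u + 2 * u ^ 2)"
        proof -
          have "1 \<le> (1 + (u + 2 * u ^ 2)) * (1 - u)"
          proof -
            have "(1 + (u + 2 * u ^ 2)) * (1 - u) - 1 = u ^ 2 * (1 - 2 * u)"
              by (simp add: algebra_simps power2_eq_square)
            moreover have "u ^ 2 * (1 - 2 * u) \<ge> 0" using u by auto
            ultimately show ?thesis by linarith
          qed
          then show ?thesis using u by (simp add: divide_le_eq)
        qed
        also have "\<dots> \<le> exp (u + 2 * u ^ 2)" by (rule exp_ge_add_one_self)
        finally show "1 / (1 - recip_weight 1 p) \<le> exp (1 / real p + 2 * (1 / real p ^ 2))"
          by (simp add: rw u_def power_divide)
      qed
      also have "\<dots> = exp (\<Sum>p\<in>P. 1 / real p + 2 * (1 / real p ^ 2))" using finP by (simp add: exp_sum)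
      finally have "ln (ln y) \<le> ln (exp (\<Sum>p\<in>P. 1 / real p + 2 * (1 / real p ^ 2)))"
        using ly by (subst ln_le_cancel_iff) auto
      then have "ln (ln y) \<le> (\<Sum>p\<in>P. 1 / real p + 2 * (1 / real p ^ 2))"
        by (simp only: ln_exp)
      also have "\<dots> = (\<Sum>p\<in>P. 1 / real p) + 2 * (\<Sum>p\<in>P. 1 / real p ^ 2)"
        by (simp only: sum.distrib sum_distrib_left)
      also have "(\<Sum>p\<in>P. 1 / real p ^ 2) \<le> 2 / 1"
      proof (rule sum_inverse_squares_le)
        fix p assume "p \<in> P"
        then show "1 < real p" using P[of p] by simp
      qed (use finP in auto)
      finally show ?thesis by simp
    qed
    have upper: "(\<Sum>p\<in>P. 1 / real p) \<le> ln (ln y) + 30"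
    proof -
      \<comment> \<open>With this choice \<open>1 + 1 / \<delta>\<close> is \<open>ln y + 1\<close>,
        and replacing \<open>p powr (-(1 + \<delta>))\<close> by \<open>1 / p\<close> costs at most
        \<open>\<delta>\<close> times the sum of \<open>ln p / p\<close>, which is bounded.\<close>
      define \<delta> where "\<delta> = 1 / ln y"
      have d: "\<delta> > 0" using ly by (simp add: \<delta>_def)
      interpret multiplicative_weight "recip_weight (1 + \<delta>)" by (rule recip_weight)
      define l where "l = sum (recip_weight (1 + \<delta>)) P"
      \<comment> \<open>The levels of \<open>Omega\<close> are disjoint sets of integers, so the
        partial sums of the series for \<open>exp l\<close> are bounded by partial sums of the zeta
        function.\<close>
      have "(\<Sum>k<K. l ^ k / fact k) \<le> 1 + 1 / \<delta>" for K
      proof -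
        note lev = level_sum_ge[of P, OF finP P(1)]
        have "(\<Sum>k<K. l ^ k / fact k) \<le> (\<Sum>k<K. sum (recip_weight (1 + \<delta>)) {s \<in> smooth P. Omega s = k})"
          unfolding l_def by (intro sum_mono lev(2))
        also have "\<dots> = sum (recip_weight (1 + \<delta>)) (\<Union>k<K. {s \<in> smooth P. Omega s = k})"
          using lev(1) by (subst sum.UNION_disjoint) auto
        also have "\<dots> \<le> 1 + 1 / \<delta>" unfolding recip_weight_def
          using lev(1) d smooth_pos[of _ P] by (intro recip_sum_powr_le) auto
        finally show ?thesis .
      qed
      moreover have "(\<lambda>k. l ^ k / fact k) sums exp l"
        using exp_converges[of l] by (simp add: scaleR_conv_of_real divide_inverse mult.commute)
      ultimately have "exp l \<le> 1 + 1 / \<delta>"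
        by (intro LIMSEQ_le_const2[of "\<lambda>K. \<Sum>k<K. l ^ k / fact k"]) (auto simp: sums_def)
      then have "exp l \<le> ln y + 1" by (simp add: \<delta>_def)
      also have "\<dots> = ln y * (1 + 1 / ln y)" using ly by (simp add: field_simps)
      also have "\<dots> \<le> exp (ln (ln y)) * exp (1 / ln y)"
        using ly by (intro mult_mono exp_ge_add_one_self) auto
      finally have "l \<le> ln (ln y) + 1 / ln y" by (simp flip: exp_add)
      also have "1 / ln y \<le> 2" using ly by (simp add: divide_le_eq)
      finally have l: "l \<le> ln (ln y) + 2" by simp
      have "(\<Sum>p\<in>P. 1 / real p) - l = (\<Sum>p\<in>P. 1 / real p - recip_weight (1 + \<delta>) p)"
        by (simp add: l_def sum_subtractf)
      also have "\<dots> \<le> (\<Sum>p\<in>P. \<delta> * (ln (real p) / real p))"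
      proof (intro sum_mono)
        fix p assume p: "p \<in> P"
        have "1 - \<delta> * ln (real p) \<le> exp (- \<delta> * ln (real p))"
          using exp_ge_add_one_self[of "- \<delta> * ln (real p)"] by simp
        also have "\<dots> = real p powr (-\<delta>)" using P(2)[OF p] by (simp add: powr_def)
        finally have "1 / real p * (1 - real p powr (-\<delta>)) \<le> 1 / real p * (\<delta> * ln (real p))"
          by (intro mult_left_mono) auto
        moreover have "recip_weight (1 + \<delta>) p = 1 / real p * real p powr (-\<delta>)"
          using P(2)[OF p] powr_add[of "real p" "-1" "-\<delta>"] by (simp add: recip_weight_def powr_minus_divide)
        ultimately show "1 / real p - recip_weight (1 + \<delta>) p \<le> \<delta> * (ln (real p) / real p)"
          by (simp add: algebra_simps)
      qed
      also have "\<dots> = \<delta> * (\<Sum>p\<in>P. ln (real p) / real p)" by (simp only: sum_distrib_left)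
      also have "\<dots> \<le> \<delta> * (6 * (ln (y / 1) + 1))"
      proof (intro mult_left_mono sum_ln_primes_interval)
        fix p assume "p \<in> P"
        then show "prime p \<and> 1 < real p \<and> real p \<le> y" using P[of p] by (simp add: P_def)
      qed (use d y finP in auto)
      also have "\<dots> = 6 + 6 * (1 / ln y)" using ly by (simp add: \<delta>_def field_simps)
      also have "\<dots> \<le> 6 + 6 * 2" using \<open>1 / ln y \<le> 2\<close> by simp
      finally show ?thesis using l by simp
    qed
    show ?thesis using lower upper by (simp add: P_def abs_le_iff)
  qed
  then show ?thesis by blast
qed

section \<open>Stirling's formula and the Poisson distribution\<close>

text \<open>The summand \<open>1 / 2\<close> makes consecutive differences of the sequence
  \<open>O(1 / n^2)\<close>, so it converges to some \<open>L\<close>. Wallis' product then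
  identifies \<open>L\<close>, because its logarithm is \<open>4 * s n - 2 * s (2 * n)\<close> up to
  explicit terms.\<close>

lemma stirling:
  "(\<lambda>n. ln (fact n) - ((real n + 1 / 2) * ln (real n) - real n)) \<longlonglongrightarrow> ln (2 * pi) / 2"
proof -
  define s where "s n = ln (fact n) - ((real n + 1 / 2) * ln (real n) - real n)" for n
  have "(\<lambda>n. (real n + 1 / 2) * ln (1 + 1 / real n) - 1) \<in> O(\<lambda>n. real n powr -2)"
    by real_asymp
  moreover have "summable (\<lambda>n. real n powr -2)" by (simp add: summable_real_powr_iff)
  ultimately have "summable (\<lambda>n. (real n + 1 / 2) * ln (1 + 1 / real n) - 1)"
    using summable_comparison_test_bigo[of "\<lambda>n. real n powr -2"] by simp
  moreover have "(real n + 1 / 2) * ln (1 + 1 / real n) - 1 = s n - s (Suc n)" if "n \<ge> 1" for n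
  proof -
    have "1 + 1 / real n = (real n + 1) / real n" using that by (simp add: field_simps)
    then have e1: "ln (1 + 1 / real n) = ln (real n + 1) - ln (real n)"
      using that by (simp add: ln_div)
    have e2: "ln (fact (Suc n) :: real) = ln (real n + 1) + ln (fact n)"
      by (simp add: ln_mult add.commute del: of_nat_Suc)
    have e3: "real (Suc n) = real n + 1" by simp
    show ?thesis unfolding s_def e1 e2 e3 by (simp add: algebra_simps)
  qed
  ultimately have "summable (\<lambda>n. s n - s (Suc n))"
    by (subst summable_cong) (auto intro!: eventually_sequentiallyI[of 1])
  then have "convergent (\<lambda>n. \<Sum>k<n. s k - s (Suc k))" by (simp add: summable_iff_convergent)
  then have "convergent (\<lambda>n. s 0 - (\<Sum>k<n. s k - s (Suc k)))" by (intro convergent_diff convergent_const)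
  moreover have "s 0 - (\<Sum>k<n. s k - s (Suc k)) = s n" for n by (induction n) auto
  ultimately obtain L where L: "s \<longlonglongrightarrow> L" by (auto simp: convergent_def)
  have W: "(\<Prod>k=1..n. (4 * real k ^ 2) / (4 * real k ^ 2 - 1)) =
      (4 ^ n * fact n ^ 2) ^ 2 / (fact (2 * n) ^ 2 * (2 * real n + 1))" for n
  proof (induction n)
    case (Suc n)
    have e1: "(\<Prod>k=1..Suc n. (4 * real k ^ 2) / (4 * real k ^ 2 - 1)) =
       (4 ^ n * fact n ^ 2) ^ 2 / (fact (2 * n) ^ 2 * (2 * real n + 1)) *
       ((4 * real (Suc n) ^ 2) / (4 * real (Suc n) ^ 2 - 1))"
      by (subst Suc [symmetric]) (simp add: prod.nat_ivl_Suc')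
    have e2: "(fact (Suc n) :: real) = (real n + 1) * fact n" by simp
    have e3: "(fact (2 * Suc n) :: real) = (2 * real n + 2) * (2 * real n + 1) * fact (2 * n)"
      by (simp add: algebra_simps)
    have e4: "4 * real (Suc n) ^ 2 - 1 = (2 * real n + 1) * (2 * real n + 3)"
      by (simp add: algebra_simps power2_eq_square)
    have e5: "2 * real (Suc n) + 1 = 2 * real n + 3" by simp
    have alg: "(f1 * a ^ 2) ^ 2 / (b ^ 2 * u) * ((4 * x ^ 2) / (u * v)) =
        ((4 * f1) * (x * a) ^ 2) ^ 2 / ((2 * x * u * b) ^ 2 * v)"
      if "u > 0" "v > 0" "x > 0" "b > 0" for f1 a b u v x :: real
      using that by (simp add: divide_simps) (simp add: power2_eq_square power4_eq_xxxx algebra_simps)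
    show ?case
      unfolding e1 e2 e3 e4 e5
      using alg[of "2 * real n + 1" "2 * real n + 3" "real n + 1" "fact (2 * n)" "4 ^ n" "fact n"]
      by (simp add: algebra_simps)
  qed simp
  have lnW: "ln (\<Prod>k=1..n. (4 * real k ^ 2) / (4 * real k ^ 2 - 1)) =
      4 * s n - 2 * s (2 * n) - ln 2 + (ln (real n) - ln (2 * real n + 1))" if "n \<ge> 1" for n
  proof -
    have "ln (\<Prod>k=1..n. (4 * real k ^ 2) / (4 * real k ^ 2 - 1)) =
        ln ((4 ^ n * fact n ^ 2) ^ 2) - ln (fact (2 * n) ^ 2 * (2 * real n + 1))"
      unfolding W using that by (subst ln_div) auto
    also have "ln ((4 ^ n * fact n ^ 2 :: real) ^ 2) = 2 * (real n * ln 4 + 2 * ln (fact n))"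
      by (simp add: ln_realpow ln_mult)
    also have "ln (fact (2 * n) ^ 2 * (2 * real n + 1)) = 2 * ln (fact (2 * n)) + ln (2 * real n + 1)"
      using that by (simp add: ln_mult ln_realpow)
    also have "ln (4 :: real) = 2 * ln 2" using ln_realpow[of 2 2] by simp
    finally have e: "ln (\<Prod>k=1..n. (4 * real k ^ 2) / (4 * real k ^ 2 - 1)) =
       2 * (real n * (2 * ln 2) + 2 * ln (fact n)) - (2 * ln (fact (2 * n)) + ln (2 * real n + 1))" .
    have "ln (2 * real n) = ln 2 + ln (real n)" using that by (simp add: ln_mult)
    then have "s (2 * n) = ln (fact (2 * n)) - ((2 * real n + 1 / 2) * (ln 2 + ln (real n)) - 2 * real n)"
      by (simp add: s_def)
    then show ?thesis unfolding e by (simp add: s_def algebra_simps)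
  qed
  \<comment> \<open>Comparison with \<open>ln (pi / 2)\<close> gives
    \<open>2 * L = ln (pi / 2) + 2 * ln 2 = ln (2 * pi)\<close>.\<close>
  have A: "(\<lambda>n. 4 * s n - 2 * s (2 * n) - ln 2 + (ln (real n) - ln (2 * real n + 1)))
      \<longlonglongrightarrow> 4 * L - 2 * L - ln 2 + (- ln 2)"
  proof (intro tendsto_intros L)
    show "(\<lambda>n. s (2 * n)) \<longlonglongrightarrow> L"
      by (rule filterlim_compose[OF L]) real_asymp
    show "(\<lambda>n. ln (real n) - ln (2 * real n + 1)) \<longlonglongrightarrow> - ln 2"
      by real_asymp
  qed
  have "(\<lambda>n. ln (\<Prod>k=1..n. (4 * real k ^ 2) / (4 * real k ^ 2 - 1))) \<longlonglongrightarrow> ln (pi / 2)"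
    by (intro tendsto_ln wallis) auto
  moreover have "(\<lambda>n. ln (\<Prod>k=1..n. (4 * real k ^ 2) / (4 * real k ^ 2 - 1)))
      \<longlonglongrightarrow> 4 * L - 2 * L - ln 2 + (- ln 2)"
    by (rule Lim_transform_eventually[OF A], rule eventually_sequentiallyI[of 1]) (rule lnW [symmetric])
  ultimately have "4 * L - 2 * L - ln 2 + (- ln 2) = ln (pi / 2)"
    by (rule LIMSEQ_unique[rotated])
  then have "L = ln (2 * pi) / 2" by (simp add: ln_div ln_mult)
  with L have "s \<longlonglongrightarrow> ln (2 * pi) / 2" by (simp only:)
  then show ?thesis unfolding s_def .
qed

text \<open>The ratio of consecutive terms is \<open>l / (n + 1)\<close>, which crosses 1 at
  \<open>\<lfloor>l\<rfloor>\<close>.\<close>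

lemma poisson_max:
  fixes l :: real
  assumes "l \<ge> 0"
  shows "l ^ k / fact k \<le> l ^ nat \<lfloor>l\<rfloor> / fact (nat \<lfloor>l\<rfloor>)"
proof -
  define k0 where "k0 = nat \<lfloor>l\<rfloor>"
  have succ: "l ^ Suc n / fact (Suc n) = l ^ n / fact n * (l / real (Suc n))" for n
    by (simp add: field_simps)
  have nn: "l ^ n / fact n \<ge> 0" for n using assms by simp
  show ?thesis
  proof (cases "k \<le> k0")
    case True
    then have "l ^ k / fact k \<le> l ^ k0 / fact k0"
    proof (induction rule: inc_induct)
      case (step n)
      have "real (Suc n) \<le> l" using step.hyps assms unfolding k0_def by linarith
      then have "l ^ n / fact n * 1 \<le> l ^ n / fact n * (l / real (Suc n))"
        using nn by (intro mult_left_mono) auto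
      then show ?case using step.IH succ[of n] by simp
    qed simp
    then show ?thesis by (simp add: k0_def)
  next
    case False
    then have "k0 \<le> k" by simp
    then have "l ^ k / fact k \<le> l ^ k0 / fact k0"
    proof (induction rule: dec_induct)
      case (step n)
      have "l \<le> real (Suc n)" using step.hyps assms unfolding k0_def by linarith
      then have "l ^ n / fact n * (l / real (Suc n)) \<le> l ^ n / fact n * 1"
        using nn by (intro mult_left_mono) auto
      then show ?case using step.IH succ[of n] by simp
    qed simp
    then show ?thesis by (simp add: k0_def)
  qed
qed

text \<open>An exact decomposition into three errors: a term of size about
  \<open>(k - l)^2 / l\<close> that is never positive, a logarithm that vanishes as
  \<open>k / l \<rightarrow> 1\<close>, and the error in Stirling's formula.\<close>

lemma poisson_ln:
  fixes l :: real
  assumes "l > 0" "k \<ge> 1"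
  shows "ln (l ^ k / fact k * (sqrt (2 * pi * l) / exp l)) =
    (real k * ln (l / real k) + real k - l) + ln (l / real k) / 2 +
    (ln (2 * pi) / 2 - (ln (fact k) - ((real k + 1 / 2) * ln (real k) - real k)))"
proof -
  have "ln (l ^ k / fact k * (sqrt (2 * pi * l) / exp l)) =
     real k * ln l - ln (fact k) + (ln (2 * pi * l) / 2 - l)"
    using assms by (simp add: ln_mult ln_div ln_realpow ln_sqrt)
  also have "ln (2 * pi * l) = ln (2 * pi) + ln l" using assms by (simp add: ln_mult)
  finally show ?thesis using assms by (simp add: ln_div algebra_simps add_divide_distrib diff_divide_distrib)
qed

text \<open>Uniformity in \<open>k\<close> comes from \<open>poisson_max\<close>; at the mode the
  first error is discarded by \<open>ln x \<le> x - 1\<close> and the other two tend to 0.\<close>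

lemma poisson_upper:
  assumes "\<epsilon> > 0"
  shows "\<forall>\<^sub>F l in at_top. \<forall>k. l ^ k / fact k \<le> (1 + \<epsilon>) * (exp l / sqrt (2 * pi * l))"
proof -
  define s where "s n = ln (fact n) - ((real n + 1 / 2) * ln (real n) - real n)" for n
  have s: "s \<longlonglongrightarrow> ln (2 * pi) / 2" unfolding s_def by (rule stirling)
  have fl: "filterlim (\<lambda>l::real. nat \<lfloor>l\<rfloor>) sequentially at_top"
    by (rule filterlim_compose[OF filterlim_nat_sequentially filterlim_floor_sequentially])
  have "((\<lambda>l::real. ln (2 * pi) / 2 - s (nat \<lfloor>l\<rfloor>)) \<longlongrightarrow> ln (2 * pi) / 2 - ln (2 * pi) / 2) at_top"
    by (intro tendsto_intros filterlim_compose[OF s fl])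
  moreover have "((\<lambda>l::real. ln (l / real (nat \<lfloor>l\<rfloor>)) / 2) \<longlongrightarrow> 0) at_top"
    by real_asymp
  ultimately have "((\<lambda>l::real. ln (l / real (nat \<lfloor>l\<rfloor>)) / 2 + (ln (2 * pi) / 2 - s (nat \<lfloor>l\<rfloor>))) \<longlongrightarrow> 0) at_top"
    using tendsto_add by fastforce
  moreover have "ln (1 + \<epsilon>) > 0" using assms by simp
  ultimately have "\<forall>\<^sub>F l::real in at_top. ln (l / real (nat \<lfloor>l\<rfloor>)) / 2 + (ln (2 * pi) / 2 - s (nat \<lfloor>l\<rfloor>)) < ln (1 + \<epsilon>)"
    by (rule order_tendstoD)
  then show ?thesis using eventually_ge_at_top[of 1]
  proof eventually_elim
    case (elim l)
    define k where "k = nat \<lfloor>l\<rfloor>"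
    have k: "k \<ge> 1" using elim by (simp add: k_def le_nat_floor)
    have "real k * ln (l / real k) \<le> real k * (l / real k - 1)"
      using elim k by (intro mult_left_mono ln_le_minus_one) auto
    also have "\<dots> = l - real k" using k by (simp add: field_simps)
    finally have "ln (l ^ k / fact k * (sqrt (2 * pi * l) / exp l)) \<le> ln (1 + \<epsilon>)"
      using poisson_ln[of l k] elim k by (simp add: s_def k_def)
    then have "l ^ k / fact k * (sqrt (2 * pi * l) / exp l) \<le> 1 + \<epsilon>"
      using elim assms by (subst (asm) ln_le_cancel_iff) auto
    then have "l ^ k / fact k \<le> (1 + \<epsilon>) * (exp l / sqrt (2 * pi * l))"
      using elim by (simp add: field_simps)
    then show ?case using poisson_max[of l] elim unfolding k_def by (meson order_trans zero_le_one)
  qed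
qed

text \<open>Within a fixed distance \<open>K\<close> of \<open>l\<close> the first error is at least
  \<open>- K ^ 2 / l\<close>, so bounded shifts of the level do not affect the peak in the
  limit.\<close>

lemma poisson_lower:
  assumes "\<epsilon> > 0" "\<epsilon> < 1"
  shows "\<forall>\<^sub>F l in at_top. \<forall>k. \<bar>real k - l\<bar> \<le> K \<longrightarrow> (1 - \<epsilon>) * (exp l / sqrt (2 * pi * l)) \<le> l ^ k / fact k"
proof -
  define s where "s n = ln (fact n) - ((real n + 1 / 2) * ln (real n) - real n)" for n
  have s: "s \<longlonglongrightarrow> ln (2 * pi) / 2" unfolding s_def by (rule stirling)
  define \<eta> where "\<eta> = - ln (1 - \<epsilon>)"
  have eta: "\<eta> > 0" using assms by (simp add: \<eta>_def)
  have "\<forall>\<^sub>F k in sequentially. s k < ln (2 * pi) / 2 + \<eta> / 2"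
    using s eta by (intro order_tendstoD(2)) auto
  then obtain k1 where k1: "\<And>k. k \<ge> k1 \<Longrightarrow> s k < ln (2 * pi) / 2 + \<eta> / 2"
    by (auto simp: eventually_sequentially)
  have "((\<lambda>l::real. (K ^ 2 + \<bar>K\<bar>) / l) \<longlongrightarrow> 0) at_top" by real_asymp
  then have "\<forall>\<^sub>F l::real in at_top. (K ^ 2 + \<bar>K\<bar>) / l < \<eta> / 2"
    using eta by (intro order_tendstoD(2)) auto
  then show ?thesis using eventually_ge_at_top[of "\<bar>K\<bar> + real k1 + 1"]
  proof eventually_elim
    case (elim l)
    show ?case
    proof (intro allI impI)
      fix k :: nat assume k: "\<bar>real k - l\<bar> \<le> K"
      have l: "l > 0" using elim by linarith
      have "real k \<ge> real k1 + 1" using k elim by linarith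
      then have kk: "k \<ge> k1" "k \<ge> 1" by linarith+
      have ln: "ln (l / real k) \<ge> 1 - real k / l"
        using ln_le_minus_one[of "real k / l"] l kk by (simp add: ln_div)
      have "real k * (1 - real k / l) \<le> real k * ln (l / real k)"
        using ln by (intro mult_left_mono) auto
      moreover have "real k * (1 - real k / l) + real k - l = - ((real k - l) ^ 2 / l)"
        using l by (simp add: field_simps power2_eq_square)
      moreover have "(real k - l) ^ 2 / l \<le> K ^ 2 / l"
        using k l by (intro divide_right_mono) (auto simp flip: abs_le_square_iff)
      moreover have "ln (l / real k) \<ge> - (\<bar>K\<bar> / l)"
      proof -
        have "1 - real k / l = (l - real k) / l" using l by (simp add: field_simps)
        also have "\<dots> \<ge> (- \<bar>K\<bar>) / l" using k l by (intro divide_right_mono) auto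
        finally show ?thesis using ln by simp
      qed
      moreover have "\<bar>K\<bar> / l \<ge> 0" using l by simp
      moreover have "(K ^ 2 + \<bar>K\<bar>) / l = K ^ 2 / l + \<bar>K\<bar> / l" by (simp add: add_divide_distrib)
      moreover note k1[OF kk(1)] elim(1)
      ultimately have "ln (1 - \<epsilon>) \<le> ln (l ^ k / fact k * (sqrt (2 * pi * l) / exp l))"
        using poisson_ln[of l k] l kk(2) unfolding s_def \<eta>_def by linarith
      then have "1 - \<epsilon> \<le> l ^ k / fact k * (sqrt (2 * pi * l) / exp l)"
        using l assms by (subst (asm) ln_le_cancel_iff) auto
      then show "(1 - \<epsilon>) * (exp l / sqrt (2 * pi * l)) \<le> l ^ k / fact k"
        using l by (simp add: field_simps)
    qed
  qed
qed

section \<open>Blocks of primes\<close>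

text \<open>Here \<open>P\<close> is a finite set of medium-sized primes, and \<open>tail\<close> says that the elements of
  \<open>smooth P\<close> beyond \<open>M\<close> carry little weight.\<close>

locale prime_block = multiplicative_weight +
  fixes P :: "nat set" and l M E S B \<tau> :: real
  assumes finP: "finite P" and P: "p \<in> P \<Longrightarrow> prime p \<and> f p < 1"
    and l: "l = sum f P" and l_pos: "l > 0"
    and E: "(\<Prod>p\<in>P. 1 / (1 - f p ^ 2)) \<le> E"
    and S: "(\<Prod>p\<in>P. 1 / (1 - f p)) \<le> S"
    and B: "l ^ k / fact k \<le> B"
    and M: "M \<ge> 1" and tau: "\<tau> \<ge> 0"
    and tail: "D \<ge> 0 \<Longrightarrow> finite F \<Longrightarrow> F \<subseteq> smooth P \<Longrightarrow> (\<And>s. s \<in> F \<Longrightarrow> M < real s) \<Longrightarrow>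
      (\<And>p j. p \<in> P \<Longrightarrow> j \<ge> 1 \<Longrightarrow> sum f {m. m * p ^ j \<in> F} \<le> D) \<Longrightarrow> sum f F \<le> \<tau> * D"
begin

lemma B_pos: "B > 0"
  using B[of 0] by simp

lemma E_pos: "E > 0"
proof -
  have "(\<Prod>p\<in>P. 1 / (1 - f p ^ 2)) > 0"
  proof (intro prod_pos)
    fix p assume "p \<in> P"
    then show "1 / (1 - f p ^ 2) > 0" using P[of p] f_nonneg[of p] by (auto simp: power_less_one_iff)
  qed
  then show ?thesis using E by simp
qed

lemma S_pos: "S > 0"
proof -
  have "(\<Prod>p\<in>P. 1 / (1 - f p)) > 0" using P by (intro prod_pos) auto
  then show ?thesis using S by simp
qed

lemma smooth_sum_le: "finite F \<Longrightarrow> F \<subseteq> smooth P \<Longrightarrow> sum f F \<le> S"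
  using euler_product_le[of P F] finP P S by fastforce

lemma primitive_smooth_sum_le:
  assumes "finite A" "A \<subseteq> smooth P" "primitive_set A"
  shows "sum f A \<le> E * B"
proof -
  have "sum f A \<le> (\<Prod>p\<in>P. 1 / (1 - f p ^ 2)) * B"
    using assms finP P l l_pos B by (intro primitive_sum_le) auto
  also have "\<dots> \<le> E * B" using E B_pos by (intro mult_right_mono) auto
  finally show ?thesis .
qed

lemma finite_cofactors:
  fixes F :: "nat set"
  assumes "finite F" "q > 0" shows "finite {m. m * q \<in> F}"
proof -
  have "finite ((\<lambda>m. m * q) -` F)" using assms by (intro finite_vimageI) (auto simp: inj_def)
  then show ?thesis by (simp add: vimage_def)
qed

lemma P_power_pos: "p \<in> P \<Longrightarrow> p ^ j > 0"
  using P[of p] prime_gt_0_nat[of p] by simp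

lemma finite_smooth_level: "finite {s \<in> smooth P. Omega s = k}"
  using level_sum_ge(1)[of P k] finP P by blast

lemma level_ge: "l ^ k / fact k \<le> sum f {s \<in> smooth P. Omega s = k}"
  unfolding l using level_sum_ge(2)[of P k] finP P by blast

text \<open>Adding the Poisson lower bounds over all levels yields \<open>exp l\<close>; the
  elements beyond \<open>M\<close> are removed by \<open>tail\<close>, with the full mass
  \<open>S\<close> as bound for the cofactor sets.\<close>

lemma smooth_sum_ge:
  "exp l - \<tau> * S \<le> sum f {s \<in> smooth P. real s \<le> M}"
proof -
  define T where "T = {s \<in> smooth P. real s \<le> M}"
  have finT: "finite T"
    by (rule finite_subset[OF _ finite_pos_le[of M]]) (auto simp: T_def smooth_def)
  have part: "(\<Sum>k<K. l ^ k / fact k) \<le> sum f T + \<tau> * S" for K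
  proof -
    define F where "F = (\<Union>k<K. {s \<in> smooth P. Omega s = k})"
    have finF: "finite F" unfolding F_def using finite_smooth_level by blast
    have Fsm: "F \<subseteq> smooth P" by (auto simp: F_def)
    define F1 where "F1 = {s \<in> F. M < real s}"
    have big: "sum f F1 \<le> \<tau> * S"
    proof (rule tail)
      fix p j assume p: "p \<in> P" "j \<ge> (1::nat)"
      have "{m. m * p ^ j \<in> F1} \<subseteq> smooth P" using Fsm by (auto simp: F1_def smooth_mult_iff)
      moreover have "finite {m. m * p ^ j \<in> F1}"
        using finF P_power_pos[OF p(1)] by (intro finite_cofactors) (auto simp: F1_def)
      ultimately show "sum f {m. m * p ^ j \<in> F1} \<le> S" by (rule smooth_sum_le[rotated])
    qed (use S_pos finF Fsm in \<open>auto simp: F1_def\<close>)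
    have "(\<Sum>k<K. l ^ k / fact k) \<le> (\<Sum>k<K. sum f {s \<in> smooth P. Omega s = k})"
      by (intro sum_mono level_ge)
    also have "\<dots> = sum f F"
      unfolding F_def using finite_smooth_level by (subst sum.UNION_disjoint) auto
    also have "\<dots> \<le> sum f (T \<union> F1)"
      using finT finF Fsm f_nonneg by (intro sum_mono2) (auto simp: T_def F1_def)
    also have "\<dots> \<le> sum f T + sum f F1"
      using finT finF by (subst sum.union_disjoint) (auto simp: T_def F1_def)
    finally show ?thesis using big by simp
  qed
  have "(\<lambda>k. l ^ k / fact k) sums exp l"
    using exp_converges[of l] by (simp add: scaleR_conv_of_real divide_inverse mult.commute)
  then have "exp l \<le> sum f T + \<tau> * S"
    using part by (intro LIMSEQ_le_const2[of "\<lambda>K. \<Sum>k<K. l ^ k / fact k"]) (auto simp: sums_def)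
  then show ?thesis by (simp add: T_def)
qed

text \<open>Fibring over \<open>r\<close> bounds \<open>sum f A\<close> by
  \<open>E * B * sum f G\<close>. To return from \<open>G\<close> to integers, every
  \<open>r \<in> G\<close> is multiplied by every \<open>s \<le> M\<close>: the products are
  distinct and at most \<open>X * M\<close>. This decouples \<open>s\<close> from \<open>r\<close>
  at the price of enlarging \<open>X\<close> by the factor \<open>M\<close>.\<close>

lemma primitive_upper:
  assumes A: "A \<subseteq> {n. 0 < n \<and> real n \<le> X}" "primitive_set A" and V: "\<tau> * S \<le> exp l"
  shows "sum f A * (exp l - \<tau> * S) \<le> E * B * total (X * M)"
proof -
  define G where "G = smooth_part (-P) ` A"
  define H where "H = {s \<in> smooth P. real s \<le> M}"
  have finA: "finite A" using A(1) finite_pos_le finite_subset by blast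
  have Gsm: "G \<subseteq> smooth (-P)" using smooth_part_smooth by (auto simp: G_def)
  have "sum f A = (\<Sum>r\<in>G. f r * sum f {s \<in> smooth P. s * r \<in> A})"
    unfolding G_def using finA A(1) by (intro sum_split) auto
  also have "\<dots> \<le> (\<Sum>r\<in>G. f r * (E * B))"
  proof (intro sum_mono mult_left_mono primitive_smooth_sum_le)
    fix r assume "r \<in> G"
    then have r: "r > 0" using Gsm smooth_pos by auto
    show "finite {s \<in> smooth P. s * r \<in> A}"
      by (rule finite_subset[OF _ finite_cofactors[OF finA r]]) auto
    show "primitive_set {s \<in> smooth P. s * r \<in> A}" using A(2) r by (rule primitive_fiber)
  qed (auto simp: f_nonneg)
  also have "\<dots> = E * B * sum f G" by (simp add: sum_distrib_left mult.commute)
  finally have "sum f A * (exp l - \<tau> * S) \<le> E * B * sum f G * (exp l - \<tau> * S)"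
    using V by (intro mult_right_mono) auto
  also have "\<dots> = E * B * (sum f G * (exp l - \<tau> * S))" by simp
  also have "\<dots> \<le> E * B * total (X * M)"
  proof (intro mult_left_mono)
    have "sum f G * (exp l - \<tau> * S) \<le> sum f G * sum f H"
      unfolding H_def using smooth_sum_ge f_nonneg by (intro mult_left_mono sum_nonneg)
    also have "\<dots> = (\<Sum>r\<in>G. f r * sum f H)" by (simp only: sum_distrib_right)
    also have "\<dots> \<le> total (X * M)"
      unfolding total_def
    proof (rule sum_prod_le[of _ _ P])
      fix r s assume rs: "r \<in> G" "s \<in> H"
      then obtain a where a: "a \<in> A" "r = smooth_part (-P) a" by (auto simp: G_def)
      then have "a > 0" "real a \<le> X" using A(1) by auto
      then have "real r \<le> X" using smooth_part_le[of a "-P"] a(2) by linarith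
      moreover have "real s \<le> M" "s > 0" using rs smooth_pos by (auto simp: H_def)
      ultimately have "real r * real s \<le> X * M" by (intro mult_mono) auto
      moreover have "r > 0" using rs Gsm smooth_pos by auto
      ultimately show "s * r \<in> {n. 0 < n \<and> real n \<le> X * M}"
        using \<open>s > 0\<close> by (simp add: mult.commute)
    qed (use finite_pos_le finA Gsm in \<open>auto simp: G_def H_def\<close>)
    finally show "sum f G * (exp l - \<tau> * S) \<le> total (X * M)" .
  qed (use E_pos B_pos in auto)
  finally show ?thesis .
qed

text \<open>For each rough \<open>r\<close> with few prime factors, the cofactor must have level
  \<open>k - Omega r\<close>, and all these levels lie within \<open>K\<close> of \<open>k\<close>,
  where the Poisson terms are still at least \<open>L\<close>. The truncations
  \<open>r * M \<le> X\<close> and \<open>s \<le> M\<close> again make the two choices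
  independent.\<close>

lemma level_lower:
  assumes L: "\<And>j. j \<le> k \<Longrightarrow> k \<le> j + K \<Longrightarrow> L \<le> l ^ j / fact j" and K: "K \<le> k"
  shows "sum f {r \<in> smooth (-P). real r * M \<le> X \<and> Omega r \<le> K} * (L - \<tau> * (E * B)) \<le>
    sum f {n. 0 < n \<and> real n \<le> X \<and> Omega n = k}"
proof -
  define G where "G = {r \<in> smooth (-P). real r * M \<le> X \<and> Omega r \<le> K}"
  define H where "H r = {s \<in> smooth P. Omega s = k - Omega r \<and> real s \<le> M}" for r
  have H: "L - \<tau> * (E * B) \<le> sum f (H r)" if r: "r \<in> G" for r
  proof -
    define j where "j = k - Omega r"
    have j: "j \<le> k" "k \<le> j + K" using r by (auto simp: j_def G_def)
    define T where "T = {s \<in> smooth P. Omega s = j}"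
    define F1 where "F1 = {s \<in> T. M < real s}"
    have finT: "finite T" unfolding T_def by (rule finite_smooth_level)
    have "sum f F1 \<le> \<tau> * (E * B)"
    proof (rule tail)
      fix p i assume p: "p \<in> P" "i \<ge> (1::nat)"
      \<comment> \<open>Cofactors of a level set by a prime power lie on one level, hence form a
        primitive set. The bound \<open>S\<close> would be useless here: a loss of order
        \<open>\<tau> * exp l\<close> eventually exceeds the peak \<open>L\<close>, which is smaller
        by a factor of order \<open>sqrt l\<close>.\<close>
      show "sum f {m. m * p ^ i \<in> F1} \<le> E * B"
      proof (rule primitive_smooth_sum_le)
        show "finite {m. m * p ^ i \<in> F1}"
          using finT P_power_pos[OF p(1)] by (intro finite_cofactors) (auto simp: F1_def)
        show sm: "{m. m * p ^ i \<in> F1} \<subseteq> smooth P" by (auto simp: F1_def T_def smooth_mult_iff)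
        show "primitive_set {m. m * p ^ i \<in> F1}"
        proof (rule primitive_level[of _ "j - i"])
          fix a assume a: "a \<in> {m. m * p ^ i \<in> F1}"
          then have "a > 0" using sm smooth_pos by auto
          moreover have "Omega (a * p ^ i) = j" using a by (auto simp: F1_def T_def)
          ultimately show "a > 0 \<and> Omega a = j - i"
            using P[OF p(1)] P_power_pos[OF p(1)] by (simp add: Omega_mult Omega_prime_power)
        qed
      qed
    next
      show "finite F1" using finT by (rule rev_finite_subset) (auto simp: F1_def)
    qed (use E_pos B_pos in \<open>auto simp: F1_def T_def\<close>)
    moreover have "sum f T = sum f (H r \<union> F1)"
      by (intro sum.cong) (auto simp: T_def H_def F1_def j_def)
    moreover have "sum f (H r \<union> F1) = sum f (H r) + sum f F1"
    proof (rule sum.union_disjoint)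
      show "finite (H r)" by (rule finite_subset[OF _ finT]) (auto simp: H_def T_def j_def)
    qed (use finT in \<open>auto simp: H_def F1_def\<close>)
    moreover have "L \<le> sum f T" unfolding T_def using L[OF j] level_ge[of j] by linarith
    ultimately show ?thesis by linarith
  qed
  have finG: "finite G"
  proof (rule finite_subset[OF _ finite_pos_le[of X]], safe)
    fix r assume r: "r \<in> G"
    then show "r > 0" by (auto simp: G_def smooth_def)
    have "real r * 1 \<le> real r * M" using M by (intro mult_left_mono) auto
    then show "real r \<le> X" using r by (auto simp: G_def)
  qed
  have "sum f G * (L - \<tau> * (E * B)) = (\<Sum>r\<in>G. f r * (L - \<tau> * (E * B)))"
    by (simp only: sum_distrib_right)
  also have "\<dots> \<le> (\<Sum>r\<in>G. f r * sum f (H r))"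
    using H f_nonneg by (intro sum_mono mult_left_mono)
  also have "\<dots> \<le> sum f {n. 0 < n \<and> real n \<le> X \<and> Omega n = k}"
  proof (rule sum_prod_le[of _ _ P])
    show "finite {n. 0 < n \<and> real n \<le> X \<and> Omega n = k}"
      by (rule finite_subset[OF _ finite_pos_le[of X]]) auto
    fix r s assume rs: "r \<in> G" "s \<in> H r"
    have pos: "r > 0" "s > 0" using rs by (auto simp: G_def H_def smooth_def)
    have "real s * real r \<le> M * real r" using rs by (intro mult_right_mono) (auto simp: H_def)
    also have "\<dots> \<le> X" using rs by (auto simp: G_def mult.commute)
    finally have "real (s * r) \<le> X" by simp
    moreover have "Omega (s * r) = k" using pos rs K by (simp add: Omega_mult H_def G_def)
    ultimately show "s * r \<in> {n. 0 < n \<and> real n \<le> X \<and> Omega n = k}" using pos by simp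
  qed (use finG in \<open>auto simp: G_def H_def\<close>)
  finally show ?thesis by (simp add: G_def)
qed

text \<open>Used as a lower bound for the rough sum: every fibre has weight at most
  \<open>S\<close>, however it is cut off by \<open>Y\<close>.\<close>

lemma total_le_rough: "total Y \<le> S * sum f {r \<in> smooth (-P). real r \<le> Y}"
proof -
  define F where "F = {n. 0 < n \<and> real n \<le> Y}"
  have finF: "finite F" unfolding F_def by (rule finite_pos_le)
  have "total Y = (\<Sum>r\<in>smooth_part (-P) ` F. f r * sum f {s \<in> smooth P. s * r \<in> F})"
    unfolding total_def F_def[symmetric] using finF by (intro sum_split) (auto simp: F_def)
  also have "\<dots> \<le> (\<Sum>r\<in>smooth_part (-P) ` F. f r * S)"
  proof (intro sum_mono mult_left_mono smooth_sum_le)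
    fix r assume "r \<in> smooth_part (-P) ` F"
    then have "r > 0" using smooth_part_pos by auto
    show "finite {s \<in> smooth P. s * r \<in> F}"
      by (rule finite_subset[OF _ finite_cofactors[OF finF \<open>r > 0\<close>]]) auto
  qed (auto simp: f_nonneg)
  also have "\<dots> = S * sum f (smooth_part (-P) ` F)" by (simp add: sum_distrib_left mult.commute)
  also have "\<dots> \<le> S * sum f {r \<in> smooth (-P). real r \<le> Y}"
  proof (intro mult_left_mono sum_mono2)
    show "finite {r \<in> smooth (-P). real r \<le> Y}"
      by (rule finite_subset[OF _ finite_pos_le[of Y]]) (auto simp: smooth_def)
    show "smooth_part (-P) ` F \<subseteq> {r \<in> smooth (-P). real r \<le> Y}"
    proof safe
      fix n assume n: "n \<in> F"
      show "smooth_part (-P) n \<in> smooth (-P)" by (rule smooth_part_smooth)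
      have "smooth_part (-P) n \<le> n" using n by (intro smooth_part_le) (auto simp: F_def)
      then show "real (smooth_part (-P) n) \<le> Y" using n unfolding F_def by (auto intro: order_trans[rotated])
    qed
  qed (use S_pos f_nonneg in auto)
  finally show ?thesis .
qed

end

section \<open>Integers with exceptionally many prime factors\<close>

context multiplicative_weight
begin

text \<open>The weights of the levels of \<open>smooth T\<close> form a convergent series, bounded
  by the Euler product, and \<open>K\<close> is a point beyond which its tail is below
  \<open>\<eta>\<close>. It depends on \<open>T\<close> and \<open>\<eta>\<close>, but not on
  \<open>F\<close>.\<close>

lemma large_Omega_small:
  assumes T: "finite T" "\<And>p. p \<in> T \<Longrightarrow> prime p \<and> f p < 1" and "\<eta> > 0"
  shows "\<exists>K. \<forall>F. finite F \<longrightarrow> F \<subseteq> {t \<in> smooth T. K < Omega t} \<longrightarrow> sum f F \<le> \<eta>"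
proof -
  define S where "S = (\<Prod>p\<in>T. 1 / (1 - f p))"
  define h where "h k = sum f {s \<in> smooth T. Omega s = k}" for k
  define U where "U K = (\<Union>k<K. {s \<in> smooth T. Omega s = k})" for K
  have fin: "finite {s \<in> smooth T. Omega s = k}" for k
    using level_sum_ge(1)[of T k] T by blast
  have finU: "finite (U K)" for K unfolding U_def using fin by blast
  have hU: "(\<Sum>k<K. h k) = sum f (U K)" for K
    unfolding h_def U_def using fin by (subst sum.UNION_disjoint) auto
  have bound: "(\<Sum>k<K. h k) \<le> S" for K
    unfolding hU S_def using T finU by (intro euler_product_le) (auto simp: U_def)
  have h0: "h k \<ge> 0" for k unfolding h_def by (intro sum_nonneg f_nonneg)
  have sm: "summable h" using h0 bound by (intro summableI_nonneg_bounded[of h S]) auto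
  then have "(\<lambda>K. \<Sum>k<K. h k) \<longlonglongrightarrow> suminf h" by (simp add: summable_LIMSEQ)
  then have "\<forall>\<^sub>F K in sequentially. suminf h - \<eta> < (\<Sum>k<K. h k)"
    using assms(3) by (intro order_tendstoD(1)) auto
  then obtain K where K: "suminf h - \<eta> < (\<Sum>k<K. h k)"
    by (auto simp: eventually_sequentially)
  have "sum f F \<le> \<eta>" if F: "finite F" "F \<subseteq> {t \<in> smooth T. K < Omega t}" for F
  proof -
    define J where "J = Suc (Max (insert K (Omega ` F)))"
    have "Omega t < J" if "t \<in> F" for t
      using F(1) that by (auto simp: J_def less_Suc_eq_le)
    moreover have "K \<le> Max (insert K (Omega ` F))" using F(1) by (intro Max_ge) auto
    then have "K \<le> J" unfolding J_def by linarith
    ultimately have "F \<union> U K \<subseteq> U J" using F(2) by (fastforce simp: U_def)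
    moreover have "F \<inter> U K = {}" using F(2) by (auto simp: U_def)
    ultimately have "sum f F + sum f (U K) \<le> sum f (U J)"
      using F(1) finU f_nonneg by (subst sum.union_disjoint [symmetric]) (auto intro!: sum_mono2)
    also have "\<dots> \<le> suminf h" unfolding hU [symmetric] using sm h0 by (intro sum_le_suminf) auto
    finally show ?thesis using K by (simp add: hU)
  qed
  then show ?thesis by blast
qed

text \<open>With \<open>T\<close> the small primes, the part of \<open>r\<close> free of
  \<open>T\<close> has only large prime factors and hence at most \<open>K1\<close> of them. So
  \<open>Omega r > K1 + K2\<close> forces a \<open>T\<close>-part with more than \<open>K2\<close>
  prime factors, and each such fibre has weight at most \<open>\<eta>\<close>.\<close>

lemma large_Omega_rough:
  assumes T: "T \<inter> P = {}"
    and small: "\<And>F. finite F \<Longrightarrow> F \<subseteq> {t \<in> smooth T. K2 < Omega t} \<Longrightarrow> sum f F \<le> \<eta>"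
    and large: "\<And>r. r \<in> smooth (- (P \<union> T)) \<Longrightarrow> real r \<le> Y \<Longrightarrow> Omega r \<le> K1"
  shows "sum f {r \<in> smooth (-P). real r \<le> Y \<and> K1 + K2 < Omega r} \<le>
    \<eta> * sum f {r \<in> smooth (-P). real r \<le> Y}"
proof -
  define R where "R = {r \<in> smooth (-P). real r \<le> Y}"
  define F where "F = {r \<in> smooth (-P). real r \<le> Y \<and> K1 + K2 < Omega r}"
  define G where "G = smooth_part (-T) ` F"
  have finR: "finite R" by (rule finite_subset[OF _ finite_pos_le[of Y]]) (auto simp: R_def smooth_def)
  have FR: "F \<subseteq> R" by (auto simp: F_def R_def)
  have finF: "finite F" using FR finR finite_subset by blast
  have eta: "\<eta> \<ge> 0" using small[of "{}"] by simp
  have G: "r \<in> smooth (- (P \<union> T)) \<and> real r \<le> Y" if r: "r \<in> G" for r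
  proof -
    obtain n where n: "n \<in> F" "r = smooth_part (-T) n" using r by (auto simp: G_def)
    have n': "n \<in> smooth (-P)" "real n \<le> Y" using n by (auto simp: F_def)
    have "r \<in> smooth (-P)"
      unfolding n(2) using smooth_dvd[OF n'(1) smooth_part_dvd[OF smooth_pos[OF n'(1)]]] .
    moreover have "r \<in> smooth (-T)" unfolding n(2) by (rule smooth_part_smooth)
    moreover have "real r \<le> Y"
      using smooth_part_le[OF smooth_pos[OF n'(1)], of "-T"] n'(2) n(2) by linarith
    ultimately show ?thesis by (auto simp: smooth_def)
  qed
  have "sum f F = (\<Sum>r\<in>G. f r * sum f {t \<in> smooth T. t * r \<in> F})"
    unfolding G_def using finF by (intro sum_split) (auto simp: F_def smooth_def)
  also have "\<dots> \<le> (\<Sum>r\<in>G. f r * \<eta>)"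
  proof (intro sum_mono mult_left_mono small)
    fix r assume r: "r \<in> G"
    have rpos: "r > 0" using G[OF r] smooth_pos by blast
    have "finite ((\<lambda>t. t * r) -` F)" using finF rpos by (intro finite_vimageI) (auto simp: inj_def)
    then show "finite {t \<in> smooth T. t * r \<in> F}" by (rule rev_finite_subset) auto
    show "{t \<in> smooth T. t * r \<in> F} \<subseteq> {t \<in> smooth T. K2 < Omega t}"
    proof safe
      fix t assume t: "t \<in> smooth T" "t * r \<in> F"
      have "Omega (t * r) = Omega t + Omega r" by (rule Omega_mult[OF smooth_pos[OF t(1)] rpos])
      moreover have "Omega r \<le> K1" using G[OF r] large by blast
      moreover have "K1 + K2 < Omega (t * r)" using t(2) by (simp add: F_def)
      ultimately show "K2 < Omega t" by linarith
    qed
  qed (rule f_nonneg)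
  also have "\<dots> = \<eta> * sum f G" by (simp add: sum_distrib_left mult.commute)
  also have "\<dots> \<le> \<eta> * sum f R"
  proof (intro mult_left_mono sum_mono2)
    show "G \<subseteq> R"
    proof
      fix r assume "r \<in> G"
      then show "r \<in> R" using G[of r] smooth_mono[of "- (P \<union> T)" "-P"] by (auto simp: R_def)
    qed
  qed (use finR f_nonneg eta in auto)
  finally show ?thesis by (simp add: F_def R_def)
qed

end

section \<open>The cases \<open>z > 2\<close> and \<open>z = 2\<close>\<close>

text \<open>At \<open>n = 0\<close> division by zero gives the value 0, so that multiplicativity
  holds on all natural numbers.\<close>

definition omega_weight :: "real \<Rightarrow> nat \<Rightarrow> real" where
  "omega_weight z n = z ^ Omega n / real n"

lemma weight_sum_eq: "weight_sum z A = sum (omega_weight z) A"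
  by (simp add: weight_sum_def omega_weight_def)

lemma multiplicative_omega_weight: "z \<ge> 0 \<Longrightarrow> multiplicative_weight (omega_weight z)"
proof
  fix m n :: nat
  show "omega_weight z (m * n) = omega_weight z m * omega_weight z n"
    by (cases "m = 0 \<or> n = 0") (auto simp: omega_weight_def Omega_mult power_add)
qed (auto simp: omega_weight_def)

lemma omega_weight_prime: "prime p \<Longrightarrow> omega_weight z p = z / real p"
  by (simp add: omega_weight_def Omega_prime)

lemma bounded_omega_weight:
  assumes "0 \<le> z" "z < 2" shows "bounded_weight (omega_weight z) z (z / 2)"
proof -
  interpret multiplicative_weight "omega_weight z"
    using assms by (intro multiplicative_omega_weight)
  show ?thesis
  proof
    fix p :: nat assume p: "prime p"
    show "omega_weight z p \<le> z / real p" using p by (simp add: omega_weight_prime)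
    have "real p \<ge> 2" using prime_ge_2_nat[OF p] by simp
    then show "omega_weight z p \<le> z / 2"
      using p assms frac_le[of z z 2 "real p"] by (simp add: omega_weight_prime)
  qed (use assms in auto)
qed

lemma max_density_le:
  assumes "\<And>A. A \<subseteq> {1..N} \<Longrightarrow> primitive_set A \<Longrightarrow> weight_sum z A / weight_sum z {1..N} \<le> c"
  shows "max_density z N \<le> c"
  unfolding max_density_def using max_density_wf[of N] assms by (intro Max.boundedI) auto

lemma max_density_ge:
  assumes "A \<subseteq> {1..N}" "primitive_set A"
  shows "weight_sum z A / weight_sum z {1..N} \<le> max_density z N"
  unfolding max_density_def using max_density_wf[of N] assms by (intro Max_ge) auto

lemma max_density_nonneg: "max_density z N \<ge> 0"
  using max_density_ge[of "{}" N z] by (simp add: primitive_set_def weight_sum_def)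

section \<open>Chains of multiples by powers of 2\<close>

lemma smooth_2_powers: "s \<in> smooth {2} \<longleftrightarrow> (\<exists>j. s = 2 ^ j)"
proof
  assume s: "s \<in> smooth {2}"
  then have "s = (\<Prod>q\<in>prime_factors s. q ^ multiplicity q s)"
    by (simp add: smooth_def prime_factorization_nat)
  moreover have "prime_factors s = {} \<or> prime_factors s = {2}" using s by (auto simp: smooth_def)
  ultimately show "\<exists>j. s = 2 ^ j" by (auto intro: exI[of _ 0])
next
  assume "\<exists>j. s = 2 ^ j"
  then show "s \<in> smooth {2}"
    by (auto simp: smooth_def prime_factorization_prime_power split: if_splits)
qed

lemma omega_weight_2_power: "omega_weight z (2 ^ j) = (z / 2) ^ j"
  by (simp add: omega_weight_def Omega_prime_power power_divide)

lemma primitive_upper_half: "primitive_set {n. n \<le> N \<and> N < 2 * n}"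
  unfolding primitive_set_def
proof (intro ballI impI)
  fix a b assume ab: "a \<in> {n. n \<le> N \<and> N < 2 * n}" "b \<in> {n. n \<le> N \<and> N < 2 * n}" "a dvd b"
  then obtain c where c: "b = a * c" by (auto elim: dvdE)
  have "c < 2"
  proof (rule ccontr)
    assume "\<not> c < 2"
    then have "a * 2 \<le> a * c" by (intro mult_left_mono) auto
    then show False using ab(1,2) unfolding c mem_Collect_eq by linarith
  qed
  moreover have "c \<noteq> 0" using ab(2) c by (intro notI) simp
  ultimately have "c = 1" by simp
  then show "a = b" using c by simp
qed

text \<open>The hypothesis compares the last term of the geometric progression along a chain with
  the whole progression. Only lengths with \<open>2 ^ J \<le> N\<close> occur, which allows a
  \<open>c\<close> depending on \<open>N\<close> when \<open>z = 2\<close>.\<close>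

lemma upper_half_weight:
  assumes z: "z > 0"
    and c: "\<And>J. 2 ^ J \<le> N \<Longrightarrow> c * (\<Sum>j\<le>J. (z / 2) ^ j) \<le> (z / 2) ^ J"
  shows "c * weight_sum z {1..N} \<le> weight_sum z {n. n \<le> N \<and> N < 2 * n}"
proof -
  let ?f = "omega_weight z"
  interpret multiplicative_weight ?f using z by (intro multiplicative_omega_weight) auto
  define G where "G = smooth_part (-{2}) ` {1..N}"
  define J where "J r = Max {j. 2 ^ j * r \<le> N}" for r
  have G: "r > 0" "r \<le> N" if r: "r \<in> G" for r
  proof -
    obtain n where n: "r = smooth_part (-{2}) n" "n > 0" "n \<le> N"
      using r by (auto simp: G_def Suc_le_eq)
    show "r > 0" unfolding n(1) by (rule smooth_part_pos)
    show "r \<le> N" using n smooth_part_le[of n "-{2}"] by simp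
  qed
  have J: "2 ^ j * r \<le> N \<longleftrightarrow> j \<le> J r" if r: "r \<in> G" for r j
  proof -
    have fin: "finite {j. 2 ^ j * r \<le> N}"
    proof (rule finite_subset)
      show "{j. 2 ^ j * r \<le> N} \<subseteq> {..N}"
      proof
        fix j assume j: "j \<in> {j. 2 ^ j * r \<le> N}"
        have "j < 2 ^ j" by simp
        also have "\<dots> \<le> 2 ^ j * r" using G[OF r] by simp
        also have "\<dots> \<le> N" using j by simp
        finally show "j \<in> {..N}" by simp
      qed
    qed auto
    have "2 ^ 0 * r \<le> N" using G[OF r] by simp
    then have "J r \<in> {j. 2 ^ j * r \<le> N}"
      unfolding J_def using fin by (intro Max_in) blast+
    then have Jr: "2 ^ J r * r \<le> N" by simp
    have "2 ^ j * r \<le> N" if "j \<le> J r"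
    proof -
      have "2 ^ j * r \<le> 2 ^ J r * r" using that by (intro mult_right_mono power_increasing) auto
      then show ?thesis using Jr by (rule order_trans)
    qed
    moreover have "j \<le> J r" if "2 ^ j * r \<le> N"
      unfolding J_def using fin that by (intro Max_ge) auto
    ultimately show ?thesis by blast
  qed
  have "c * sum ?f {1..N} = (\<Sum>r\<in>G. ?f r * (c * sum ?f {s \<in> smooth {2}. s * r \<in> {1..N}}))"
    unfolding G_def by (subst sum_split[of _ "{2}"]) (auto simp: sum_distrib_left mult_ac)
  also have "\<dots> \<le> (\<Sum>r\<in>G. ?f r * sum ?f {2 ^ J r})"
  proof (intro sum_mono mult_left_mono)
    fix r assume r: "r \<in> G"
    have "{s \<in> smooth {2}. s * r \<in> {1..N}} = (\<lambda>j. 2 ^ j) ` {..J r}"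
      using J[OF r] G[OF r] by (auto simp: smooth_2_powers Suc_le_eq)
    then have "sum ?f {s \<in> smooth {2}. s * r \<in> {1..N}} = (\<Sum>j\<le>J r. (z / 2) ^ j)"
      by (simp add: sum.reindex inj_on_def omega_weight_2_power)
    moreover have "2 ^ J r \<le> N"
    proof -
      have "2 ^ J r \<le> 2 ^ J r * r" using G[OF r] by simp
      also have "\<dots> \<le> N" using J[OF r, of "J r"] by simp
      finally show ?thesis .
    qed
    ultimately show "c * sum ?f {s \<in> smooth {2}. s * r \<in> {1..N}} \<le> sum ?f {2 ^ J r}"
      using c by (simp add: omega_weight_2_power)
  qed (rule f_nonneg)
  also have "\<dots> \<le> sum ?f {n. n \<le> N \<and> N < 2 * n}"
  proof (rule sum_prod_le[of _ _ "{2}"])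
    fix r s :: nat
    assume rs: "r \<in> G" "s \<in> {2 ^ J r}"
    then have s: "s = 2 ^ J r" by simp
    have "2 ^ J r * r \<le> N" "\<not> 2 ^ Suc (J r) * r \<le> N"
      using J[OF rs(1), of "J r"] J[OF rs(1), of "Suc (J r)"] by auto
    then show "s * r \<in> {n. n \<le> N \<and> N < 2 * n}" using s by simp
  next
    fix r
    show "{2 ^ J r} \<subseteq> smooth {2}" by (auto simp: smooth_2_powers)
  qed (auto simp: G_def smooth_part_smooth)
  finally show ?thesis by (simp add: weight_sum_eq)
qed

lemma weight_sum_pos:
  assumes "z > 0" "N \<ge> 1" shows "weight_sum z {1..N} > 0"
  unfolding weight_sum_def using assms by (intro sum_pos) auto

lemma max_density_ge_upper_half:
  assumes "z > 0" "N \<ge> 1" "\<And>J. 2 ^ J \<le> N \<Longrightarrow> c * (\<Sum>j\<le>J. (z / 2) ^ j) \<le> (z / 2) ^ J"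
  shows "c \<le> max_density z N"
proof -
  have "c * weight_sum z {1..N} \<le> weight_sum z {n. n \<le> N \<and> N < 2 * n}"
    using assms by (intro upper_half_weight)
  then have "c \<le> weight_sum z {n. n \<le> N \<and> N < 2 * n} / weight_sum z {1..N}"
    using weight_sum_pos[OF assms(1,2)] by (simp add: le_divide_eq)
  also have "\<dots> \<le> max_density z N"
    by (intro max_density_ge primitive_upper_half) auto
  finally show ?thesis .
qed

text \<open>For \<open>u = z / 2 > 1\<close> the last term of a geometric progression starting at 1
  makes up at least the share \<open>(u - 1) / u = 1 - 2 / z\<close>.\<close>

lemma max_density_supercritical:
  assumes "z > 2" "N \<ge> 1" shows "1 - 2 / z \<le> max_density z N"
proof (rule max_density_ge_upper_half)
  fix J :: nat
  define u where "u = z / 2"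
  have u: "u > 1" using assms by (simp add: u_def)
  have "(u - 1) * (\<Sum>j\<le>J. u ^ j) = u ^ Suc J - 1"
    by (subst power_diff_1_eq) (simp add: lessThan_Suc_atMost)
  then have "(u - 1) / u * (\<Sum>j\<le>J. u ^ j) = (u ^ Suc J - 1) / u" by simp
  also have "\<dots> \<le> u ^ J" using u by (simp add: divide_le_eq mult.commute)
  also have "(u - 1) / u = 1 - 2 / z" using assms by (simp add: u_def field_simps)
  finally show "(1 - 2 / z) * (\<Sum>j\<le>J. (z / 2) ^ j) \<le> (z / 2) ^ J" by (simp add: u_def)
qed (use assms in auto)

text \<open>For \<open>z = 2\<close> all terms along a chain are equal, so the share is
  \<open>1 / (J + 1)\<close>. The constant 3 comes from \<open>ln 2 \<ge> 2 / 3\<close>: both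
  \<open>J\<close> and 1 are at most \<open>3 / 2 * ln N\<close>.\<close>

lemma max_density_2_lower:
  assumes "N \<ge> 2" shows "1 / (3 * ln (real N)) \<le> max_density 2 N"
proof (rule max_density_ge_upper_half)
  fix J :: nat assume J: "2 ^ J \<le> N"
  have lnN: "ln (real N) \<ge> ln 2" using assms by simp
  have l2: "ln (2::real) \<ge> 2 / 3" by (rule ln2_ge_two_thirds)
  have "real (2 ^ J) \<le> real N" using J of_nat_le_iff by blast
  then have "ln (2 ^ J) \<le> ln (real N)" using assms by (subst ln_le_cancel_iff) auto
  then have "real J * ln 2 \<le> ln (real N)" by (simp add: ln_realpow)
  moreover have "real J * (2 / 3) \<le> real J * ln 2" using l2 by (intro mult_left_mono) auto
  ultimately have "real J + 1 \<le> 3 * ln (real N)" using lnN l2 by linarith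
  then show "1 / (3 * ln (real N)) * (\<Sum>j\<le>J. (2 / 2) ^ j) \<le> (2 / 2) ^ J"
    using lnN l2 by (simp add: divide_le_eq)
qed (use assms in auto)

text \<open>Slow variation shows that raising \<open>x\<close> to the power
  \<open>1 + \<delta>\<close> at most doubles \<open>total\<close>; finitely many such steps reach
  \<open>x ^ 2\<close>.\<close>

lemma (in bounded_weight) total_square_le:
  "\<exists>C>0. \<exists>x0\<ge>1. \<forall>x\<ge>x0. total (x ^ 2) \<le> C * total x"
proof -
  obtain C where C: "C > 0" "\<And>x X. 1 \<le> x \<Longrightarrow> x \<le> X \<Longrightarrow> ln x * (total X - total x) \<le> C * (ln (X / x) + 1) * total X"
    using slow_variation by blast
  \<comment> \<open>With \<open>ln x \<ge> 4 * C\<close>, this makes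
    \<open>C * (\<delta> * ln x + 1) = ln x / 4 + C\<close> at most \<open>ln x / 2\<close>, which
    is what doubling requires.\<close>
  define \<delta> where "\<delta> = 1 / (4 * C)"
  have d: "\<delta> > 0" using C by (simp add: \<delta>_def)
  define x0 where "x0 = exp (4 * C)"
  have x0: "x0 \<ge> 1" using C by (simp add: x0_def)
  have step: "total (x powr (1 + \<delta>)) \<le> 2 * total x" if x: "x \<ge> x0" for x
  proof -
    have lx: "ln x \<ge> 4 * C" using x x0 ln_mono[of x0 x] by (simp add: x0_def)
    have x1: "x \<ge> 1" using x x0 by simp
    have le: "x \<le> x powr (1 + \<delta>)" using x1 d powr_mono[of 1 "1 + \<delta>" x] by simp
    have "ln (x powr (1 + \<delta>) / x) = \<delta> * ln x"
      using x1 by (simp add: ln_div ln_powr algebra_simps)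
    then have "ln x * (total (x powr (1 + \<delta>)) - total x) \<le> C * (\<delta> * ln x + 1) * total (x powr (1 + \<delta>))"
      using C(2)[OF x1 le] by simp
    also have "C * (\<delta> * ln x + 1) \<le> ln x / 2"
    proof -
      have "C * (\<delta> * ln x + 1) = ln x / 4 + C" using C by (simp add: \<delta>_def field_simps)
      then show ?thesis using lx by simp
    qed
    then have "C * (\<delta> * ln x + 1) * total (x powr (1 + \<delta>)) \<le> ln x / 2 * total (x powr (1 + \<delta>))"
      using total_ge_1[of "x powr (1 + \<delta>)"] le x1 by (intro mult_right_mono) auto
    finally have "ln x * (total (x powr (1 + \<delta>)) - total x) \<le> ln x * (total (x powr (1 + \<delta>)) / 2)"
      by simp
    moreover have "ln x > 0" using lx C by linarith
    ultimately have "total (x powr (1 + \<delta>)) - total x \<le> total (x powr (1 + \<delta>)) / 2"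
      by (simp only: mult_le_cancel_left_pos)
    then show ?thesis by simp
  qed
  have iter: "total (x powr ((1 + \<delta>) ^ n)) \<le> 2 ^ n * total x" if x: "x \<ge> x0" for x n
  proof (induction n)
    case (Suc n)
    have "1 \<le> (1 + \<delta>) ^ n" using d by (intro one_le_power) auto
    then have "x \<le> x powr ((1 + \<delta>) ^ n)"
      using x x0 powr_mono[of 1 "(1 + \<delta>) ^ n" x] by simp
    then have "total ((x powr ((1 + \<delta>) ^ n)) powr (1 + \<delta>)) \<le> 2 * total (x powr ((1 + \<delta>) ^ n))"
      using x by (intro step) auto
    then show ?case using Suc by (simp add: powr_powr mult.commute)
  qed (use x x0 in auto)
  obtain n where n: "2 < (1 + \<delta>) ^ n" using real_arch_pow[of "1 + \<delta>" 2] d by auto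
  have "total (x ^ 2) \<le> 2 ^ n * total x" if x: "x \<ge> x0" for x
  proof -
    have "x ^ 2 = x powr 2" using x x0 by (simp add: powr_numeral)
    also have "\<dots> \<le> x powr ((1 + \<delta>) ^ n)" using x x0 n by (intro powr_mono) auto
    finally show ?thesis using iter[OF x, of n] total_mono order_trans by blast
  qed
  then show ?thesis using x0 by (intro exI[of _ "2 ^ n"]) auto
qed

text \<open>For \<open>z = 2\<close> the prime 2 has weight 1 and violates
  \<open>\<rho> < 1\<close>. Setting the weight to 0 there leaves 3 as the worst prime, with
  \<open>\<rho> = 2 / 3\<close>.\<close>

definition odd_weight :: "nat \<Rightarrow> real" where
  "odd_weight n = (if even n then 0 else omega_weight 2 n)"

lemma odd_weight: "bounded_weight odd_weight 2 (2 / 3)"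
proof -
  interpret multiplicative_weight "omega_weight 2" by (intro multiplicative_omega_weight) auto
  show ?thesis
  proof
    fix m n :: nat
    show "odd_weight (m * n) = odd_weight m * odd_weight n"
      by (auto simp: odd_weight_def f_mult)
    show "odd_weight 1 = 1" using f_1 by (simp add: odd_weight_def)
    show "odd_weight n \<ge> 0" by (simp add: odd_weight_def f_nonneg)
    fix p :: nat assume p: "prime p"
    show "odd_weight p \<le> 2 / real p" using p by (simp add: odd_weight_def omega_weight_prime)
    show "odd_weight p \<le> 2 / 3"
    proof (cases "even p")
      case False
      then have "p \<noteq> 2" by auto
      then have "p \<ge> 3" using prime_ge_2_nat[OF p] by simp
      then have "real p \<ge> 3" by simp
      then show ?thesis using p frac_le[of 2 2 3 "real p"] by (simp add: odd_weight_def omega_weight_prime)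
    qed (simp add: odd_weight_def)
  qed simp
qed

lemma smooth_minus_2: "n \<in> smooth (-{2}) \<longleftrightarrow> odd n"
proof
  assume "n \<in> smooth (-{2})"
  then show "odd n" using smooth_prime_dvd[of n "-{2}" 2] by auto
next
  assume n: "odd n"
  then have "n > 0" by (auto intro!: Nat.gr0I)
  then show "n \<in> smooth (-{2})" using n by (intro smoothI) auto
qed

text \<open>The numerator is at most the odd sum up to \<open>N\<close>, the denominator at least
  \<open>ln N / 2\<close> times the odd sum up to \<open>sqrt N\<close>, and
  \<open>total_square_le\<close> makes the two odd sums comparable.\<close>

lemma max_density_2_upper:
  "\<exists>C>0. \<forall>\<^sub>F N in sequentially. max_density 2 N \<le> C * (1 / ln (real N))"
proof -
  let ?f = "omega_weight 2"
  interpret multiplicative_weight ?f by (intro multiplicative_omega_weight) auto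
  interpret o: bounded_weight odd_weight 2 "2 / 3" by (rule odd_weight)
  define R where "R x = {r \<in> smooth (-{2}). real r \<le> x}" for x
  have finR: "finite (R x)" for x
    by (rule finite_subset[OF _ finite_pos_le[of x]]) (auto simp: R_def smooth_def)
  have tot: "o.total x = sum ?f (R x)" for x
  proof -
    have "o.total x = (\<Sum>n\<in>R x. odd_weight n)"
      unfolding o.total_def
      by (intro sum.mono_neutral_right finite_pos_le)
         (auto simp: R_def smooth_minus_2 odd_weight_def intro!: Nat.gr0I)
    also have "\<dots> = sum ?f (R x)"
      by (intro sum.cong) (auto simp: R_def smooth_minus_2 odd_weight_def)
    finally show ?thesis .
  qed
  obtain C x0 where C: "C > 0" "x0 \<ge> 1" "\<And>x. x \<ge> x0 \<Longrightarrow> o.total (x ^ 2) \<le> C * o.total x"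
    using o.total_square_le by blast
  have up: "weight_sum 2 A \<le> o.total (real N)" if A: "A \<subseteq> {1..N}" "primitive_set A" for A N
  proof -
    define G where "G = smooth_part (-{2}) ` A"
    have finA: "finite A" using A(1) finite_subset by blast
    have Apos: "a > 0 \<and> a \<le> N" if "a \<in> A" for a using A(1) that by auto
    have "sum ?f A = (\<Sum>r\<in>G. ?f r * sum ?f {s \<in> smooth {2}. s * r \<in> A})"
      unfolding G_def using finA Apos by (intro sum_split) auto
    also have "\<dots> \<le> (\<Sum>r\<in>G. ?f r * 1)"
    proof (intro sum_mono mult_left_mono)
      fix r assume "r \<in> G"
      then have r: "r > 0" using smooth_part_pos by (auto simp: G_def)
      define D where "D = {s \<in> smooth {2}. s * r \<in> A}"
      have prim: "primitive_set D" unfolding D_def using A(2) r by (rule primitive_fiber)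
      have "s = t" if st: "s \<in> D" "t \<in> D" for s t
      proof -
        obtain i j where ij: "s = 2 ^ i" "t = 2 ^ j" using st by (auto simp: D_def smooth_2_powers)
        have "s dvd t \<or> t dvd s" unfolding ij using le_imp_power_dvd nat_le_linear by blast
        then show ?thesis using prim st unfolding primitive_set_def by metis
      qed
      then consider "D = {}" | s where "s \<in> D" "D = {s}" by blast
      then have "sum ?f D \<le> 1"
      proof cases
        case 2
        then obtain j where "s = 2 ^ j" by (auto simp: D_def smooth_2_powers)
        then show ?thesis unfolding 2(2) by (simp add: omega_weight_2_power)
      qed simp
      then show "sum ?f {s \<in> smooth {2}. s * r \<in> A} \<le> 1" unfolding D_def .
    qed (rule f_nonneg)
    also have "\<dots> \<le> sum ?f (R (real N))"
    proof -
      have "smooth_part (-{2}) a \<le> N" if "a \<in> A" for a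
        using smooth_part_le[of a "-{2}"] Apos[OF that] by linarith
      then have "G \<subseteq> R (real N)" using smooth_part_smooth by (auto simp: G_def R_def)
      then show ?thesis using finR f_nonneg by (simp add: sum_mono2)
    qed
    finally show ?thesis by (simp add: tot weight_sum_eq)
  qed
  \<comment> \<open>Every odd \<open>r \<le> sqrt N\<close> is combined with every power of 2 up to
    \<open>sqrt N\<close>. Each power has weight 1, and there are at least \<open>ln N / 2\<close>
    of them.\<close>
  have low: "ln (real N) / 2 * o.total (sqrt (real N)) \<le> weight_sum 2 {1..N}" if N: "N \<ge> 1" for N
  proof -
    define J where "J = nat \<lfloor>log 2 (sqrt (real N))\<rfloor>"
    have sN: "sqrt (real N) \<ge> 1" using N by simp
    then have lg: "log 2 (sqrt (real N)) \<ge> 0" by simp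
    have "real J \<le> log 2 (sqrt (real N))" using lg by (simp add: J_def)
    then have "2 powr real J \<le> 2 powr (log 2 (sqrt (real N)))" by simp
    then have J: "2 ^ J \<le> sqrt (real N)" using sN N by (simp add: powr_realpow)
    have "ln (real N) / 2 = ln (sqrt (real N))" using N by (simp add: ln_sqrt)
    also have "\<dots> = ln 2 * log 2 (sqrt (real N))" by (simp add: log_def)
    also have "\<dots> \<le> 1 * log 2 (sqrt (real N))" using lg ln_2_less_1 by (intro mult_right_mono) auto
    also have "\<dots> \<le> real J + 1" using lg unfolding J_def by linarith
    finally have lnJ: "ln (real N) / 2 \<le> real J + 1" .
    have "sum ?f ((\<lambda>j. 2 ^ j) ` {..J}) = real J + 1"
      by (subst sum.reindex) (auto simp: inj_on_def omega_weight_2_power)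
    then have "ln (real N) / 2 \<le> sum ?f ((\<lambda>j. 2 ^ j) ` {..J})" using lnJ by simp
    then have "sum ?f (R (sqrt (real N))) * (ln (real N) / 2)
        \<le> sum ?f (R (sqrt (real N))) * sum ?f ((\<lambda>j. 2 ^ j) ` {..J})"
      by (intro mult_left_mono sum_nonneg f_nonneg)
    also have "\<dots> = (\<Sum>r\<in>R (sqrt (real N)). ?f r * sum ?f ((\<lambda>j. 2 ^ j) ` {..J}))"
      by (simp only: sum_distrib_right)
    also have "\<dots> \<le> sum ?f {1..N}"
    proof (rule sum_prod_le[of _ _ "{2}"])
      fix r s :: nat
      assume rs: "r \<in> R (sqrt (real N))" "s \<in> (\<lambda>j. 2 ^ j) ` {..J}"
      then obtain j where j: "s = 2 ^ j" "j \<le> J" by auto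
      have "(2::real) ^ j \<le> 2 ^ J" using j by (intro power_increasing) auto
      also note J
      finally have "real s \<le> sqrt (real N)" using j by simp
      moreover have "real r \<le> sqrt (real N)" using rs by (auto simp: R_def)
      ultimately have "real s * real r \<le> sqrt (real N) * sqrt (real N)" by (intro mult_mono) auto
      then have "real (s * r) \<le> real N" by simp
      then have "s * r \<le> N" using of_nat_le_iff by blast
      moreover have "r > 0" using rs by (auto simp: R_def smooth_def)
      ultimately show "s * r \<in> {1..N}" using j by (simp add: Suc_le_eq)
    qed (use finR in \<open>auto simp: R_def smooth_2_powers\<close>)
    finally show ?thesis by (simp only: tot weight_sum_eq mult.commute)
  qed
  have "max_density 2 N \<le> 2 * C * (1 / ln (real N))" if N: "N \<ge> 2" "real N \<ge> x0 ^ 2" for N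
  proof (rule max_density_le)
    fix A assume A: "A \<subseteq> {1..N}" "primitive_set A"
    have sx: "sqrt (real N) \<ge> x0" using N C(2) by (simp add: real_le_rsqrt)
    have lnN: "ln (real N) > 0" using N by simp
    have "weight_sum 2 A * ln (real N) \<le> o.total (sqrt (real N) ^ 2) * ln (real N)"
      using up[OF A] lnN by (intro mult_right_mono) auto
    also have "\<dots> \<le> C * o.total (sqrt (real N)) * ln (real N)"
      using C(3)[OF sx] lnN by (intro mult_right_mono) auto
    also have "\<dots> = 2 * C * (ln (real N) / 2 * o.total (sqrt (real N)))" by simp
    also have "\<dots> \<le> 2 * C * weight_sum 2 {1..N}" using low[of N] N C(1) by (intro mult_left_mono) auto
    finally show "weight_sum 2 A / weight_sum 2 {1..N} \<le> 2 * C * (1 / ln (real N))"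
      using weight_sum_pos[of 2 N] N lnN by (simp add: field_simps)
  qed
  moreover have "\<forall>\<^sub>F N in sequentially. N \<ge> 2 \<and> real N \<ge> x0 ^ 2"
    by (intro eventually_conj eventually_ge_at_top) real_asymp
  ultimately have "\<forall>\<^sub>F N in sequentially. max_density 2 N \<le> 2 * C * (1 / ln (real N))"
    by (auto elim: eventually_mono)
  then show ?thesis using C(1) by (intro exI[of _ "2 * C"]) auto
qed

lemma max_density_critical: "(\<lambda>N. max_density 2 N) \<in> \<Theta>(\<lambda>N. 1 / ln (real N))"
proof (rule bigthetaI)
  obtain C where C: "\<forall>\<^sub>F N in sequentially. max_density 2 N \<le> C * (1 / ln (real N))"
    using max_density_2_upper by blast
  have "\<forall>\<^sub>F N in sequentially. norm (max_density 2 N) \<le> C * norm (1 / ln (real N))"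
    using C eventually_ge_at_top[of 2]
  proof eventually_elim
    case (elim N)
    then show ?case by (simp add: max_density_nonneg)
  qed
  then show "(\<lambda>N. max_density 2 N) \<in> O(\<lambda>N. 1 / ln (real N))" by (rule bigoI)
  show "(\<lambda>N. max_density 2 N) \<in> \<Omega>(\<lambda>N. 1 / ln (real N))"
  proof (rule landau_omega.bigI[of "1 / 3"])
    show "\<forall>\<^sub>F N in sequentially. 1 / 3 * norm (1 / ln (real N)) \<le> norm (max_density 2 N)"
      using eventually_ge_at_top[of 2]
    proof eventually_elim
      case (elim N)
      then show ?case using max_density_2_lower[of N] by (simp add: max_density_nonneg)
    qed
  qed simp
qed

section \<open>The case \<open>z < 2\<close>\<close>

definition mid_primes :: "real \<Rightarrow> nat \<Rightarrow> nat set" where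
  "mid_primes \<delta> N = {p. prime p \<and> 1 / \<delta> < real p \<and> real p \<le> real N powr (\<delta> ^ 2)}"

text \<open>The Poisson parameter \<open>l\<close> of the prime block.\<close>

definition mid_sum :: "real \<Rightarrow> real \<Rightarrow> nat \<Rightarrow> real" where
  "mid_sum z \<delta> N = (\<Sum>p\<in>mid_primes \<delta> N. z / real p)"

lemma finite_primes_le: "finite {p. prime p \<and> real p \<le> y}"
proof (rule finite_subset)
  show "{p. prime p \<and> real p \<le> y} \<subseteq> {..nat \<lfloor>y\<rfloor>}" by (auto simp: le_nat_floor)
qed auto

lemma finite_mid_primes: "finite (mid_primes \<delta> N)"
  by (rule finite_subset[OF _ finite_primes_le[of "real N powr (\<delta> ^ 2)"]]) (auto simp: mid_primes_def)

text \<open>For fixed \<open>\<delta>\<close> both cut-offs change the sum of \<open>1 / p\<close>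
  by a bounded amount only: the small primes by the constant \<open>c0\<close>, the exponent by
  \<open>ln (\<delta> ^ 2)\<close>.\<close>

lemma mid_sum_asymp:
  assumes "0 < \<delta>" "0 < z"
  shows "(\<lambda>N. mid_sum z \<delta> N / (z * ln (ln (real N)))) \<longlonglongrightarrow> 1"
proof -
  obtain C where C: "\<And>y. y \<ge> 2 \<Longrightarrow> \<bar>(\<Sum>p | prime p \<and> real p \<le> y. 1 / real p) - ln (ln y)\<bar> \<le> C"
    using prime_recip_sum by blast
  define c0 where "c0 = (\<Sum>p | prime p \<and> real p \<le> 1 / \<delta>. 1 / real p)"
  define K where "K = C + \<bar>c0\<bar> + \<bar>ln (\<delta> ^ 2)\<bar>"
  have "\<forall>\<^sub>F N in sequentially. real N powr (\<delta> ^ 2) \<ge> max 2 (1 / \<delta>) \<and> ln (ln (real N)) > 0"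
  proof (intro eventually_conj)
    have "filterlim (\<lambda>N. real N powr (\<delta> ^ 2)) at_top sequentially"
      using assms by real_asymp
    then show "\<forall>\<^sub>F N in sequentially. real N powr (\<delta> ^ 2) \<ge> max 2 (1 / \<delta>)"
      unfolding filterlim_at_top by blast
    show "\<forall>\<^sub>F N in sequentially. ln (ln (real N)) > 0" by real_asymp
  qed
  then have "\<forall>\<^sub>F N in sequentially. norm (mid_sum z \<delta> N / (z * ln (ln (real N))) - 1) \<le> K / ln (ln (real N))"
  proof eventually_elim
    case (elim N)
    define y where "y = real N powr (\<delta> ^ 2)"
    have y: "y \<ge> 2" "y \<ge> 1 / \<delta>" using elim by (auto simp: y_def)
    have "real N > 1"
    proof (rule ccontr)
      assume "\<not> real N > 1"
      then have "real N powr (\<delta> ^ 2) \<le> 1 powr (\<delta> ^ 2)" by (intro powr_mono2) auto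
      then show False using y(1) by (simp add: y_def)
    qed
    then have N: "ln (real N) > 0" by simp
    have "{p. prime p \<and> real p \<le> y} = mid_primes \<delta> N \<union> {p. prime p \<and> real p \<le> 1 / \<delta>}"
      using y by (auto simp: mid_primes_def y_def)
    moreover have "mid_primes \<delta> N \<inter> {p. prime p \<and> real p \<le> 1 / \<delta>} = {}"
      by (auto simp: mid_primes_def)
    ultimately have "(\<Sum>p | prime p \<and> real p \<le> y. 1 / real p) = (\<Sum>p\<in>mid_primes \<delta> N. 1 / real p) + c0"
      unfolding c0_def using finite_mid_primes finite_primes_le by (simp add: sum.union_disjoint)
    moreover have "ln (ln y) = ln (\<delta> ^ 2) + ln (ln (real N))"
    proof -
      have "ln y = \<delta> ^ 2 * ln (real N)" using N by (simp add: y_def ln_powr)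
      then show ?thesis using N assms by (simp add: ln_mult)
    qed
    ultimately have *: "\<bar>(\<Sum>p\<in>mid_primes \<delta> N. 1 / real p) - ln (ln (real N))\<bar> \<le> K"
      using C[OF y(1)] unfolding K_def by linarith
    have "mid_sum z \<delta> N / (z * ln (ln (real N))) - 1 =
      ((\<Sum>p\<in>mid_primes \<delta> N. 1 / real p) - ln (ln (real N))) / ln (ln (real N))"
    proof -
      have "mid_sum z \<delta> N = z * (\<Sum>p\<in>mid_primes \<delta> N. 1 / real p)"
        by (simp add: mid_sum_def sum_distrib_left)
      then show ?thesis using assms elim by (simp add: field_simps)
    qed
    then show ?case using * elim by (simp add: divide_right_mono)
  qed
  moreover have "(\<lambda>N. K / ln (ln (real N))) \<longlonglongrightarrow> 0" by real_asymp
  ultimately have "(\<lambda>N. mid_sum z \<delta> N / (z * ln (ln (real N))) - 1) \<longlonglongrightarrow> 0"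
    by (rule Lim_null_comparison)
  then show ?thesis by (simp add: LIM_zero_iff)
qed

lemma mid_sum_at_top:
  assumes "0 < \<delta>" "0 < z"
  shows "filterlim (mid_sum z \<delta>) at_top sequentially"
proof -
  have "filterlim (\<lambda>N. z * ln (ln (real N))) at_top sequentially"
    using assms by real_asymp
  then have "filterlim (\<lambda>N. mid_sum z \<delta> N / (z * ln (ln (real N))) * (z * ln (ln (real N)))) at_top sequentially"
    by (intro filterlim_tendsto_pos_mult_at_top[OF mid_sum_asymp[OF assms]]) auto
  moreover have "\<forall>\<^sub>F N in sequentially. ln (ln (real N)) > 0" by real_asymp
  then have "\<forall>\<^sub>F N in sequentially. mid_sum z \<delta> N / (z * ln (ln (real N))) * (z * ln (ln (real N))) = mid_sum z \<delta> N"
    by eventually_elim (use assms in auto)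
  ultimately show ?thesis by (subst (asm) filterlim_cong) auto
qed

text \<open>Leaving out the primes up to \<open>1/\<delta>\<close> makes \<open>\<Sum> z\<^sup>2/p\<^sup>2\<close>, and with it every correction to
  the Poisson law, of order \<open>\<delta>\<close>.\<close>

lemma mid_prime_block:
  assumes z: "0 < z" "z < 2"
  shows "\<exists>C>0. \<forall>\<delta> N B. 0 < \<delta> \<longrightarrow> \<delta> \<le> 1 / 4 \<longrightarrow> 1 / \<delta> ^ 2 \<le> ln (real N) \<longrightarrow> mid_sum z \<delta> N > 0 \<longrightarrow>
    (\<forall>k. mid_sum z \<delta> N ^ k / fact k \<le> B) \<longrightarrow>
    prime_block (omega_weight z) (mid_primes \<delta> N) (mid_sum z \<delta> N) (real N powr \<delta>) (exp (16 * \<delta>))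
      (exp (mid_sum z \<delta> N + 16 * \<delta>)) B (C * \<delta>)"
proof -
  let ?f = "omega_weight z"
  interpret bounded_weight ?f z "z / 2" using z by (intro bounded_omega_weight) auto
  obtain C where C: "C > 0" "\<And>y M B P F. y \<ge> 1 \<Longrightarrow> M > 1 \<Longrightarrow> B \<ge> 0 \<Longrightarrow> (\<forall>p\<in>P. prime p \<and> real p \<le> y) \<Longrightarrow>
     finite F \<Longrightarrow> F \<subseteq> smooth P \<Longrightarrow> (\<forall>s\<in>F. M < real s) \<Longrightarrow>
     (\<forall>p\<in>P. \<forall>j\<ge>1. sum ?f {m. m * p ^ j \<in> F} \<le> B) \<Longrightarrow> ln M * sum ?f F \<le> C * (ln y + 1) * B"
    using tail_bound by blast
  have "prime_block ?f (mid_primes \<delta> N) (mid_sum z \<delta> N) (real N powr \<delta>) (exp (16 * \<delta>))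
      (exp (mid_sum z \<delta> N + 16 * \<delta>)) B (2 * C * \<delta>)"
    if d: "0 < \<delta>" "\<delta> \<le> 1 / 4" and lnN: "1 / \<delta> ^ 2 \<le> ln (real N)" and pos: "mid_sum z \<delta> N > 0"
      and B: "\<And>k. mid_sum z \<delta> N ^ k / fact k \<le> B" for \<delta> N B
  proof -
    define P where "P = mid_primes \<delta> N"
    define l where "l = mid_sum z \<delta> N"
    have finP: "finite P" unfolding P_def by (rule finite_mid_primes)
    have lnN0: "ln (real N) > 0"
      using lnN d by (meson less_le_trans zero_less_divide_1_iff zero_less_power)
    then have N1: "real N > 1" by (metis ln_gt_zero_iff not_gr_zero of_nat_0 of_nat_0_less_iff ln_0 less_irrefl)
    have P: "prime p" "?f p = z / real p" "0 \<le> z / real p" "z / real p \<le> 1 / 2" "z / real p \<le> 2 * (1 / real p)" "1 / \<delta> < real p"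
      if p: "p \<in> P" for p
    proof -
      show pr: "prime p" "1 / \<delta> < real p" using p by (auto simp: P_def mid_primes_def)
      show "?f p = z / real p" using pr by (simp add: omega_weight_prime)
      show "0 \<le> z / real p" using z by simp
      \<comment> \<open>Primes of the block exceed 4, so \<open>z / p \<le> 1 / 2\<close>, the range
        in which the quadratic estimates \<open>ineq\<close> hold.\<close>
      have "4 \<le> 1 / \<delta>" using d by (simp add: field_simps)
      then have "real p \<ge> 4" using pr by linarith
      then show "z / real p \<le> 1 / 2" using z by (simp add: divide_le_eq)
      show "z / real p \<le> 2 * (1 / real p)" using z by (simp add: divide_right_mono)
    qed
    \<comment> \<open>The constant is \<open>16 = 2 * 4 * 2\<close>: the factor 2 from
      \<open>ineq\<close>, then \<open>z ^ 2 < 4\<close>, then the sum of \<open>1 / p ^ 2\<close>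
      over \<open>p > 1 / \<delta>\<close>, which is at most \<open>2 * \<delta>\<close>.\<close>
    have sq: "(\<Sum>p\<in>P. 2 * (z / real p) ^ 2) \<le> 16 * \<delta>"
    proof -
      have "(\<Sum>p\<in>P. 2 * (z / real p) ^ 2) \<le> (\<Sum>p\<in>P. 8 * (1 / real p ^ 2))"
      proof (intro sum_mono)
        fix p assume "p \<in> P"
        then have "(z / real p) ^ 2 \<le> (2 * (1 / real p)) ^ 2" using P by (intro power_mono) auto
        then show "2 * (z / real p) ^ 2 \<le> 8 * (1 / real p ^ 2)" by (simp add: power_divide)
      qed
      also have "\<dots> = 8 * (\<Sum>p\<in>P. 1 / real p ^ 2)" by (simp only: sum_distrib_left)
      also have "(\<Sum>p\<in>P. 1 / real p ^ 2) \<le> 2 / (1 / \<delta>)"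
        using finP P(6) d by (intro sum_inverse_squares_le) auto
      finally show ?thesis by simp
    qed
    have ineq: "1 / (1 - u) \<le> exp (u + 2 * u ^ 2)" "1 / (1 - u ^ 2) \<le> exp (2 * u ^ 2)"
      if u: "0 \<le> u" "u \<le> 1 / 2" for u :: real
    proof -
      have "(1 + (u + 2 * u ^ 2)) * (1 - u) - 1 = u ^ 2 * (1 - 2 * u)"
        by (simp add: algebra_simps power2_eq_square)
      moreover have "u ^ 2 * (1 - 2 * u) \<ge> 0" using u by auto
      ultimately have "1 \<le> (1 + (u + 2 * u ^ 2)) * (1 - u)" by linarith
      then have "1 / (1 - u) \<le> 1 + (u + 2 * u ^ 2)" using u by (simp add: divide_le_eq)
      then show "1 / (1 - u) \<le> exp (u + 2 * u ^ 2)"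
        using exp_ge_add_one_self[of "u + 2 * u ^ 2"] by linarith
      have u2: "0 \<le> u ^ 2" "u ^ 2 \<le> 1 / 2"
        using u power_mono[of u "1 / 2" 2] by (auto simp: power2_eq_square)
      have "(1 + 2 * u ^ 2) * (1 - u ^ 2) - 1 = u ^ 2 * (1 - 2 * u ^ 2)"
        by (simp add: algebra_simps)
      moreover have "u ^ 2 * (1 - 2 * u ^ 2) \<ge> 0" using u2 by (intro mult_nonneg_nonneg) auto
      ultimately have "1 \<le> (1 + 2 * u ^ 2) * (1 - u ^ 2)" by linarith
      then have "1 / (1 - u ^ 2) \<le> 1 + 2 * u ^ 2" using u2 by (simp add: divide_le_eq)
      then show "1 / (1 - u ^ 2) \<le> exp (2 * u ^ 2)"
        using exp_ge_add_one_self[of "2 * u ^ 2"] by linarith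
    qed
    have E: "(\<Prod>p\<in>P. 1 / (1 - ?f p ^ 2)) \<le> exp (16 * \<delta>)"
    proof -
      have "(\<Prod>p\<in>P. 1 / (1 - ?f p ^ 2)) \<le> (\<Prod>p\<in>P. exp (2 * (z / real p) ^ 2))"
      proof (intro prod_mono conjI)
        fix p assume p: "p \<in> P"
        have "(z / real p) ^ 2 \<le> 1" using P(3,4)[OF p] by (intro power_le_one) linarith+
        then show "0 \<le> 1 / (1 - ?f p ^ 2)" unfolding P(2)[OF p] by simp
        show "1 / (1 - ?f p ^ 2) \<le> exp (2 * (z / real p) ^ 2)"
          unfolding P(2)[OF p] using P(3,4)[OF p] by (rule ineq)
      qed
      also have "\<dots> = exp (\<Sum>p\<in>P. 2 * (z / real p) ^ 2)" using finP by (simp add: exp_sum)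
      also have "\<dots> \<le> exp (16 * \<delta>)" using sq by simp
      finally show ?thesis .
    qed
    have S: "(\<Prod>p\<in>P. 1 / (1 - ?f p)) \<le> exp (l + 16 * \<delta>)"
    proof -
      have "(\<Prod>p\<in>P. 1 / (1 - ?f p)) \<le> (\<Prod>p\<in>P. exp (z / real p + 2 * (z / real p) ^ 2))"
      proof (intro prod_mono conjI)
        fix p assume p: "p \<in> P"
        show "0 \<le> 1 / (1 - ?f p)" unfolding P(2)[OF p] using P(4)[OF p] by (intro divide_nonneg_nonneg) linarith+
        show "1 / (1 - ?f p) \<le> exp (z / real p + 2 * (z / real p) ^ 2)"
          unfolding P(2)[OF p] using P(3,4)[OF p] by (rule ineq)
      qed
      also have "\<dots> = exp (\<Sum>p\<in>P. z / real p + 2 * (z / real p) ^ 2)" using finP by (simp add: exp_sum)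
      also have "(\<Sum>p\<in>P. z / real p + 2 * (z / real p) ^ 2) \<le> l + 16 * \<delta>"
        unfolding sum.distrib l_def mid_sum_def P_def[symmetric] using sq by simp
      finally show ?thesis by simp
    qed
    show ?thesis unfolding P_def[symmetric] l_def[symmetric]
    proof unfold_locales
      show "finite P" by (rule finP)
      show "prime p \<and> ?f p < 1" if "p \<in> P" for p
        using P(1,2,4)[OF that] by linarith
      show "l = sum ?f P"
        unfolding l_def mid_sum_def P_def[symmetric] using P(2) by (intro sum.cong) auto
      show "0 < l" using pos by (simp add: l_def)
      show "real N powr \<delta> \<ge> 1" using N1 d by (simp add: ge_one_powr_ge_zero)
      show "0 \<le> 2 * C * \<delta>" using C d by simp
      show "l ^ k / fact k \<le> B" for k unfolding l_def by (rule B)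
    next
      fix D F
      assume D: "0 \<le> D" and F: "finite F" "F \<subseteq> smooth P" "\<And>s. s \<in> F \<Longrightarrow> real N powr \<delta> < real s"
        and le: "\<And>p j. p \<in> P \<Longrightarrow> 1 \<le> j \<Longrightarrow> sum ?f {m. m * p ^ j \<in> F} \<le> D"
      \<comment> \<open>The tail estimate has the factor \<open>\<delta> * ln N\<close> on the left
        and \<open>\<delta> ^ 2 * ln N + 1\<close> on the right;
        \<open>1 / \<delta> ^ 2 \<le> ln N\<close> absorbs the 1, and the quotient is at most
        \<open>2 * \<delta>\<close>.\<close>
      have "ln (real N powr \<delta>) * sum ?f F \<le> C * (ln (real N powr (\<delta> ^ 2)) + 1) * D"
      proof (rule C(2))
        show "1 \<le> real N powr (\<delta> ^ 2)" using N1 d by (simp add: ge_one_powr_ge_zero)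
        show "1 < real N powr \<delta>" using N1 d by simp
        show "\<forall>p\<in>P. prime p \<and> real p \<le> real N powr \<delta>\<^sup>2" by (auto simp: P_def mid_primes_def)
      qed (use D F le in auto)
      also have "ln (real N powr (\<delta> ^ 2)) + 1 \<le> 2 * \<delta> ^ 2 * ln (real N)"
        using lnN N1 d by (simp add: ln_powr divide_le_eq mult.commute)
      also have "ln (real N powr \<delta>) = \<delta> * ln (real N)" using N1 by (simp add: ln_powr)
      finally have "\<delta> * ln (real N) * sum ?f F \<le> C * (2 * \<delta> ^ 2 * ln (real N)) * D"
        using C(1) D by (simp add: mult_left_mono mult_right_mono)
      also have "\<dots> = \<delta> * ln (real N) * (2 * C * \<delta> * D)" by (simp add: power2_eq_square)
      finally show "sum ?f F \<le> 2 * C * \<delta> * D"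
        using d lnN0 by (simp only: mult_le_cancel_left_pos mult_pos_pos)
    qed (use E S in auto)
  qed
  then show ?thesis using C(1) by (intro exI[of _ "2 * C"]) auto
qed

text \<open>With \<open>y = N powr (\<delta> ^ 2)\<close> it bounds the number of large prime
  factors of an integer up to \<open>N\<close> by \<open>1 / \<delta> ^ 2\<close>.\<close>

lemma power_Omega_le:
  assumes "r > 0" "y \<ge> 0" "\<And>p. prime p \<Longrightarrow> p dvd r \<Longrightarrow> y \<le> real p"
  shows "y ^ Omega r \<le> real r"
proof -
  have "Omega r = (\<Sum>p\<in>prime_factors r. multiplicity p r)"
    unfolding Omega_def size_multiset_overloaded_eq
    by (intro sum.cong refl) (auto simp: count_prime_factorization)
  then have "y ^ Omega r = (\<Prod>p\<in>prime_factors r. y ^ multiplicity p r)" by (simp add: power_sum)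
  also have "\<dots> \<le> (\<Prod>p\<in>prime_factors r. real p ^ multiplicity p r)"
    using assms by (intro prod_mono conjI power_mono) (auto simp: in_prime_factors_iff)
  also have "\<dots> = real (\<Prod>p\<in>prime_factors r. p ^ multiplicity p r)" by simp
  also have "(\<Prod>p\<in>prime_factors r. p ^ multiplicity p r) = r"
    using prime_factorization_nat[OF assms(1)] by simp
  finally show ?thesis .
qed

lemma weight_sum_total:
  assumes "z \<ge> 0"
  shows "weight_sum z {1..N} = multiplicative_weight.total (omega_weight z) (real N)"
  unfolding weight_sum_eq multiplicative_weight.total_def[OF multiplicative_omega_weight[OF assms]]
  by (intro sum.cong) (auto simp: Suc_le_eq)

text \<open>The function \<open>\<psi>\<close> records the order of limits: for fixed
  \<open>\<delta>\<close> the bound holds for all large \<open>N\<close>, and only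
  \<open>\<psi>\<close> has to tend to 1. Normalizing by \<open>mid_sum\<close> keeps the
  asymptotics of \<open>l\<close> out of the estimate.\<close>

lemma max_density_mid_upper:
  assumes z: "0 < z" "z < 2"
  shows "\<exists>\<psi>. (\<psi> \<longlongrightarrow> 1) (at_right 0) \<and> (\<forall>\<^sub>F \<delta> in at_right 0.
    \<forall>\<^sub>F N in sequentially. max_density z N * sqrt (2 * pi * mid_sum z \<delta> N) \<le> \<psi> \<delta>)"
proof -
  let ?f = "omega_weight z"
  interpret bounded_weight ?f z "z / 2" using z by (intro bounded_omega_weight) auto
  obtain C where C: "C > 0" "\<And>\<delta> N B. 0 < \<delta> \<Longrightarrow> \<delta> \<le> 1 / 4 \<Longrightarrow> 1 / \<delta> ^ 2 \<le> ln (real N) \<Longrightarrow> mid_sum z \<delta> N > 0 \<Longrightarrow>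
    (\<forall>k. mid_sum z \<delta> N ^ k / fact k \<le> B) \<Longrightarrow>
    prime_block ?f (mid_primes \<delta> N) (mid_sum z \<delta> N) (real N powr \<delta>) (exp (16 * \<delta>))
      (exp (mid_sum z \<delta> N + 16 * \<delta>)) B (C * \<delta>)"
    using mid_prime_block[OF z] by blast
  obtain C1 where C1: "C1 > 0" "\<And>x X. 1 \<le> x \<Longrightarrow> x \<le> X \<Longrightarrow> ln x * (total X - total x) \<le> C1 * (ln (X / x) + 1) * total X"
    using slow_variation by blast
  \<comment> \<open>The numerator comes from the square factors and the Poisson peak. In the
    denominator stand the loss from truncating \<open>s\<close> and the passage from
    \<open>total\<close> at \<open>N powr (1 + \<delta>)\<close> back to \<open>N\<close>.\<close>
  define \<psi> where "\<psi> \<delta> = exp (16 * \<delta>) * (1 + \<delta>) / ((1 - C * \<delta> * exp (16 * \<delta>)) * (1 - 2 * C1 * \<delta>))" for \<delta> :: real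
  have "\<forall>\<^sub>F N in sequentially. max_density z N * sqrt (2 * pi * mid_sum z \<delta> N) \<le> \<psi> \<delta>"
    if d: "0 < \<delta>" "\<delta> < 1 / 4" and c: "0 < 1 - C * \<delta> * exp (16 * \<delta>)" and e: "0 < 1 - 2 * C1 * \<delta>" for \<delta>
  proof -
    have "\<forall>\<^sub>F N in sequentially. \<forall>k. mid_sum z \<delta> N ^ k / fact k \<le>
        (1 + \<delta>) * (exp (mid_sum z \<delta> N) / sqrt (2 * pi * mid_sum z \<delta> N))"
      using poisson_upper[OF d(1)] mid_sum_at_top[OF d(1) z(1)] by (rule eventually_compose_filterlim)
    moreover have "\<forall>\<^sub>F N in sequentially. mid_sum z \<delta> N > 0"
      using mid_sum_at_top[OF d(1) z(1)] by (simp add: filterlim_at_top_dense)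
    moreover have "\<forall>\<^sub>F N in sequentially. 1 / \<delta> ^ 2 \<le> ln (real N)" by real_asymp
    moreover have "\<forall>\<^sub>F N in sequentially. N \<ge> 2" by (rule eventually_ge_at_top)
    ultimately show ?thesis
    proof eventually_elim
      case (elim N)
      define l where "l = mid_sum z \<delta> N"
      define q where "q = sqrt (2 * pi * l)"
      have l: "l > 0" "q > 0" using elim by (auto simp: l_def q_def)
      define B where "B = (1 + \<delta>) * (exp l / q)"
      interpret b: prime_block ?f "mid_primes \<delta> N" l "real N powr \<delta>" "exp (16 * \<delta>)"
        "exp (l + 16 * \<delta>)" B "C * \<delta>"
        unfolding l_def B_def q_def using elim d by (intro C(2)) auto
      have N: "real N > 1" using elim by simp
      have lnN: "1 \<le> \<delta> * ln (real N)"
      proof -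
        have "1 \<le> \<delta> ^ 2 * ln (real N)" using elim(3) d by (simp add: divide_le_eq mult.commute)
        also have "\<dots> \<le> \<delta> * ln (real N)"
          using d N by (intro mult_right_mono) (auto simp: power2_eq_square mult_left_le)
        finally show ?thesis .
      qed
      define X where "X = real N * real N powr \<delta>"
      have X: "total X * (1 - 2 * C1 * \<delta>) \<le> total (real N)"
      proof -
        have "real N * 1 \<le> X" unfolding X_def
          using N d by (intro mult_left_mono) (auto simp: ge_one_powr_ge_zero)
        then have *: "ln (real N) * (total X - total (real N)) \<le> C1 * (ln (X / real N) + 1) * total X"
          using N by (intro C1(2)) auto
        have "ln (X / real N) = \<delta> * ln (real N)" using N by (simp add: X_def ln_powr)
        then have "ln (X / real N) + 1 \<le> 2 * \<delta> * ln (real N)" using lnN by simp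
        then have "C1 * (ln (X / real N) + 1) * total X \<le> C1 * (2 * \<delta> * ln (real N)) * total X"
          using C1(1) \<open>real N * 1 \<le> X\<close> N total_ge_1[of X]
          by (intro mult_right_mono mult_left_mono) auto
        with * have "ln (real N) * (total X - total (real N)) \<le> ln (real N) * (2 * C1 * \<delta> * total X)"
          by (simp add: mult_ac)
        moreover have "ln (real N) > 0" using N by simp
        ultimately have "total X - total (real N) \<le> 2 * C1 * \<delta> * total X"
          by (simp only: mult_le_cancel_left_pos)
        then show ?thesis by (simp add: algebra_simps)
      qed
      have tN: "total (real N) > 0" using total_ge_1[of "real N"] N by simp
      have "max_density z N \<le> \<psi> \<delta> / q"
      proof (rule max_density_le)
        fix A assume A: "A \<subseteq> {1..N}" "primitive_set A"
        define a where "a = sum ?f A"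
        have eq: "exp l - C * \<delta> * exp (l + 16 * \<delta>) = exp l * (1 - C * \<delta> * exp (16 * \<delta>))"
          by (simp add: exp_add algebra_simps)
        have "a * (exp l - C * \<delta> * exp (l + 16 * \<delta>)) \<le> exp (16 * \<delta>) * B * total X"
          unfolding a_def X_def
        proof (rule b.primitive_upper[OF _ A(2)])
          show "A \<subseteq> {n. 0 < n \<and> real n \<le> real N}" using A(1) by (auto simp: Suc_le_eq)
          have "0 \<le> exp l * (1 - C * \<delta> * exp (16 * \<delta>))" using c by simp
          then show "C * \<delta> * exp (l + 16 * \<delta>) \<le> exp l" unfolding eq [symmetric] by simp
        qed
        then have "exp l * (a * (1 - C * \<delta> * exp (16 * \<delta>))) \<le> exp l * (exp (16 * \<delta>) * (1 + \<delta>) / q * total X)"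
          unfolding eq B_def by (simp add: mult_ac)
        then have "a * (1 - C * \<delta> * exp (16 * \<delta>)) \<le> exp (16 * \<delta>) * (1 + \<delta>) / q * total X"
          by (simp only: mult_le_cancel_left_pos exp_gt_zero)
        then have "a * (1 - C * \<delta> * exp (16 * \<delta>)) * (1 - 2 * C1 * \<delta>) \<le>
            exp (16 * \<delta>) * (1 + \<delta>) / q * total X * (1 - 2 * C1 * \<delta>)"
          using e by (intro mult_right_mono) auto
        also have "\<dots> = exp (16 * \<delta>) * (1 + \<delta>) / q * (total X * (1 - 2 * C1 * \<delta>))" by simp
        also have "\<dots> \<le> exp (16 * \<delta>) * (1 + \<delta>) / q * total (real N)"
          using X d l by (intro mult_left_mono) auto
        finally have main: "a * ((1 - C * \<delta> * exp (16 * \<delta>)) * (1 - 2 * C1 * \<delta>)) \<le>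
           exp (16 * \<delta>) * (1 + \<delta>) / q * total (real N)" by (simp add: mult.assoc)
        have aux: "a / t \<le> u / v / q" if "a * v \<le> u / q * t" "t > 0" "v > 0" for t u v :: real
          using that l(2) by (simp add: field_simps)
        show "weight_sum z A / weight_sum z {1..N} \<le> \<psi> \<delta> / q"
          unfolding weight_sum_total[OF less_imp_le[OF z(1)]] weight_sum_eq[of z A] a_def[symmetric] \<psi>_def
          using main tN c e by (intro aux) auto
      qed
      then show ?case using l(2) by (simp add: q_def[symmetric] l_def[symmetric] le_divide_eq)
    qed
  qed
  moreover have "\<forall>\<^sub>F \<delta> in at_right 0. 0 < \<delta> \<and> \<delta> < 1 / 4 \<and> 0 < 1 - C * \<delta> * exp (16 * \<delta>) \<and> 0 < 1 - 2 * C1 * \<delta>"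
  proof (intro eventually_conj)
    show "\<forall>\<^sub>F \<delta> in at_right 0. (0::real) < \<delta>" by (rule eventually_at_right_less)
    show "\<forall>\<^sub>F \<delta> in at_right 0. \<delta> < (1 / 4 :: real)" by real_asymp
    show "\<forall>\<^sub>F \<delta> in at_right 0. 0 < 1 - C * \<delta> * exp (16 * \<delta>)" by real_asymp
    show "\<forall>\<^sub>F \<delta> in at_right 0. 0 < 1 - 2 * C1 * \<delta>" by real_asymp
  qed
  ultimately have "\<forall>\<^sub>F \<delta> in at_right 0. \<forall>\<^sub>F N in sequentially. max_density z N * sqrt (2 * pi * mid_sum z \<delta> N) \<le> \<psi> \<delta>"
    by (auto elim!: eventually_mono)
  moreover have "(\<psi> \<longlongrightarrow> 1) (at_right 0)" unfolding \<psi>_def by real_asymp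
  ultimately show ?thesis by blast
qed

text \<open>The primitive set is the level \<open>Omega n = \<lfloor>l\<rfloor>\<close>. Its weight
  is recovered from the rough numbers with boundedly many prime factors, which carry almost the
  whole rough sum.\<close>

lemma max_density_mid_lower:
  assumes z: "0 < z" "z < 2"
  shows "\<exists>\<psi>. (\<psi> \<longlongrightarrow> 1) (at_right 0) \<and> (\<forall>\<^sub>F \<delta> in at_right 0.
    \<forall>\<^sub>F N in sequentially. max_density z N * sqrt (2 * pi * mid_sum z \<delta> N) \<ge> \<psi> \<delta>)"
proof -
  let ?f = "omega_weight z"
  interpret bounded_weight ?f z "z / 2" using z by (intro bounded_omega_weight) auto
  obtain C where C: "C > 0" "\<And>\<delta> N B. 0 < \<delta> \<Longrightarrow> \<delta> \<le> 1 / 4 \<Longrightarrow> 1 / \<delta> ^ 2 \<le> ln (real N) \<Longrightarrow> mid_sum z \<delta> N > 0 \<Longrightarrow>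
    (\<forall>k. mid_sum z \<delta> N ^ k / fact k \<le> B) \<Longrightarrow>
    prime_block ?f (mid_primes \<delta> N) (mid_sum z \<delta> N) (real N powr \<delta>) (exp (16 * \<delta>))
      (exp (mid_sum z \<delta> N + 16 * \<delta>)) B (C * \<delta>)"
    using mid_prime_block[OF z] by blast
  obtain C1 where C1: "C1 > 0" "\<And>x X. 1 \<le> x \<Longrightarrow> x \<le> X \<Longrightarrow> ln x * (total X - total x) \<le> C1 * (ln (X / x) + 1) * total X"
    using slow_variation by blast
  \<comment> \<open>Here \<open>1 - \<delta>\<close> is the Poisson lower bound and the rest is the
    tail loss \<open>\<tau> * (E * B)\<close>, both measured in units of
    \<open>exp l / sqrt (2 * pi * l)\<close>.\<close>
  define g where "g \<delta> = 1 - \<delta> - C * \<delta> * exp (16 * \<delta>) * (1 + \<delta>)" for \<delta>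
  \<comment> \<open>The other factors come from discarding \<open>r\<close> with large
    \<open>Omega\<close>, from replacing \<open>N\<close> by \<open>N powr (1 - \<delta>)\<close>,
    and from the Euler bound \<open>S\<close>, which exceeds \<open>exp l\<close> by
    \<open>exp (16 * \<delta>)\<close>.\<close>
  define \<psi> where "\<psi> \<delta> = (1 - \<delta>) * (1 - 4 * C1 * \<delta>) * g \<delta> / exp (16 * \<delta>)" for \<delta> :: real
  have "\<forall>\<^sub>F N in sequentially. \<psi> \<delta> \<le> max_density z N * sqrt (2 * pi * mid_sum z \<delta> N)"
    if d: "0 < \<delta>" "\<delta> < 1 / 4" and g: "0 < g \<delta>" and e: "0 < 1 - 4 * C1 * \<delta>" for \<delta>
  proof -
    define T where "T = {p. prime p \<and> real p \<le> 1 / \<delta>}"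
    have "prime p \<and> ?f p < 1" if "p \<in> T" for p
      using f_prime_le_rho[of p] z that by (auto simp: T_def)
    moreover have "finite T" unfolding T_def by (rule finite_primes_le)
    ultimately obtain K2 where K2: "\<And>F. finite F \<Longrightarrow> F \<subseteq> {t \<in> smooth T. K2 < Omega t} \<Longrightarrow> sum ?f F \<le> \<delta>"
      using large_Omega_small[of T \<delta>] d by blast
    define K1 where "K1 = nat \<lceil>1 / \<delta> ^ 2\<rceil>"
    define K where "K = K1 + K2"
    have "\<forall>\<^sub>F N in sequentially. \<forall>k. mid_sum z \<delta> N ^ k / fact k \<le>
        (1 + \<delta>) * (exp (mid_sum z \<delta> N) / sqrt (2 * pi * mid_sum z \<delta> N))"
      using poisson_upper[OF d(1)] mid_sum_at_top[OF d(1) z(1)] by (rule eventually_compose_filterlim)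
    \<comment> \<open>The extra 1 accounts for the distance between \<open>l\<close> and the level
      \<open>\<lfloor>l\<rfloor>\<close>; the levels of the cofactors go down from there by at most
      \<open>K\<close>.\<close>
    moreover have "\<forall>\<^sub>F N in sequentially. \<forall>k. \<bar>real k - mid_sum z \<delta> N\<bar> \<le> real K + 1 \<longrightarrow>
       (1 - \<delta>) * (exp (mid_sum z \<delta> N) / sqrt (2 * pi * mid_sum z \<delta> N)) \<le> mid_sum z \<delta> N ^ k / fact k"
      using poisson_lower[OF d(1)] mid_sum_at_top[OF d(1) z(1)] d
      by (intro eventually_compose_filterlim[OF poisson_lower[OF d(1), of "real K + 1"]]) auto
    moreover have "\<forall>\<^sub>F N in sequentially. mid_sum z \<delta> N > real K + 1"
      using mid_sum_at_top[OF d(1) z(1)] by (simp add: filterlim_at_top_dense)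
    moreover have "\<forall>\<^sub>F N in sequentially. 1 / \<delta> ^ 2 \<le> ln (real N)" by real_asymp
    moreover have "\<forall>\<^sub>F N in sequentially. N \<ge> 2" by (rule eventually_ge_at_top)
    ultimately show ?thesis
    proof eventually_elim
      case (elim N)
      define l where "l = mid_sum z \<delta> N"
      define q where "q = sqrt (2 * pi * l)"
      have lK: "l > real K + 1" using elim by (simp add: l_def)
      then have l: "l > 0" "q > 0" by (auto simp: q_def)
      define B where "B = (1 + \<delta>) * (exp l / q)"
      define P where "P = mid_primes \<delta> N"
      define M where "M = real N powr \<delta>"
      interpret b: prime_block ?f P l M "exp (16 * \<delta>)" "exp (l + 16 * \<delta>)" B "C * \<delta>"
        unfolding l_def B_def q_def P_def M_def using elim d l(1) by (intro C(2)) (auto simp: l_def)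
      have N: "real N > 1" using elim by simp
      have M0: "M > 0" using N by (simp add: M_def)
      have lnN: "1 \<le> \<delta> ^ 2 * ln (real N)"
        using elim(4) d by (simp add: divide_le_eq mult.commute)
      also have "\<dots> \<le> \<delta> * ln (real N)"
        using d N by (intro mult_right_mono) (auto simp: power2_eq_square mult_left_le)
      finally have lnN': "1 \<le> \<delta> * ln (real N)" .
      define Y where "Y = real N / M"
      have Y: "Y = real N powr (1 - \<delta>)" using N by (simp add: Y_def M_def powr_diff)
      have tN: "total (real N) > 0" using total_ge_1[of "real N"] N by simp
      have tot: "(1 - 4 * C1 * \<delta>) * total (real N) \<le> total Y"
      proof -
        have Y1: "1 \<le> Y" "Y \<le> real N"
          unfolding Y using N d powr_mono[of "1 - \<delta>" 1 "real N"] by (auto simp: ge_one_powr_ge_zero)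
        then have *: "ln Y * (total (real N) - total Y) \<le> C1 * (ln (real N / Y) + 1) * total (real N)"
          by (intro C1(2))
        have "real N / Y = M" using N M0 by (simp add: Y_def)
        then have "ln (real N / Y) = \<delta> * ln (real N)" using N by (simp add: M_def ln_powr)
        then have "ln (real N / Y) + 1 \<le> 2 * \<delta> * ln (real N)" using lnN' by simp
        then have "C1 * (ln (real N / Y) + 1) * total (real N) \<le> C1 * (2 * \<delta> * ln (real N)) * total (real N)"
          using C1(1) tN by (intro mult_right_mono mult_left_mono) auto
        \<comment> \<open>Slow variation is now applied at \<open>Y\<close>, and
          \<open>1 - \<delta> \<ge> 1 / 2\<close> returns to \<open>ln N\<close> at the cost of a
          factor 2; this explains \<open>4 * C1\<close>.\<close>
        moreover have "1 / 2 * ln (real N) \<le> ln Y"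
          unfolding Y using N d by (simp add: ln_powr)
        then have "1 / 2 * ln (real N) * (total (real N) - total Y) \<le> ln Y * (total (real N) - total Y)"
          using total_mono[OF Y1(2)] by (intro mult_right_mono) auto
        ultimately have "1 / 2 * ln (real N) * (total (real N) - total Y) \<le> C1 * (2 * \<delta> * ln (real N)) * total (real N)"
          using * by linarith
        then have "ln (real N) * (total (real N) - total Y) \<le> ln (real N) * (4 * C1 * \<delta> * total (real N))"
          by (simp add: mult_ac)
        moreover have "ln (real N) > 0" using N by simp
        ultimately have "total (real N) - total Y \<le> 4 * C1 * \<delta> * total (real N)"
          by (simp only: mult_le_cancel_left_pos)
        then show ?thesis by (simp add: algebra_simps)
      qed
      define R where "R = sum ?f {r \<in> smooth (-P). real r \<le> Y}"
      define RK where "RK = sum ?f {r \<in> smooth (-P). real r * M \<le> real N \<and> Omega r \<le> K}"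
      have finR: "finite {r \<in> smooth (-P). real r \<le> Y}"
        by (rule finite_subset[OF _ finite_pos_le[of Y]]) (auto simp: smooth_def)
      have RK: "(1 - \<delta>) * R \<le> RK"
      proof -
        have "sum ?f {r \<in> smooth (-P). real r \<le> Y \<and> K < Omega r} \<le> \<delta> * R"
          unfolding K_def R_def
        proof (rule large_Omega_rough)
          show "T \<inter> P = {}" by (auto simp: T_def P_def mid_primes_def)
          fix r assume r: "r \<in> smooth (- (P \<union> T))" "real r \<le> Y"
          \<comment> \<open>All primes up to \<open>y\<close> lie in \<open>P\<close> or
            \<open>T\<close>, so a prime factor of \<open>r\<close> exceeds
            \<open>y\<close>.\<close>
          define y where "y = real N powr (\<delta> ^ 2)"
          have "y ^ Omega r \<le> real r"
          proof (rule power_Omega_le)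
            show "r > 0" using r smooth_pos by blast
            fix p assume p: "prime p" "p dvd r"
            then have "p \<notin> P" "p \<notin> T" using smooth_prime_dvd[OF r(1)] by blast+
            then show "y \<le> real p" using p by (auto simp: P_def T_def mid_primes_def y_def)
          qed (simp add: y_def)
          also have "\<dots> \<le> real N"
            using r(2) powr_mono[of "1 - \<delta>" 1 "real N"] d N unfolding Y by simp
          finally have "real N powr (\<delta> ^ 2 * real (Omega r)) \<le> real N powr 1"
            using N by (simp add: y_def powr_powr powr_realpow [symmetric])
          then have "\<delta> ^ 2 * real (Omega r) \<le> 1" using N by (simp only: powr_le_cancel_iff)
          then have "real (Omega r) \<le> 1 / \<delta> ^ 2" using d by (simp add: le_divide_eq mult.commute)
          then show "Omega r \<le> K1" unfolding K1_def by linarith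
        qed (rule K2)
        moreover have "R = RK + sum ?f {r \<in> smooth (-P). real r \<le> Y \<and> K < Omega r}"
        proof -
          have "{r \<in> smooth (-P). real r * M \<le> real N \<and> Omega r \<le> K} = {r \<in> smooth (-P). real r \<le> Y \<and> Omega r \<le> K}"
            using M0 by (auto simp: Y_def le_divide_eq)
          then have "RK = sum ?f {r \<in> smooth (-P). real r \<le> Y \<and> Omega r \<le> K}"
            unfolding RK_def by simp
          moreover have "R = sum ?f ({r \<in> smooth (-P). real r \<le> Y \<and> Omega r \<le> K} \<union> {r \<in> smooth (-P). real r \<le> Y \<and> K < Omega r})"
            unfolding R_def by (intro sum.cong) auto
          moreover have "\<dots> = sum ?f {r \<in> smooth (-P). real r \<le> Y \<and> Omega r \<le> K} + sum ?f {r \<in> smooth (-P). real r \<le> Y \<and> K < Omega r}"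
            by (intro sum.union_disjoint) (auto intro: finite_subset[OF _ finR])
          ultimately show ?thesis by simp
        qed
        ultimately show ?thesis by (simp add: algebra_simps)
      qed
      define k where "k = nat \<lfloor>l\<rfloor>"
      have kl: "real k \<le> l" "l < real k + 1" using l by (auto simp: k_def)
      define A where "A = {n. 0 < n \<and> real n \<le> real N \<and> Omega n = k}"
      have "RK * ((1 - \<delta>) * (exp l / q) - C * \<delta> * (exp (16 * \<delta>) * B)) \<le> sum ?f A"
        unfolding RK_def A_def
      proof (rule b.level_lower)
        show "K \<le> k" using lK kl by linarith
        fix j assume "j \<le> k" "k \<le> j + K"
        then have "\<bar>real j - l\<bar> \<le> real K + 1" using kl by linarith
        then show "(1 - \<delta>) * (exp l / q) \<le> l ^ j / fact j" using elim(2) by (simp add: l_def q_def)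
      qed
      moreover have "(1 - \<delta>) * (exp l / q) - C * \<delta> * (exp (16 * \<delta>) * B) = exp l / q * g \<delta>"
        by (simp add: B_def g_def algebra_simps add_divide_distrib diff_divide_distrib)
      ultimately have "RK * (exp l / q * g \<delta>) \<le> sum ?f A" by simp
      moreover have "(1 - \<delta>) * R * (exp l / q * g \<delta>) \<le> RK * (exp l / q * g \<delta>)"
        using RK l g by (intro mult_right_mono) auto
      moreover have "(1 - \<delta>) * ((1 - 4 * C1 * \<delta>) * total (real N) / exp (l + 16 * \<delta>)) * (exp l / q * g \<delta>)
          \<le> (1 - \<delta>) * R * (exp l / q * g \<delta>)"
      proof (intro mult_right_mono mult_left_mono)
        have "(1 - 4 * C1 * \<delta>) * total (real N) \<le> exp (l + 16 * \<delta>) * R"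
          using tot b.total_le_rough[of Y] unfolding R_def by linarith
        then show "(1 - 4 * C1 * \<delta>) * total (real N) / exp (l + 16 * \<delta>) \<le> R"
          by (simp add: divide_le_eq mult.commute)
      qed (use d l g in auto)
      moreover have "(1 - \<delta>) * ((1 - 4 * C1 * \<delta>) * total (real N) / exp (l + 16 * \<delta>)) * (exp l / q * g \<delta>)
         = \<psi> \<delta> / q * total (real N)"
        by (simp add: \<psi>_def exp_add)
      ultimately have "\<psi> \<delta> / q * total (real N) \<le> sum ?f A" by linarith
      then have "\<psi> \<delta> / q \<le> weight_sum z A / weight_sum z {1..N}"
        unfolding weight_sum_total[OF less_imp_le[OF z(1)]] weight_sum_eq[of z A]
        using tN by (simp add: le_divide_eq)
      also have "\<dots> \<le> max_density z N"
      proof (rule max_density_ge)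
        show "A \<subseteq> {1..N}" by (auto simp: A_def)
        show "primitive_set A" by (rule primitive_level[of _ k]) (auto simp: A_def)
      qed
      finally show ?case using l(2) by (simp add: q_def[symmetric] l_def[symmetric] divide_le_eq)
    qed
  qed
  moreover have "\<forall>\<^sub>F \<delta> in at_right 0. 0 < \<delta> \<and> \<delta> < 1 / 4 \<and> 0 < g \<delta> \<and> 0 < 1 - 4 * C1 * \<delta>"
  proof (intro eventually_conj)
    show "\<forall>\<^sub>F \<delta> in at_right 0. (0::real) < \<delta>" by (rule eventually_at_right_less)
    show "\<forall>\<^sub>F \<delta> in at_right 0. \<delta> < (1 / 4 :: real)" by real_asymp
    show "\<forall>\<^sub>F \<delta> in at_right 0. 0 < g \<delta>" unfolding g_def by real_asymp
    show "\<forall>\<^sub>F \<delta> in at_right 0. 0 < 1 - 4 * C1 * \<delta>" by real_asymp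
  qed
  ultimately have "\<forall>\<^sub>F \<delta> in at_right 0. \<forall>\<^sub>F N in sequentially. \<psi> \<delta> \<le> max_density z N * sqrt (2 * pi * mid_sum z \<delta> N)"
    by (auto elim!: eventually_mono)
  moreover have "(\<psi> \<longlongrightarrow> 1) (at_right 0)" unfolding \<psi>_def g_def by real_asymp
  ultimately show ?thesis by blast
qed

text \<open>Given \<open>a\<close> on one side of 1, a single \<open>\<delta>\<close> with
  \<open>\<psi> \<delta>\<close> on the same side as 1 relative to \<open>a\<close> suffices; for
  this fixed \<open>\<delta>\<close> the change of normalization has limit 1.\<close>

lemma max_density_subcritical:
  assumes z: "0 < z" "z < 2"
  shows "max_density z \<sim>[at_top] (\<lambda>N. (2 * pi * z * ln (ln (real N))) powr (-1/2))"
proof (rule asymp_equivI')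
  define D where "D N = max_density z N * sqrt (2 * pi * z * ln (ln (real N)))" for N
  have ll: "\<forall>\<^sub>F N in sequentially. ln (ln (real N)) > 0" by real_asymp
  have ratio: "(\<lambda>N. sqrt (2 * pi * z * ln (ln (real N))) / sqrt (2 * pi * mid_sum z \<delta> N)) \<longlonglongrightarrow> 1"
    if "\<delta> > 0" for \<delta>
  proof -
    have "(\<lambda>N. sqrt (inverse (mid_sum z \<delta> N / (z * ln (ln (real N)))))) \<longlonglongrightarrow> sqrt (inverse 1)"
      by (intro tendsto_real_sqrt tendsto_inverse mid_sum_asymp that z) auto
    then have lim: "(\<lambda>N. sqrt (inverse (mid_sum z \<delta> N / (z * ln (ln (real N)))))) \<longlonglongrightarrow> 1" by simp
    have "\<forall>\<^sub>F N in sequentially. mid_sum z \<delta> N > 0"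
      using mid_sum_at_top[OF that z(1)] by (simp add: filterlim_at_top_dense)
    then have "\<forall>\<^sub>F N in sequentially. sqrt (inverse (mid_sum z \<delta> N / (z * ln (ln (real N))))) =
        sqrt (2 * pi * z * ln (ln (real N))) / sqrt (2 * pi * mid_sum z \<delta> N)"
    proof eventually_elim
      case (elim N)
      have "2 * pi * z * x / (2 * pi * m) = inverse (m / (z * x))" for x m :: real by simp
      then show ?case by (simp only: real_sqrt_divide [symmetric])
    qed
    with lim show ?thesis by (rule Lim_transform_eventually)
  qed
  \<comment> \<open>Rewrites the wanted normalization as the one by \<open>mid_sum\<close> times the
    factor of \<open>ratio\<close>. Its nonnegativity is recorded so that bounds by
    \<open>\<psi> \<delta>\<close> can be multiplied by it.\<close>
  have split: "\<forall>\<^sub>F N in sequentially. D N = max_density z N * sqrt (2 * pi * mid_sum z \<delta> N) *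
      (sqrt (2 * pi * z * ln (ln (real N))) / sqrt (2 * pi * mid_sum z \<delta> N)) \<and>
      0 \<le> sqrt (2 * pi * z * ln (ln (real N))) / sqrt (2 * pi * mid_sum z \<delta> N)"
    if "\<delta> > 0" for \<delta>
  proof -
    have "\<forall>\<^sub>F N in sequentially. mid_sum z \<delta> N > 0"
      using mid_sum_at_top[OF that z(1)] by (simp add: filterlim_at_top_dense)
    then show ?thesis using ll by eventually_elim (use z in \<open>auto simp: D_def\<close>)
  qed
  have pos: "\<forall>\<^sub>F \<delta> in at_right (0::real). \<delta> > 0" by (rule eventually_at_right_less)
  have "D \<longlonglongrightarrow> 1"
  proof (rule order_tendstoI)
    fix a :: real assume a: "a < 1"
    obtain \<psi> where psi: "(\<psi> \<longlongrightarrow> 1) (at_right 0)" "\<forall>\<^sub>F \<delta> in at_right 0.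
      \<forall>\<^sub>F N in sequentially. max_density z N * sqrt (2 * pi * mid_sum z \<delta> N) \<ge> \<psi> \<delta>"
      using max_density_mid_lower[OF z] by blast
    have "\<forall>\<^sub>F \<delta> in at_right 0. a < \<psi> \<delta>" using psi(1) a by (rule order_tendstoD)
    with psi(2) pos have "\<forall>\<^sub>F \<delta> in at_right 0. a < \<psi> \<delta> \<and> \<delta> > 0 \<and>
        (\<forall>\<^sub>F N in sequentially. max_density z N * sqrt (2 * pi * mid_sum z \<delta> N) \<ge> \<psi> \<delta>)"
      by eventually_elim auto
    from eventually_happens'[OF trivial_limit_at_right_real this] obtain \<delta> where d: "a < \<psi> \<delta>" "\<delta> > 0"
        "\<forall>\<^sub>F N in sequentially. max_density z N * sqrt (2 * pi * mid_sum z \<delta> N) \<ge> \<psi> \<delta>"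
      by blast
    have "(\<lambda>N. \<psi> \<delta> * (sqrt (2 * pi * z * ln (ln (real N))) / sqrt (2 * pi * mid_sum z \<delta> N))) \<longlonglongrightarrow> \<psi> \<delta> * 1"
      by (rule tendsto_mult[OF tendsto_const ratio[OF d(2)]])
    then have "\<forall>\<^sub>F N in sequentially. a < \<psi> \<delta> * (sqrt (2 * pi * z * ln (ln (real N))) / sqrt (2 * pi * mid_sum z \<delta> N))"
      using d by (intro order_tendstoD(1)) auto
    with d(3) split[OF d(2)] show "\<forall>\<^sub>F N in sequentially. a < D N"
    proof eventually_elim
      case (elim N)
      have "\<psi> \<delta> * (sqrt (2 * pi * z * ln (ln (real N))) / sqrt (2 * pi * mid_sum z \<delta> N)) \<le>
          max_density z N * sqrt (2 * pi * mid_sum z \<delta> N) * (sqrt (2 * pi * z * ln (ln (real N))) / sqrt (2 * pi * mid_sum z \<delta> N))"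
        using elim(1) conjunct2[OF elim(2)] by (rule mult_right_mono)
      then show ?case using conjunct1[OF elim(2)] elim(3) by linarith
    qed
  next
    fix a :: real assume a: "1 < a"
    obtain \<psi> where psi: "(\<psi> \<longlongrightarrow> 1) (at_right 0)" "\<forall>\<^sub>F \<delta> in at_right 0.
      \<forall>\<^sub>F N in sequentially. max_density z N * sqrt (2 * pi * mid_sum z \<delta> N) \<le> \<psi> \<delta>"
      using max_density_mid_upper[OF z] by blast
    have "\<forall>\<^sub>F \<delta> in at_right 0. \<psi> \<delta> < a" using psi(1) a by (rule order_tendstoD)
    with psi(2) pos have "\<forall>\<^sub>F \<delta> in at_right 0. \<psi> \<delta> < a \<and> \<delta> > 0 \<and>
        (\<forall>\<^sub>F N in sequentially. max_density z N * sqrt (2 * pi * mid_sum z \<delta> N) \<le> \<psi> \<delta>)"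
      by eventually_elim auto
    from eventually_happens'[OF trivial_limit_at_right_real this] obtain \<delta> where d: "\<psi> \<delta> < a" "\<delta> > 0"
        "\<forall>\<^sub>F N in sequentially. max_density z N * sqrt (2 * pi * mid_sum z \<delta> N) \<le> \<psi> \<delta>"
      by blast
    have "(\<lambda>N. \<psi> \<delta> * (sqrt (2 * pi * z * ln (ln (real N))) / sqrt (2 * pi * mid_sum z \<delta> N))) \<longlonglongrightarrow> \<psi> \<delta> * 1"
      by (rule tendsto_mult[OF tendsto_const ratio[OF d(2)]])
    then have "\<forall>\<^sub>F N in sequentially. \<psi> \<delta> * (sqrt (2 * pi * z * ln (ln (real N))) / sqrt (2 * pi * mid_sum z \<delta> N)) < a"
      using d by (intro order_tendstoD(2)) auto
    with d(3) split[OF d(2)] show "\<forall>\<^sub>F N in sequentially. D N < a"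
    proof eventually_elim
      case (elim N)
      have "max_density z N * sqrt (2 * pi * mid_sum z \<delta> N) * (sqrt (2 * pi * z * ln (ln (real N))) / sqrt (2 * pi * mid_sum z \<delta> N)) \<le>
          \<psi> \<delta> * (sqrt (2 * pi * z * ln (ln (real N))) / sqrt (2 * pi * mid_sum z \<delta> N))"
        using elim(1) conjunct2[OF elim(2)] by (rule mult_right_mono)
      then show ?case using conjunct1[OF elim(2)] elim(3) by linarith
    qed
  qed
  moreover have "\<forall>\<^sub>F N in sequentially. D N = max_density z N / (2 * pi * z * ln (ln (real N))) powr (-1/2)"
    using ll
  proof eventually_elim
    case (elim N)
    define x where "x = 2 * pi * z * ln (ln (real N))"
    have "x \<ge> 0" using elim z by (simp add: x_def)
    then have "x powr (-1/2) = inverse (sqrt x)"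
      using powr_minus[of x "1 / 2"] by (simp add: powr_half_sqrt)
    then show ?case unfolding D_def x_def [symmetric] by (simp only: divide_inverse inverse_inverse_eq)
  qed
  ultimately show "(\<lambda>N. max_density z N / (2 * pi * z * ln (ln (real N))) powr (-1/2)) \<longlonglongrightarrow> 1"
    by (rule Lim_transform_eventually)
qed

theorem theorem7:
  shows "(\<forall>z::real. 0 < z \<and> z < 2 \<longrightarrow>
            (\<lambda>N. max_density z N) \<sim>[at_top]
              (\<lambda>N::nat. (2 * pi * z * ln (ln (real N))) powr (-1/2)))
       \<and> (\<lambda>N. max_density 2 N) \<in> \<Theta>[at_top](\<lambda>N::nat. 1 / ln (real N))
       \<and> (\<forall>z::real. z > 2 \<longrightarrow>
            (\<exists>C>0. \<exists>N\<^sub>0::nat. \<forall>N>N\<^sub>0. max_density z N \<ge> C)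
          \<and> (0 < (1 - 2 / z) / 3 \<and> (\<forall>N>4. max_density z N \<ge> (1 - 2 / z) / 3)))"
proof (intro conjI allI impI)
  fix z :: real assume "0 < z \<and> z < 2"
  then show "(\<lambda>N. max_density z N) \<sim>[at_top] (\<lambda>N::nat. (2 * pi * z * ln (ln (real N))) powr (-1/2))"
    using max_density_subcritical by blast
next
  show "(\<lambda>N. max_density 2 N) \<in> \<Theta>[at_top](\<lambda>N::nat. 1 / ln (real N))"
    by (rule max_density_critical)
next
  fix z :: real assume z: "z > 2"
  show pos: "0 < (1 - 2 / z) / 3" using z by simp
  have le: "(1 - 2 / z) / 3 \<le> max_density z N" if "N > 4" for N
  proof -
    have "c / 3 \<le> c" if "0 < c / 3" for c :: real using that by simp
    then have "(1 - 2 / z) / 3 \<le> 1 - 2 / z" using pos .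
    also have "\<dots> \<le> max_density z N" using z that by (intro max_density_supercritical) auto
    finally show ?thesis .
  qed
  then show "(1 - 2 / z) / 3 \<le> max_density z N" if "N > 4" for N using that .
  show "\<exists>C>0. \<exists>N\<^sub>0::nat. \<forall>N>N\<^sub>0. max_density z N \<ge> C"
    using pos le by blast
qed

end
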